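(* For $\tau,w\in\mathbb{H}$ with $\tau\ne w$ define $$\widehat{\Psi} (\tau,w) := \frac{\sqrt{3}}{2 \pi} \int_\tau^{w} \left(\ {}_{*}\!\!\int_{\tau}^{w_1} \frac{h(\bm w)}{(i(w_2-\tau))^{\frac 32}}\, dw_2\right) \frac{dw_1}{\sqrt{i(w_1-\tau)}},$$ where $h (\bm w ) := \vartheta_{3,1}^{[1]} (w_1)\, \vartheta_{1,1} (w_2) - \vartheta_{3,2}^{[1]} (w_1)\, \vartheta_{1,0} (w_2)$. Then for $M = \begin{pmatrix}a & b\\ c & d\end{pmatrix}\in \mathrm{SL}_2(\mathbb{Z})$ we have $$\widehat{\Psi} \left( \frac{a \tau + b}{c \tau + d}, \frac{a w + b}{c w + d} \right)=\nu_{\eta}(M)^{8}\, (c\tau +d)^2 \, \widehat{\Psi}(\tau,w).$$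
   Context: $\mathbb{H}$ is the upper half-plane; $q=e^{2\pi i\tau}$; $\bm w=(w_1,w_2)$. For $m\in\mathbb{Z}_{>0}$, $r\in\mathbb{Z}$, $k\in\mathbb{N}_0$: $\vartheta_{m,r}^{[k]}(\tau)=\sum_{n\in\mathbb{Z}+\frac{r}{2m}}n^k q^{mn^2}$ and $\vartheta_{m,r}=\vartheta_{m,r}^{[0]}$. $\nu_\eta$ is the multiplier system of $\eta(\tau)=q^{1/24}\prod_{n\ge1}(1-q^n)$, i.e. $\eta\left(\frac{a\tau+b}{c\tau+d}\right)=\nu_\eta(M)(c\tau+d)^{1/2}\eta(\tau)$. Square roots are principal and $(x)^{3/2}=(\sqrt{x})^3$. All integrals (and one-sided limits) are taken along the hyperbolic geodesic from $\tau$ to $w$. For $w_1\in\mathbb{H}\setminus\{\tau\}$ the regularized integral is $${}_{*}\!\!\int_{\tau}^{w_1} \frac{f(w_2)}{(i (w_2-\tau))^{\frac{3}{2}}}\, dw_2 := \lim_{\mathfrak z \to \tau} \left(\int_{\mathfrak z}^{w_1} \frac{f(w_2)}{(i (w_2-\tau))^{\frac{3}{2}}}\, dw_2+ 2 i\, \frac{f(\tau)}{\sqrt{i(\mathfrak z-\tau)}}\right),$$ with integral and limit along the hyperbolic geodesic from $\tau$ to $w_1$. *)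

theory Defs
  imports "HOL-Complex_Analysis.Complex_Analysis"
begin

definition upper_half_plane :: "complex set" where
  "upper_half_plane = {z. Im z > 0}"

text \<open>
  The sum over \<open>n \<in> \<int> + r/(2m)\<close> of \<open>n ^ k * q ^ (m n^2)\<close>, indexed by the integer part \<open>l\<close> of
  \<open>n = l + r/(2m)\<close>.
\<close>

definition theta :: "nat \<Rightarrow> int \<Rightarrow> nat \<Rightarrow> complex \<Rightarrow> complex" where
  "theta m r k \<tau> =
     (\<Sum>\<^sub>\<infinity>l::int. let n = (of_int l + of_int r / (2 * of_nat m) :: complex)
        in n ^ k * exp (2 * of_real pi * \<i> * of_nat m * n\<^sup>2 * \<tau>))"

definition dedekind_eta :: "complex \<Rightarrow> complex" where
  "dedekind_eta \<tau> =
     exp (2 * of_real pi * \<i> * \<tau> / 24) *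
     (\<Prod>n. 1 - exp (2 * of_real pi * \<i> * \<tau>) ^ Suc n)"

definition nu_eta :: "int \<Rightarrow> int \<Rightarrow> int \<Rightarrow> int \<Rightarrow> complex" where
  "nu_eta a b c d =
     (THE \<nu>. \<forall>\<tau>\<in>upper_half_plane.
        dedekind_eta (moebius (of_int a) (of_int b) (of_int c) (of_int d) \<tau>) =
          \<nu> * csqrt (of_int c * \<tau> + of_int d) * dedekind_eta \<tau>)"

text \<open>
  The hyperbolic geodesic from \<open>z\<close> to \<open>w\<close>, parametrised by \<open>[0,1]\<close>: the Cayley transform
  \<open>p \<mapsto> (p - z) / (p - cnj z)\<close> maps the upper half-plane isometrically onto the unit disc and sends
  \<open>z\<close> to 0, where geodesics are radii; the path below is the preimage of the straight segment from
  0 to the image \<open>u\<close> of \<open>w\<close>. The lemmas show that it is an injective path in the upper half-plane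
  from \<open>z\<close> to \<open>w\<close> inside a circle centred on the real axis or a vertical line.
\<close>

definition hgeodesic :: "complex \<Rightarrow> complex \<Rightarrow> real \<Rightarrow> complex" where
  "hgeodesic z w t =
     (let u = (w - z) / (w - cnj z) in (z - cnj z * (of_real t * u)) / (1 - of_real t * u))"

lemma norm_cayley_less_1:
  assumes "Im z > 0" "Im w > 0"
  shows "norm ((w - z) / (w - cnj z)) < 1"
proof -
  have "(norm (w - z))\<^sup>2 < (norm (w - cnj z))\<^sup>2"
    using assms unfolding cmod_power2 by (simp add: power2_eq_square algebra_simps)
  then have "norm (w - z) < norm (w - cnj z)"
    by (rule power_less_imp_less_base) simp
  moreover from this have "norm (w - cnj z) > 0"
    using norm_ge_zero[of "w - z"] by linarith
  ultimately show ?thesis by (simp add: norm_divide)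
qed

lemma hgeodesic_denom_nonzero:
  assumes "Im z > 0" "Im w > 0" "t \<in> {0..1}"
  shows "norm (of_real t * ((w - z) / (w - cnj z))) < 1"
    and "1 - of_real t * ((w - z) / (w - cnj z)) \<noteq> 0"
proof -
  have "norm (of_real t * ((w - z) / (w - cnj z))) \<le> 1 * norm ((w - z) / (w - cnj z))"
    unfolding norm_mult using assms by (intro mult_right_mono) auto
  also have "\<dots> < 1" using norm_cayley_less_1[OF assms(1,2)] by simp
  finally show *: "norm (of_real t * ((w - z) / (w - cnj z))) < 1" .
  then show "1 - of_real t * ((w - z) / (w - cnj z)) \<noteq> 0" by fastforce
qed

text \<open>Applying the Cayley transform to the path gives the radius back.\<close>

lemma hgeodesic_cayley:
  assumes "Im z > 0" "Im w > 0" "t \<in> {0..1}"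
  shows "hgeodesic z w t \<noteq> cnj z"
    and "(hgeodesic z w t - z) / (hgeodesic z w t - cnj z) = of_real t * ((w - z) / (w - cnj z))"
proof -
  define v where "v = of_real t * ((w - z) / (w - cnj z))"
  have nz: "1 - v \<noteq> 0" using hgeodesic_denom_nonzero(2)[OF assms] by (simp add: v_def)
  have zz: "z - cnj z \<noteq> 0" using assms(1) by (auto simp: complex_eq_iff)
  have g: "hgeodesic z w t = (z - cnj z * v) / (1 - v)" by (simp add: hgeodesic_def Let_def v_def)
  have 1: "hgeodesic z w t - cnj z = (z - cnj z) / (1 - v)"
    unfolding g using nz by (simp add: field_simps)
  have 2: "hgeodesic z w t - z = v * (z - cnj z) / (1 - v)"
    unfolding g using nz by (simp add: field_simps)
  show "hgeodesic z w t \<noteq> cnj z" using 1 nz zz by auto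
  show "(hgeodesic z w t - z) / (hgeodesic z w t - cnj z) = of_real t * ((w - z) / (w - cnj z))"
    unfolding 1 2 v_def[symmetric] using nz zz by simp
qed

lemma hgeodesic_endpoints:
  assumes "Im z > 0" "Im w > 0"
  shows "pathstart (hgeodesic z w) = z" "pathfinish (hgeodesic z w) = w"
proof -
  show "pathstart (hgeodesic z w) = z" by (simp add: pathstart_def hgeodesic_def)
  have wz: "w - cnj z \<noteq> 0" using assms by (auto simp: complex_eq_iff)
  have zz: "z - cnj z \<noteq> 0" using assms(1) by (auto simp: complex_eq_iff)
  have "1 - (w - z) / (w - cnj z) = (z - cnj z) / (w - cnj z)"
    using wz by (simp add: field_simps)
  moreover have "z - cnj z * ((w - z) / (w - cnj z)) = w * (z - cnj z) / (w - cnj z)"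
    using wz by (simp add: field_simps)
  ultimately show "pathfinish (hgeodesic z w) = w"
    using wz zz by (simp add: pathfinish_def hgeodesic_def Let_def)
qed

lemma hgeodesic_in_upper_half_plane:
  assumes "Im z > 0" "Im w > 0" "t \<in> {0..1}"
  shows "hgeodesic z w t \<in> upper_half_plane"
proof -
  define p where "p = hgeodesic z w t"
  have "norm ((p - z) / (p - cnj z)) < 1"
    using hgeodesic_denom_nonzero(1)[OF assms] hgeodesic_cayley(2)[OF assms] by (simp add: p_def)
  moreover have "p - cnj z \<noteq> 0" using hgeodesic_cayley(1)[OF assms] by (simp add: p_def)
  ultimately have "norm (p - z) < norm (p - cnj z)" by (simp add: norm_divide)
  then have "(norm (p - z))\<^sup>2 < (norm (p - cnj z))\<^sup>2" by (intro power_strict_mono) auto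
  then have "Im z * Im p > 0" unfolding cmod_power2 by (simp add: power2_eq_square algebra_simps)
  then show ?thesis using assms(1) by (simp add: upper_half_plane_def p_def zero_less_mult_iff)
qed

lemma arc_hgeodesic:
  assumes "Im z > 0" "Im w > 0" "z \<noteq> w"
  shows "arc (hgeodesic z w)"
  unfolding arc_def path_def
proof
  show "continuous_on {0..1} (hgeodesic z w)"
    unfolding hgeodesic_def Let_def using hgeodesic_denom_nonzero(2)[OF assms(1,2)]
    by (intro continuous_intros) auto
  have "w - cnj z \<noteq> 0" using assms by (auto simp: complex_eq_iff)
  then have u: "(w - z) / (w - cnj z) \<noteq> 0" using assms by auto
  show "inj_on (hgeodesic z w) {0..1}"
  proof (rule inj_onI)
    fix s t :: real
    assume st: "s \<in> {0..1}" "t \<in> {0..1}" "hgeodesic z w s = hgeodesic z w t"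
    have "complex_of_real s * ((w - z) / (w - cnj z)) = of_real t * ((w - z) / (w - cnj z))"
      using hgeodesic_cayley(2)[OF assms(1,2) st(1)] hgeodesic_cayley(2)[OF assms(1,2) st(2)] st(3)
      by metis
    then show "s = t" using u by simp
  qed
qed

lemma hgeodesic_circle:
  assumes "Im z > 0" "Im w > 0" "z \<noteq> w"
  obtains A B C :: real
    where "A \<noteq> 0 \<or> B \<noteq> 0"
      and "\<And>t. t \<in> {0..1} \<Longrightarrow>
             A * (norm (hgeodesic z w t))\<^sup>2 + B * Re (hgeodesic z w t) + C = 0"
proof -
  define u where "u = (w - z) / (w - cnj z)"
  have wz: "w - cnj z \<noteq> 0" using assms by (auto simp: complex_eq_iff)
  then have u0: "u \<noteq> 0" using assms by (auto simp: u_def)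
  show thesis
  proof (rule that[of "Im (cnj u)" "-2 * Im (cnj u * z)" "Im (cnj u * z\<^sup>2)"])
    show "Im (cnj u) \<noteq> 0 \<or> -2 * Im (cnj u * z) \<noteq> 0"
      using u0 assms(1) by (auto simp: complex_eq_iff)
  next
    fix t :: real assume t: "t \<in> {0..1}"
    define p where "p = hgeodesic z w t"
    have nz: "p - cnj z \<noteq> 0" and "(p - z) / (p - cnj z) = of_real t * u"
      using hgeodesic_cayley[OF assms(1,2) t] by (simp_all add: p_def u_def)
    then have pz: "p - z = of_real t * u * (p - cnj z)" by (simp add: field_simps)
    have "cnj u * ((p - z) * cnj (p - cnj z)) =
            of_real t * (u * cnj u) * ((p - cnj z) * cnj (p - cnj z))"
      unfolding pz by (simp only: mult_ac)
    also have "\<dots> = of_real (t * (norm u)\<^sup>2 * (norm (p - cnj z))\<^sup>2)"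
      by (simp only: complex_norm_square of_real_mult)
    finally have "Im (cnj u * ((p - z) * cnj (p - cnj z))) = 0" by (simp only: Im_complex_of_real)
    then show "Im (cnj u) * (norm (hgeodesic z w t))\<^sup>2 +
        -2 * Im (cnj u * z) * Re (hgeodesic z w t) + Im (cnj u * z\<^sup>2) = 0"
      unfolding p_def[symmetric] cmod_power2 by (simp add: power2_eq_square algebra_simps)
  qed
qed

text \<open>Roots are principal, with \<open>x^(3/2) = (sqrt x)^3\<close>.\<close>

definition reg_integral :: "(complex \<Rightarrow> complex) \<Rightarrow> complex \<Rightarrow> complex \<Rightarrow> complex" where
  "reg_integral f \<tau> w\<^sub>1 =
     Lim (at \<tau> within path_image (hgeodesic \<tau> w\<^sub>1))
       (\<lambda>z. contour_integral (hgeodesic z w\<^sub>1) (\<lambda>w\<^sub>2. f w\<^sub>2 / csqrt (\<i> * (w\<^sub>2 - \<tau>)) ^ 3)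
             + 2 * \<i> * (f \<tau> / csqrt (\<i> * (z - \<tau>))))"

definition h :: "complex \<Rightarrow> complex \<Rightarrow> complex" where
  "h w\<^sub>1 w\<^sub>2 = theta 3 1 1 w\<^sub>1 * theta 1 1 0 w\<^sub>2 - theta 3 2 1 w\<^sub>1 * theta 1 0 0 w\<^sub>2"

definition Psi_hat :: "complex \<Rightarrow> complex \<Rightarrow> complex" where
  "Psi_hat \<tau> w =
     of_real (sqrt 3 / (2 * pi)) *
     contour_integral (hgeodesic \<tau> w)
       (\<lambda>w\<^sub>1. reg_integral (\<lambda>w\<^sub>2. h w\<^sub>1 w\<^sub>2) \<tau> w\<^sub>1 / csqrt (\<i> * (w\<^sub>1 - \<tau>)))"

end

theory Submission
  imports Defs "HOL-Probability.Probability" "HOL-Real_Asymp.Real_Asymp"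
begin

text \<open>
  Moebius maps of \<open>SL\<^sub>2(\<int>)\<close> carry the parametrised geodesics onto each other, so both contour integrals
  transform by substitution and only the integrands have to be compared. The principal roots
  \<open>\<surd>(\<i>(w - \<tau>))\<close> of the two sides differ from the automorphy factors by a sign that is constant along a
  geodesic from \<open>\<tau>\<close>; it occurs to the fourth power. Replacing \<open>f(M\<tau>) / \<surd>(\<i>(M z - M \<tau>))\<close> by the
  automorphy factor times \<open>f(\<tau>) / \<surd>(\<i>(z - \<tau>))\<close> in the regularising term costs
  \<open>O(\<surd>(z - \<tau>))\<close>, which vanishes in the limit.

  It remains to see that \<open>h\<close> has weight 3/2 and 1/2 in its two variables with multiplier \<open>\<nu>\<^sub>\<eta>\<^sup>8\<close>. For the
  translations this is read off the series. For the inversion it follows from Poisson summation,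
  which also gives the inversion law of \<open>\<eta>\<close> because \<open>\<eta> = \<theta>\<^sub>6\<^sub>,\<^sub>1 - \<theta>\<^sub>6\<^sub>,\<^sub>7\<close> by Euler's
  pentagonal number theorem.
\<close>

section \<open>Hyperbolic geodesics and the branch of the square root\<close>

text \<open>The weights add up as follows. The inner integral divided by the outer root contributes
  \<open>(c \<tau> + d)^2\<close> and one factor \<open>(c w\<^sub>1 + d)^(1/2)\<close>; the weight
  3/2 of \<open>h\<close> in \<open>w\<^sub>1\<close> raises the latter to a square, which cancels
  the Jacobian of \<open>dw\<^sub>1\<close>. \<open>h\<close> is the determinant of the pairs
  \<open>theta 3 1 1\<close>, \<open>theta 3 2 1\<close> and \<open>theta 1 0 0\<close>,
  \<open>theta 1 1 0\<close>. Inversion acts on both pairs by the same matrix of determinant -1, up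
  to automorphy factors, so \<open>h\<close> reproduces itself although its constituents mix.
  \<open>nu_eta\<close> is a definite description, and no closed formula for it is used: the laws of
  eta and of \<open>h\<close> are carried with one common constant through the Euclidean algorithm
  on the bottom row, and the non-vanishing of eta identifies that constant. Two default values shape
  the analysis. \<open>Lim\<close> says something only where a limit exists, which is why an
  explicit primitive is built. The outer integral is never shown to converge, so it is handled only
  by pointwise equality of integrands and scaling by a nonzero constant.\<close>

abbreviation moebius_int :: "int \<Rightarrow> int \<Rightarrow> int \<Rightarrow> int \<Rightarrow> complex \<Rightarrow> complex" where
  "moebius_int a b c d \<equiv> moebius (of_int a) (of_int b) (of_int c) (of_int d)"

section \<open>Moebius maps of integer matrices of determinant 1\<close>

lemma moebius_denom_nonzero:
  fixes a b c d :: int and z :: complex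
  assumes "a * d - b * c = 1" "Im z \<noteq> 0"
  shows "of_int c * z + of_int d \<noteq> 0"
proof
  assume *: "of_int c * z + of_int d = 0"
  then have "Im (of_int c * z + of_int d) = 0" by simp
  then have "c = 0" using assms(2) by simp
  with * assms(1) show False by simp
qed

lemma of_int_det:
  fixes a b c d :: int
  assumes "a * d - b * c = 1"
  shows "of_int a * of_int d - of_int b * of_int c = (1::complex)"
  using arg_cong[OF assms, of "of_int :: int \<Rightarrow> complex"] by simp

text \<open>Points are only kept off the real axis, so that conjugates qualify:
  \<open>w = cnj z\<close> yields the imaginary part of the image, and the differences to
  \<open>z\<close> and to \<open>cnj z\<close> together yield its Cayley quotient.\<close>

lemma moebius_int_diff:
  fixes z w :: complex
  assumes "a * d - b * c = 1" "Im z \<noteq> 0" "Im w \<noteq> 0"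
  shows "moebius_int a b c d z - moebius_int a b c d w =
           (z - w) / ((of_int c * z + of_int d) * (of_int c * w + of_int d))"
proof -
  have "of_int a * of_int d = 1 + of_int b * (of_int c :: complex)"
    using of_int_det[OF assms(1)] by (simp add: algebra_simps)
  then have "(of_int a * z + of_int b) * (of_int c * w + of_int d) -
        (of_int a * w + of_int b) * (of_int c * z + of_int d) = z - w"
    by algebra
  then show ?thesis
    using moebius_denom_nonzero[OF assms(1,2)] moebius_denom_nonzero[OF assms(1,3)]
    by (simp add: moebius_def diff_frac_eq)
qed

lemma cnj_moebius_int: "cnj (moebius_int a b c d z) = moebius_int a b c d (cnj z)"
  by (simp add: moebius_def)

lemma Im_moebius_int_pos:
  assumes "a * d - b * c = 1" "Im z > 0"
  shows "Im (moebius_int a b c d z) > 0"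
proof -
  define j where "j = of_int c * z + of_int d"
  have "j \<noteq> 0" using moebius_denom_nonzero[OF assms(1)] assms(2) by (simp add: j_def)
  have "moebius_int a b c d z - cnj (moebius_int a b c d z) =
          (z - cnj z) / (j * cnj j)"
    using moebius_int_diff[OF assms(1), of z "cnj z"] assms(2)
    by (simp add: cnj_moebius_int j_def)
  also have "\<dots> = of_real (2 * Im z / (norm j)\<^sup>2) * \<i>"
    by (simp only: complex_diff_cnj complex_norm_square[symmetric]) (simp add: field_simps)
  finally have "Im (moebius_int a b c d z - cnj (moebius_int a b c d z)) = 2 * Im z / (norm j)\<^sup>2"
    by simp
  moreover have "2 * Im z / (norm j)\<^sup>2 > 0" using \<open>j \<noteq> 0\<close> assms(2) by simp
  ultimately show ?thesis by simp
qed

lemma moebius_int_has_field_derivative: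
  assumes "a * d - b * c = 1" "Im z \<noteq> 0"
  shows "(moebius_int a b c d has_field_derivative 1 / (of_int c * z + of_int d)\<^sup>2) (at z within S)"
proof -
  have nz: "of_int c * z + of_int d \<noteq> 0" by (rule moebius_denom_nonzero[OF assms])
  have "of_int a * of_int d = 1 + of_int b * (of_int c :: complex)"
    using of_int_det[OF assms(1)] by (simp add: algebra_simps)
  then have "of_int a * (of_int c * z + of_int d) - (of_int a * z + of_int b) * of_int c = 1"
    by algebra
  then show ?thesis unfolding moebius_def using nz
    by (auto intro!: derivative_eq_intros simp: power2_eq_square)
qed

section \<open>Geodesics under Moebius maps, and their subarcs\<close>

lemma hgeodesic_unique:
  assumes "Im z \<noteq> 0" "p \<noteq> cnj z"
    and "(p - z) / (p - cnj z) = of_real t * ((w - z) / (w - cnj z))"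
  shows "p = hgeodesic z w t"
proof -
  define v where "v = of_real t * ((w - z) / (w - cnj z))"
  have "p - z = v * (p - cnj z)" using assms(2,3) by (simp add: v_def field_simps)
  then have *: "p * (1 - v) = z - cnj z * v" by algebra
  have "z \<noteq> cnj z" using assms(1) by (auto simp: complex_eq_iff)
  then have "1 - v \<noteq> 0" using * by auto
  then have "p = (z - cnj z * v) / (1 - v)" using * by (simp add: field_simps)
  then show ?thesis by (simp only: hgeodesic_def Let_def v_def)
qed

text \<open>The Cayley quotients at \<open>z\<close> and at its image differ by the factor
  \<open>j (cnj z) / j z\<close>, a rotation that is the same for every point. Radii therefore go to
  radii with the same parameter.\<close>

lemma moebius_int_hgeodesic:
  assumes det: "a * d - b * c = 1" and z: "Im z > 0" and w: "Im w > 0" and t: "t \<in> {0..1}"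
  shows "hgeodesic (moebius_int a b c d z) (moebius_int a b c d w) t =
         moebius_int a b c d (hgeodesic z w t)"
proof (rule hgeodesic_unique[symmetric])
  let ?M = "moebius_int a b c d"
  define p where "p = hgeodesic z w t"
  define j where "j = (\<lambda>x. of_int c * x + of_int d :: complex)"
  have p: "Im p > 0"
    using hgeodesic_in_upper_half_plane[OF z w t] by (simp add: p_def upper_half_plane_def)
  have pos: "Im (?M z) > 0" "Im (?M p) > 0" using Im_moebius_int_pos[OF det] z p by auto
  then show "Im (?M z) \<noteq> 0" "?M (hgeodesic z w t) \<noteq> cnj (?M z)"
    by (auto simp: p_def[symmetric] complex_eq_iff)
  have jnz: "j x \<noteq> 0" if "Im x \<noteq> 0" for x
    using moebius_denom_nonzero[OF det that] by (simp add: j_def)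
  have ratio: "(?M x - ?M z) / (?M x - cnj (?M z)) = (x - z) / (x - cnj z) * (j (cnj z) / j z)"
    if "Im x > 0" for x
  proof -
    have "?M x - ?M z = (x - z) / (j x * j z)" "?M x - ?M (cnj z) = (x - cnj z) / (j x * j (cnj z))"
      using moebius_int_diff[OF det, of x] z that by (simp_all add: j_def)
    moreover have "j x \<noteq> 0" "j z \<noteq> 0" "j (cnj z) \<noteq> 0" using that z by (auto intro!: jnz)
    ultimately show ?thesis by (simp add: cnj_moebius_int)
  qed
  show "(?M (hgeodesic z w t) - ?M z) / (?M (hgeodesic z w t) - cnj (?M z)) =
          of_real t * ((?M w - ?M z) / (?M w - cnj (?M z)))"
    using hgeodesic_cayley(2)[OF z w t] ratio[OF p] ratio[OF w] by (simp add: p_def)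
qed

lemma hgeodesic_eq:
  assumes "Im z > 0" "Im w > 0" "t \<in> {0..1}"
  shows "hgeodesic z w t = cnj z + 2 * \<i> * of_real (Im z) / (1 - of_real t * ((w - z) / (w - cnj z)))"
proof -
  define v where "v = of_real t * ((w - z) / (w - cnj z))"
  have "1 - v \<noteq> 0" using hgeodesic_denom_nonzero(2)[OF assms] by (simp add: v_def)
  moreover have "2 * \<i> * of_real (Im z) = z - cnj z" by (simp add: complex_diff_cnj mult_ac)
  ultimately show ?thesis unfolding hgeodesic_def Let_def v_def[symmetric]
    by (simp add: field_simps)
qed

lemma hgeodesic_diff:
  assumes "Im z > 0" "Im w > 0" "t \<in> {0..1}"
  defines "v \<equiv> of_real t * ((w - z) / (w - cnj z))"
  shows "hgeodesic z w t - z = 2 * \<i> * of_real (Im z) * v / (1 - v)"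
proof -
  have "1 - v \<noteq> 0" using hgeodesic_denom_nonzero(2)[OF assms(1-3)] by (simp add: v_def)
  moreover have *: "2 * \<i> * of_real (Im z) = z - cnj z" by (simp add: complex_diff_cnj mult_ac)
  ultimately show ?thesis unfolding hgeodesic_def Let_def v_def[symmetric] *
    by (simp add: field_simps)
qed

text \<open>In the disc centred at \<open>z\<close> the arc is a radius. Recentring at the point
  with parameter \<open>s\<close> gives the point with parameter \<open>x\<close> the real factor
  \<open>(x - s) / (1 - s * x * N)\<close> times a constant, so the remaining piece is again a
  radius.\<close>

lemma hgeodesic_subarc:
  assumes z: "Im z > 0" and w: "Im w > 0" and s: "s \<in> {0..<1}"
  shows "path_image (hgeodesic (hgeodesic z w s) w) \<subseteq> hgeodesic z w ` {s..1}"
  unfolding path_image_def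
proof (rule image_subsetI)
  fix r :: real assume r: "r \<in> {0..1}"
  define u where "u = (w - z) / (w - cnj z)"
  define N where "N = (norm u)\<^sup>2"
  have N: "0 \<le> N" "N < 1" using norm_cayley_less_1[OF z w]
    by (simp_all add: N_def u_def abs_square_less_1)
  have sN: "s * N < 1" using s N mult_mono[of s 1 N N] by auto
  define \<kappa> where "\<kappa> = (1 - s) / (1 - s * N)"
  have \<kappa>: "\<kappa> \<ge> 0" "\<kappa> * (1 - s * N) = 1 - s" using sN s by (simp_all add: \<kappa>_def)
  \<comment> \<open>The point sought must have the real factor \<open>r * \<kappa>\<close>, where
    \<open>\<kappa>\<close> is the factor of \<open>w\<close>; \<open>t\<close> is the solution of
    \<open>(t - s) / (1 - s * t * N) = r * \<kappa>\<close>.\<close>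
  define t where "t = (s + r * \<kappa>) / (1 + r * \<kappa> * s * N)"
  have den: "1 + r * \<kappa> * s * N > 0"
    using r s N \<kappa> by (intro add_pos_nonneg mult_nonneg_nonneg) auto
  have "r * (1 - s) \<le> 1 - s" using r s by (simp add: mult_left_le_one_le)
  then have "r * \<kappa> * (1 - s * N) \<le> 1 - s" using \<kappa>(2) by (metis mult.assoc)
  then have t1: "t \<le> 1" unfolding t_def using den by (simp add: algebra_simps)
  have "s * s * N \<le> 1" using s N by (intro mult_le_one) auto
  then have "r * \<kappa> * (s * s * N) \<le> r * \<kappa> * 1" using r \<kappa> by (intro mult_left_mono) auto
  then have ts: "s \<le> t" unfolding t_def using den by (simp add: field_simps)
  have t: "t \<in> {0..1}" "s \<in> {0..1}" using t1 ts s by auto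
  have "t * (1 + r * \<kappa> * s * N) = s + r * \<kappa>" using den by (simp add: t_def)
  then have key: "t - s = r * \<kappa> * (1 - s * t * N)" by algebra
  have stN: "s * t * N < 1" using t N mult_mono[of "s * t" 1 N N] mult_le_one[of s t] by auto
  define y where "y = 2 * \<i> * complex_of_real (Im z)"
  have y: "y \<noteq> 0" using z by (simp add: y_def)
  have nz: "1 - of_real x * u \<noteq> 0" "1 - of_real x * cnj u \<noteq> 0" if "x \<in> {0..1}" for x
  proof -
    show *: "1 - of_real x * u \<noteq> 0"
      using hgeodesic_denom_nonzero(2)[OF z w that] by (simp add: u_def)
    show "1 - of_real x * cnj u \<noteq> 0"
      using * by (metis complex_cnj_cnj complex_cnj_complex_of_real complex_cnj_diff complex_cnj_mult
          complex_cnj_one complex_cnj_zero)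
  qed
  have X: "hgeodesic z w x = cnj z + y / (1 - of_real x * u)" if "x \<in> {0..1}" for x
    using hgeodesic_eq[OF z w that] by (simp add: u_def y_def)
  have zy: "z = cnj z + y" by (simp add: y_def complex_eq_iff)
  define q where "q = hgeodesic z w s"
  have cq: "cnj q = cnj z + y - y / (1 - of_real s * cnj u)"
    using X[OF t(2)] zy by (simp add: q_def y_def)
  have Nu: "complex_of_real N = u * cnj u" by (simp only: N_def complex_norm_square)
  have ratio: "(hgeodesic z w x - q) / (hgeodesic z w x - cnj q) =
      of_real ((x - s) / (1 - s * x * N)) * (u * (1 - of_real s * cnj u) / (1 - of_real s * u))"
    if x: "x \<in> {0..1}" for x
  proof -
    have D: "hgeodesic z w x - q = y * (of_real (x - s) * u) / ((1 - of_real x * u) * (1 - of_real s * u))"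
      unfolding q_def X[OF x] X[OF t(2)] using nz(1)[OF x] nz(1)[OF t(2)] by (simp add: field_simps)
    have M: "hgeodesic z w x - cnj q = y * (1 - of_real s * of_real x * of_real N) /
            ((1 - of_real x * u) * (1 - of_real s * cnj u))"
      unfolding cq X[OF x] Nu using nz(1)[OF x] nz(2)[OF t(2)] by (simp add: field_simps)
    have "s * x * N < 1" using x t N mult_mono[of "s * x" 1 N N] mult_le_one[of s x] by auto
    then have sxN: "complex_of_real (1 - s * x * N) \<noteq> 0" by (subst of_real_eq_0_iff) simp
    have "1 - of_real s * of_real x * of_real N = complex_of_real (1 - s * x * N)" by simp
    from M[unfolded this] have E: "hgeodesic z w x - cnj q = y * complex_of_real (1 - s * x * N) /
            ((1 - of_real x * u) * (1 - of_real s * cnj u))" .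
    show ?thesis unfolding D E of_real_divide using y nz(1)[OF x] nz(2)[OF t(2)] nz(1)[OF t(2)] sxN
      by (simp add: divide_simps del: of_real_diff of_real_mult)
  qed
  have q: "Im q > 0" and p: "Im (hgeodesic z w t) > 0"
    using hgeodesic_in_upper_half_plane[OF z w] t by (simp_all add: q_def upper_half_plane_def)
  have w1: "hgeodesic z w 1 = w" using hgeodesic_endpoints(2)[OF z w] by (simp add: pathfinish_def)
  have "(t - s) / (1 - s * t * N) = r * ((1 - s) / (1 - s * 1 * N))"
    unfolding key using stN by (simp add: \<kappa>_def)
  then have "(hgeodesic z w t - q) / (hgeodesic z w t - cnj q) = of_real r * ((w - q) / (w - cnj q))"
    using ratio[OF t(1)] ratio[of 1] w1 by simp
  moreover have "hgeodesic z w t \<noteq> cnj q" using p q by (auto simp: complex_eq_iff)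
  ultimately have "hgeodesic z w t = hgeodesic q w r"
    using q by (intro hgeodesic_unique) auto
  then show "hgeodesic (hgeodesic z w s) w r \<in> hgeodesic z w ` {s..1}"
    using t1 ts by (auto simp: q_def intro: image_eqI[of _ _ t])
qed

text \<open>
  The branch cut of \<open>csqrt (\<i> * (p - z))\<close> is the vertical ray above \<open>z\<close>. A geodesic from \<open>z\<close> either
  avoids it or runs inside it, so the root is differentiable along the geodesic in both cases.
\<close>

lemma hgeodesic_vertical_cases:
  assumes z: "Im z > 0" and w: "Im w > 0" and "z \<noteq> w"
  obtains "\<And>p. p \<in> hgeodesic z w ` {0<..1} \<Longrightarrow> \<i> * (p - z) \<notin> \<real>\<^sub>\<le>\<^sub>0"
  | "\<And>p. p \<in> hgeodesic z w ` {0<..1} \<Longrightarrow> \<exists>x>0. \<i> * (p - z) = - of_real x"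
proof -
  define u where "u = (w - z) / (w - cnj z)"
  define y where "y = Im z"
  have y: "y > 0" using z by (simp add: y_def)
  have "w - cnj z \<noteq> 0" using assms by (auto simp: complex_eq_iff)
  then have u0: "u \<noteq> 0" using assms by (auto simp: u_def)
  have nz: "norm (of_real t * u) < 1" "1 - of_real t * u \<noteq> 0" if "t \<in> {0<..1}" for t
    using hgeodesic_denom_nonzero[OF z w, of t] that by (simp_all add: u_def)
  have E: "\<i> * (hgeodesic z w t - z) = - (2 * of_real y * of_real t * u / (1 - of_real t * u))"
    if "t \<in> {0<..1}" for t
  proof -
    have "\<i> * (hgeodesic z w t - z) = (\<i> * \<i>) * (2 * of_real y * of_real t * u / (1 - of_real t * u))"
      using hgeodesic_diff[OF z w, of t] that unfolding u_def[symmetric] y_def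
      by (simp only: mult_ac times_divide_eq_right times_divide_eq_left) (simp add: mult_ac)
    then show ?thesis by simp
  qed
  show thesis
  proof (cases "\<exists>x>0. u = of_real x")
    case True
    then obtain x where x: "x > 0" "u = of_real x" by auto
    show thesis
    proof (rule that(2))
      fix p assume "p \<in> hgeodesic z w ` {0<..1}"
      then obtain t where t: "t \<in> {0<..1}" "p = hgeodesic z w t" by auto
      have "norm (of_real (t * x) :: complex) < 1" using nz(1)[OF t(1)] x by simp
      then have tx: "t * x < 1" unfolding norm_of_real by linarith
      have "\<i> * (p - z) = - of_real (2 * y * t * x / (1 - t * x))"
        using E[OF t(1)] by (simp add: x t)
      moreover have "2 * y * t * x / (1 - t * x) > 0" using y x t tx by simp
      ultimately show "\<exists>x>0. \<i> * (p - z) = - of_real x" by blast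
    qed
  next
    case False
    show thesis
    proof (rule that(1))
      fix p assume "p \<in> hgeodesic z w ` {0<..1}"
      then obtain t where t: "t \<in> {0<..1}" "p = hgeodesic z w t" by auto
      show "\<i> * (p - z) \<notin> \<real>\<^sub>\<le>\<^sub>0"
      proof
        assume "\<i> * (p - z) \<in> \<real>\<^sub>\<le>\<^sub>0"
        then obtain \<rho> where \<rho>: "\<rho> \<le> 0" "\<i> * (p - z) = of_real \<rho>"
          by (auto elim!: nonpos_Reals_cases)
        then have "2 * of_real y * of_real t * u / (1 - of_real t * u) = - of_real \<rho>"
          using E[OF t(1)] t(2) by (simp add: minus_equation_iff)
        then have "2 * of_real y * of_real t * u = - of_real \<rho> * (1 - of_real t * u)"
          using nz(2)[OF t(1)] by (simp add: field_simps)
        then have eq: "u * of_real (t * (2 * y - \<rho>)) = of_real (- \<rho>)"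
          by (simp add: algebra_simps)
        have pos: "t * (2 * y - \<rho>) > 0" using t y \<rho> by (intro mult_pos_pos) auto
        then have "u = of_real (- \<rho> / (t * (2 * y - \<rho>)))"
          using eq by (metis less_irrefl nonzero_eq_divide_eq of_real_divide of_real_eq_0_iff)
        moreover have "- \<rho> / (t * (2 * y - \<rho>)) \<ge> 0"
          using pos \<rho>(1) by (intro divide_nonneg_nonneg) auto
        ultimately have "u = 0" using False by (metis less_eq_real_def of_real_0)
        then show False using u0 by simp
      qed
    qed
  qed
qed

lemma csqrt_hgeodesic_has_field_derivative:
  assumes z: "Im z > 0" and w: "Im w > 0" and "z \<noteq> w"
    and p: "p \<in> hgeodesic z w ` {0<..1}"
  shows "((\<lambda>x. csqrt (\<i> * (x - z))) has_field_derivative \<i> / (2 * csqrt (\<i> * (p - z))))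
           (at p within hgeodesic z w ` {0<..1})"
proof (rule hgeodesic_vertical_cases[OF assms(1-3)], goal_cases)
  case 1
  have "((\<lambda>x. \<i> * (x - z)) has_field_derivative \<i>) (at p within hgeodesic z w ` {0<..1})"
    by (auto intro!: derivative_eq_intros)
  then show ?case using 1[OF p] by (rule has_field_derivative_csqrt')
next
  case 2
  \<comment> \<open>Inside the cut the argument is a negative real, so its principal root is
    \<open>\<i>\<close> times the root of a positive number, and that root is differentiable there.
    Differentiating only within the geodesic hides the jump across the cut.\<close>
  have eq: "csqrt (\<i> * (q - z)) = \<i> * csqrt (- \<i> * (q - z))" if "q \<in> hgeodesic z w ` {0<..1}" for q
  proof -
    from 2[OF that] obtain x where x: "x > 0" "\<i> * (q - z) = - of_real x" by blast
    have "csqrt (- of_real x) = \<i> * csqrt (of_real x)"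
      using x(1) by (intro csqrt_unique)
        (auto simp: power_mult_distrib simp flip: of_real_power)
    then show ?thesis by (simp only: x(2) mult_minus_left minus_minus)
  qed
  from 2[OF p] obtain x where x: "x > 0" "\<i> * (p - z) = - of_real x" by blast
  have n: "- \<i> * (p - z) \<notin> \<real>\<^sub>\<le>\<^sub>0"
    unfolding mult_minus_left x(2) minus_minus using x(1) by simp
  have "((\<lambda>x. - \<i> * (x - z)) has_field_derivative - \<i>) (at p within hgeodesic z w ` {0<..1})"
    by (auto intro!: derivative_eq_intros)
  then have "((\<lambda>x. csqrt (- \<i> * (x - z))) has_field_derivative
      - \<i> / (2 * csqrt (- \<i> * (p - z)))) (at p within hgeodesic z w ` {0<..1})"
    using n by (rule has_field_derivative_csqrt')
  from DERIV_cmult[OF this, of \<i>]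
  have D: "((\<lambda>x. \<i> * csqrt (- \<i> * (x - z))) has_field_derivative
       \<i> * (- \<i> / (2 * csqrt (- \<i> * (p - z))))) (at p within hgeodesic z w ` {0<..1})" .
  have "\<i> * (- \<i> / (2 * csqrt (- \<i> * (p - z)))) = \<i> / (2 * csqrt (\<i> * (p - z)))"
    unfolding eq[OF p] by (simp add: field_simps)
  from D[unfolded this] show ?case
    by (rule has_field_derivative_transform_within[OF _ zero_less_one p]) (rule eq[symmetric])
qed

section \<open>The geodesic as a path\<close>

lemma hgeodesic_in_Im_pos:
  assumes "Im z > 0" "Im w > 0" "p \<in> path_image (hgeodesic z w)"
  shows "Im p > 0"
  using assms hgeodesic_in_upper_half_plane by (auto simp: path_image_def upper_half_plane_def)

lemma hgeodesic_0: "hgeodesic z w 0 = z"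
  by (simp add: hgeodesic_def)

lemma hgeodesic_1:
  assumes "Im z > 0" "Im w > 0"
  shows "hgeodesic z w 1 = w"
  using hgeodesic_endpoints(2)[OF assms] by (simp add: pathfinish_def)

lemma hgeodesic_ne_start:
  assumes "Im z > 0" "Im w > 0" "z \<noteq> w" "t \<in> {0<..1}"
  shows "hgeodesic z w t \<noteq> z"
proof
  assume "hgeodesic z w t = z"
  then have "hgeodesic z w t = hgeodesic z w 0" by (simp add: hgeodesic_0)
  moreover have "inj_on (hgeodesic z w) {0..1}" using arc_hgeodesic[OF assms(1-3)] by (simp add: arc_def)
  ultimately have "t = 0" using assms(4) by (auto dest: inj_onD)
  with assms(4) show False by simp
qed

lemma path_image_hgeodesic:
  assumes "Im z > 0" "Im w > 0" "z \<noteq> w"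
  shows "path_image (hgeodesic z w) - {z} = hgeodesic z w ` {0<..1}"
proof -
  have "{0..1} = insert 0 {0<..1::real}" by auto
  then have "path_image (hgeodesic z w) = insert z (hgeodesic z w ` {0<..1})"
    by (simp add: path_image_def hgeodesic_0)
  moreover have "z \<notin> hgeodesic z w ` {0<..1}" using hgeodesic_ne_start[OF assms] by force
  ultimately show ?thesis by auto
qed

lemma continuous_on_hgeodesic:
  assumes "Im z > 0" "Im w > 0"
  shows "continuous_on {0..1} (hgeodesic z w)"
  unfolding hgeodesic_def Let_def using hgeodesic_denom_nonzero(2)[OF assms]
  by (intro continuous_intros) auto

lemma valid_path_hgeodesic:
  assumes "Im z > 0" "Im w > 0"
  shows "valid_path (hgeodesic z w)"
proof -
  define u where "u = (w - z) / (w - cnj z)"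
  define S where "S = {x. 1 - x * u \<noteq> 0}"
  have "open S" unfolding S_def by (intro open_Collect_neq continuous_intros)
  have "path_image (linepath 0 1) \<subseteq> S"
    using hgeodesic_denom_nonzero(2)[OF assms]
    by (auto simp: path_image_def linepath_def S_def u_def scaleR_conv_of_real)
  moreover have "(\<lambda>x. (z - cnj z * (x * u)) / (1 - x * u)) holomorphic_on S"
    unfolding S_def by (intro holomorphic_intros) auto
  ultimately have "valid_path ((\<lambda>x. (z - cnj z * (x * u)) / (1 - x * u)) \<circ> linepath 0 1)"
    using \<open>open S\<close> by (intro valid_path_compose_holomorphic) auto
  also have "(\<lambda>x. (z - cnj z * (x * u)) / (1 - x * u)) \<circ> linepath 0 1 = hgeodesic z w"
    by (auto simp: fun_eq_iff linepath_def hgeodesic_def u_def Let_def scaleR_conv_of_real)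
  finally show ?thesis .
qed

lemma hgeodesic_differentiable:
  assumes "Im z > 0" "Im w > 0" "t \<in> {0..1}"
  shows "hgeodesic z w differentiable (at t within {0..1})"
  unfolding hgeodesic_def Let_def using hgeodesic_denom_nonzero(2)[OF assms]
  by (intro derivative_intros) auto

text \<open>Since the image geodesic carries the same parameter, the chain rule makes the two
  integrands over \<open>{0..1}\<close> equal pointwise. This gives an equivalence for arbitrary
  \<open>f\<close>, with no regularity assumed.\<close>

lemma has_contour_integral_moebius_int:
  assumes det: "a * d - b * c = 1" and z: "Im z > 0" and w: "Im w > 0"
  shows "(f has_contour_integral I) (hgeodesic (moebius_int a b c d z) (moebius_int a b c d w)) \<longleftrightarrow>
         ((\<lambda>p. f (moebius_int a b c d p) / (of_int c * p + of_int d)\<^sup>2) has_contour_integral I) (hgeodesic z w)"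
  unfolding has_contour_integral_def
proof (rule has_integral_cong)
  let ?M = "moebius_int a b c d"
  fix x :: real assume x: "x \<in> {0..1}"
  define g where "g = hgeodesic z w"
  have "Im (g x) > 0" using hgeodesic_in_upper_half_plane[OF z w x]
    by (simp add: g_def upper_half_plane_def)
  then have "(?M has_field_derivative 1 / (of_int c * g x + of_int d)\<^sup>2) (at (g x) within g ` {0..1})"
    by (intro moebius_int_has_field_derivative[OF det]) auto
  moreover have "(g has_vector_derivative vector_derivative g (at x within {0..1})) (at x within {0..1})"
    using hgeodesic_differentiable[OF z w x] vector_derivative_works by (auto simp: g_def)
  ultimately have "(?M \<circ> g has_vector_derivative
      vector_derivative g (at x within {0..1}) * (1 / (of_int c * g x + of_int d)\<^sup>2)) (at x within {0..1})"
    by (intro field_vector_diff_chain_within)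
  then have "(hgeodesic (?M z) (?M w) has_vector_derivative
      vector_derivative g (at x within {0..1}) * (1 / (of_int c * g x + of_int d)\<^sup>2)) (at x within {0..1})"
    by (rule has_vector_derivative_transform[OF x, rotated])
       (simp add: g_def moebius_int_hgeodesic[OF det z w])
  then have "vector_derivative (hgeodesic (?M z) (?M w)) (at x within {0..1}) =
      vector_derivative g (at x within {0..1}) * (1 / (of_int c * g x + of_int d)\<^sup>2)"
    using x by (intro vector_derivative_within_closed_interval) auto
  then show "f (hgeodesic (?M z) (?M w) x) * vector_derivative (hgeodesic (?M z) (?M w)) (at x within {0..1}) =
      f (?M (hgeodesic z w x)) / (of_int c * hgeodesic z w x + of_int d)\<^sup>2 *
        vector_derivative (hgeodesic z w) (at x within {0..1})"
    by (simp add: moebius_int_hgeodesic[OF det z w x] g_def)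
qed

lemma contour_integral_moebius_int:
  assumes "a * d - b * c = 1" "Im z > 0" "Im w > 0"
  shows "contour_integral (hgeodesic (moebius_int a b c d z) (moebius_int a b c d w)) f =
         contour_integral (hgeodesic z w) (\<lambda>p. f (moebius_int a b c d p) / (of_int c * p + of_int d)\<^sup>2)"
  unfolding contour_integral_def contour_integrable_on_def has_contour_integral_moebius_int[OF assms] ..

text \<open>A non-integrable \<open>f\<close> has the junk value 0 on both sides.\<close>

lemma contour_integral_cmult:
  assumes "k \<noteq> 0"
  shows "contour_integral g (\<lambda>x. k * f x) = k * contour_integral g f"
proof (cases "f contour_integrable_on g")
  case True
  then show ?thesis by (rule contour_integral_lmul)
next
  case False
  have "\<not> (\<lambda>x. k * f x) contour_integrable_on g"
  proof
    assume "(\<lambda>x. k * f x) contour_integrable_on g"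
    then have "(\<lambda>x. inverse k * (k * f x)) contour_integrable_on g"
      by (rule contour_integrable_lmul)
    also have "(\<lambda>x. inverse k * (k * f x)) = f" using assms by (simp add: fun_eq_iff)
    finally show False using False by contradiction
  qed
  then show ?thesis using False by (simp add: not_integrable_contour_integral)
qed

text \<open>The quotient \<open>f / g\<close> is continuous with values in \<open>{1, -1}\<close>,
  hence constant on a connected set.\<close>

lemma square_eq_imp_global_sign:
  fixes f g :: "'a::topological_space \<Rightarrow> complex"
  assumes "connected S" "continuous_on S f" "continuous_on S g"
    and sq: "\<And>x. x \<in> S \<Longrightarrow> (f x)\<^sup>2 = (g x)\<^sup>2" and nz: "\<And>x. x \<in> S \<Longrightarrow> g x \<noteq> 0"
  obtains \<epsilon> :: complex where "\<epsilon>\<^sup>2 = 1" "\<And>x. x \<in> S \<Longrightarrow> f x = \<epsilon> * g x"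
proof -
  have "(\<lambda>x. f x / g x) ` S \<subseteq> {1, -1}"
  proof (rule image_subsetI)
    fix x assume "x \<in> S"
    then have "f x = g x \<or> f x = - g x" "g x \<noteq> 0" using sq nz by (auto simp: power2_eq_iff)
    then show "f x / g x \<in> {1, -1}" by auto
  qed
  moreover from this have "finite ((\<lambda>x. f x / g x) ` S)" by (rule finite_subset) simp
  moreover have "continuous_on S (\<lambda>x. f x / g x)" using assms by (intro continuous_intros) auto
  ultimately have "(\<lambda>x. f x / g x) constant_on S"
    using assms(1) by (intro continuous_finite_range_constant)
  then obtain \<epsilon> where \<epsilon>: "\<And>x. x \<in> S \<Longrightarrow> f x / g x = \<epsilon>" by (auto simp: constant_on_def)
  show thesis
  proof (cases "S = {}")
    case True then show thesis by (intro that[of 1]) auto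
  next
    case False
    then have "\<epsilon>\<^sup>2 = 1" using \<epsilon> sq nz by (auto simp flip: \<epsilon> simp: power_divide)
    moreover have "f x = \<epsilon> * g x" if "x \<in> S" for x using \<epsilon>[OF that] nz[OF that] by (simp add: field_simps)
    ultimately show thesis by (rule that)
  qed
qed

text \<open>For \<open>c \<noteq> 0\<close> the argument is never real. For \<open>c = 0\<close> it
  may be a negative number on the cut, but then the function is constant.\<close>

lemma csqrt_linear_holomorphic:
  assumes det: "a * d - b * (c::int) = 1"
  shows "(\<lambda>z. csqrt (of_int c * z + of_int d)) holomorphic_on {z. Im z > 0}"
proof (cases "c = 0")
  case False
  then have "of_int c * z + of_int d \<notin> \<real>\<^sub>\<le>\<^sub>0" if "Im z > 0" for z
    using that by (auto simp: complex_nonpos_Reals_iff)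
  then show ?thesis by (intro holomorphic_intros) auto
qed simp

text \<open>By \<open>moebius_int_diff\<close> the squares of both sides agree. The starting point
  is left out because the roots vanish there; the rest of the geodesic is still connected.\<close>

lemma hgeodesic_sign:
  assumes det: "a * d - b * c = 1" and z: "Im z > 0" and w: "Im w > 0" and "z \<noteq> w"
  obtains \<epsilon> :: complex where "\<epsilon>\<^sup>2 = 1"
    "\<And>p. p \<in> hgeodesic z w ` {0<..1} \<Longrightarrow>
        csqrt (\<i> * (p - z)) = \<epsilon> * (csqrt (\<i> * (moebius_int a b c d p - moebius_int a b c d z)) *
          csqrt (of_int c * p + of_int d) * csqrt (of_int c * z + of_int d))"
proof -
  let ?M = "moebius_int a b c d"
  define S where "S = hgeodesic z w ` {0<..1}"
  have SH: "Im p > 0" if "p \<in> S" for p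
    using that hgeodesic_in_upper_half_plane[OF z w] by (auto simp: S_def upper_half_plane_def)
  have "connected S" unfolding S_def
    using continuous_on_hgeodesic[OF z w]
    by (intro connected_continuous_image) (auto intro: continuous_on_subset)
  moreover have cont: "continuous_on (hgeodesic z' w' ` {0<..1}) (\<lambda>p. csqrt (\<i> * (p - z')))"
    if "Im z' > 0" "Im w' > 0" "z' \<noteq> w'" for z' w'
    using csqrt_hgeodesic_has_field_derivative[OF that] by (intro DERIV_continuous_on)
  note cont[OF z w \<open>z \<noteq> w\<close>, folded S_def]
  moreover have "continuous_on S (\<lambda>p. csqrt (\<i> * (?M p - ?M z)) *
          csqrt (of_int c * p + of_int d) * csqrt (of_int c * z + of_int d))"
  proof (intro continuous_on_mult continuous_on_const)
    have "?M z - ?M w = (z - w) / ((of_int c * z + of_int d) * (of_int c * w + of_int d))"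
      using z w by (intro moebius_int_diff[OF det]) auto
    then have "?M z \<noteq> ?M w"
      using \<open>z \<noteq> w\<close> moebius_denom_nonzero[OF det, of z] moebius_denom_nonzero[OF det, of w] z w by auto
    \<comment> \<open>The image of the arc is itself a geodesic starting at \<open>?M z\<close>, so
      the root is continuous along it even if it runs inside the cut.\<close>
    then have "continuous_on (hgeodesic (?M z) (?M w) ` {0<..1}) (\<lambda>p. csqrt (\<i> * (p - ?M z)))"
      using Im_moebius_int_pos[OF det] z w by (intro cont) auto
    also have "hgeodesic (?M z) (?M w) ` {0<..1} = ?M ` S"
      unfolding S_def image_image by (intro image_cong refl moebius_int_hgeodesic[OF det z w]) auto
    finally have c: "continuous_on (?M ` S) (\<lambda>p. csqrt (\<i> * (p - ?M z)))" .
    have "continuous_on S ?M"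
    proof (rule DERIV_continuous_on)
      fix p assume "p \<in> S"
      then show "(?M has_field_derivative 1 / (of_int c * p + of_int d)\<^sup>2) (at p within S)"
        using SH by (intro moebius_int_has_field_derivative[OF det]) force
    qed
    then show "continuous_on S (\<lambda>p. csqrt (\<i> * (?M p - ?M z)))"
      by (rule continuous_on_compose2[OF c]) auto
    show "continuous_on S (\<lambda>p. csqrt (of_int c * p + of_int d))"
      using csqrt_linear_holomorphic[OF det] SH
      by (intro holomorphic_on_imp_continuous_on) (auto elim!: holomorphic_on_subset)
  qed
  moreover have "(csqrt (\<i> * (p - z)))\<^sup>2 = (csqrt (\<i> * (?M p - ?M z)) *
          csqrt (of_int c * p + of_int d) * csqrt (of_int c * z + of_int d))\<^sup>2" if "p \<in> S" for p
  proof -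
    define A B where "A = of_int c * p + of_int d" and "B = of_int c * z + of_int d"
    have "A \<noteq> 0" "B \<noteq> 0" "?M p - ?M z = (p - z) / (A * B)"
      using moebius_int_diff[OF det, of p z] moebius_denom_nonzero[OF det] SH[OF that] z
      by (simp_all add: A_def B_def)
    then show ?thesis
      unfolding A_def[symmetric] B_def[symmetric] power_mult_distrib power2_csqrt by simp
  qed
  moreover have "csqrt (\<i> * (?M p - ?M z)) *
          csqrt (of_int c * p + of_int d) * csqrt (of_int c * z + of_int d) \<noteq> 0" if "p \<in> S" for p
  proof -
    have "p \<noteq> z" using that hgeodesic_ne_start[OF z w \<open>z \<noteq> w\<close>] by (auto simp: S_def)
    then show ?thesis
    using moebius_int_diff[OF det, of p z] moebius_denom_nonzero[OF det, of p]
      moebius_denom_nonzero[OF det, of z] SH[OF that] z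
      by simp
  qed
  ultimately show thesis using that unfolding S_def by (rule square_eq_imp_global_sign)
qed

section \<open>The regularised integral\<close>

text \<open>
  Substituting \<open>w = \<tau> - \<i> u\<^sup>2\<close> turns \<open>f w / (\<i> (w - \<tau>))\<^sup>3\<^sup>/\<^sup>2 dw\<close> into
  \<open>-2\<i> f (\<tau> - \<i> u\<^sup>2) / u\<^sup>2 du\<close>. The domain of \<open>u\<close> is starlike about 0, so the regular part of the
  integrand has a primitive there.
\<close>

lemma regular_part_primitive:
  assumes hol: "f holomorphic_on {z. Im z > 0}" and \<tau>: "Im \<tau> > 0"
  obtains P where "isCont P 0"
    "\<And>u. Im (\<tau> - \<i> * u\<^sup>2) > 0 \<Longrightarrow> u \<noteq> 0 \<Longrightarrow>
       (P has_field_derivative (f (\<tau> - \<i> * u\<^sup>2) - f \<tau>) / u\<^sup>2) (at u)"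
proof -
  \<comment> \<open>The difference quotient of \<open>f\<close> with its singularity removed;
    \<open>- \<i> * L (\<tau> - \<i> * u\<^sup>2)\<close> extends the regular part of the integrand
    over \<open>u = 0\<close>.\<close>
  define L where "L = (\<lambda>z. if z = \<tau> then deriv f \<tau> else (f z - f \<tau>) / (z - \<tau>))"
  define D where "D = {u. Im (\<tau> - \<i> * u\<^sup>2) > 0}"
  have "open {z. Im z > 0}" by (simp add: open_halfspace_Im_gt)
  then have L: "L holomorphic_on {z. Im z > 0}"
    unfolding L_def using \<tau> by (intro pole_lemma_open hol)
  have oD: "open D" unfolding D_def by (intro open_Collect_less continuous_intros)
  have "(L \<circ> (\<lambda>u. \<tau> - \<i> * u\<^sup>2)) holomorphic_on D"
    by (intro holomorphic_on_compose_gen[OF _ L] holomorphic_intros) (auto simp: D_def)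
  then have K: "(\<lambda>u. - \<i> * L (\<tau> - \<i> * u\<^sup>2)) holomorphic_on D"
    by (intro holomorphic_intros) (simp add: o_def)
  have "starlike D" unfolding starlike_def
  proof (intro bexI ballI subsetI)
    show "0 \<in> D" using \<tau> by (simp add: D_def)
    fix x y assume x: "x \<in> D" and "y \<in> closed_segment 0 x"
    then obtain r where r: "0 \<le> r" "r \<le> 1" "y = of_real r * x"
      by (auto simp: closed_segment_def scaleR_conv_of_real)
    have E: "Im (\<tau> - \<i> * y\<^sup>2) = Im \<tau> - r\<^sup>2 * Re (x\<^sup>2)"
      unfolding r(3) power_mult_distrib of_real_power[symmetric] by simp
    have "r\<^sup>2 \<le> 1" "0 \<le> r\<^sup>2" using r(1,2) by (simp_all add: power_le_one)
    have "r\<^sup>2 * Re (x\<^sup>2) < Im \<tau>"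
    proof (cases "Re (x\<^sup>2) > 0")
      case True
      have "r\<^sup>2 * Re (x\<^sup>2) \<le> 1 * Re (x\<^sup>2)" using True \<open>r\<^sup>2 \<le> 1\<close> by (intro mult_right_mono) auto
      then show ?thesis using x by (simp add: D_def)
    next
      case False
      then have "r\<^sup>2 * Re (x\<^sup>2) \<le> 0" using \<open>0 \<le> r\<^sup>2\<close> by (intro mult_nonneg_nonpos) auto
      then show ?thesis using \<tau> by linarith
    qed
    then show "y \<in> D" using E by (simp add: D_def)
  qed
  then obtain P where P: "\<And>u. u \<in> D \<Longrightarrow> (P has_field_derivative - \<i> * L (\<tau> - \<i> * u\<^sup>2)) (at u)"
    using holomorphic_starlike_primitive[of D "\<lambda>u. - \<i> * L (\<tau> - \<i> * u\<^sup>2)" "{}"] K oD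
    by (auto simp: holomorphic_on_imp_continuous_on holomorphic_on_open field_differentiable_def)
  show thesis
  proof (rule that[of P])
    have "0 \<in> D" using \<tau> by (simp add: D_def)
    then show "isCont P 0" using P DERIV_isCont by blast
    fix u assume u: "Im (\<tau> - \<i> * u\<^sup>2) > 0" "u \<noteq> 0"
    then have "- \<i> * L (\<tau> - \<i> * u\<^sup>2) = (f (\<tau> - \<i> * u\<^sup>2) - f \<tau>) / u\<^sup>2"
      by (simp add: L_def field_simps)
    then show "(P has_field_derivative (f (\<tau> - \<i> * u\<^sup>2) - f \<tau>) / u\<^sup>2) (at u)"
      using P[of u] u by (simp add: D_def)
  qed
qed

lemma path_image_hgeodesic_subset:
  assumes "Im \<tau> > 0" "Im w > 0" "z \<in> hgeodesic \<tau> w ` {0<..1}"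
  shows "path_image (hgeodesic z w) \<subseteq> hgeodesic \<tau> w ` {0<..1}"
proof -
  obtain s where s: "s \<in> {0<..1}" "z = hgeodesic \<tau> w s" using assms(3) by auto
  show ?thesis
  proof (cases "s = 1")
    case True
    then have "z = w" using s hgeodesic_1[OF assms(1,2)] by simp
    moreover from this have "path_image (hgeodesic z w) \<subseteq> {z}"
      by (auto simp: path_image_def hgeodesic_def)
    ultimately show ?thesis using assms(3) by auto
  next
    case False
    then have "path_image (hgeodesic z w) \<subseteq> hgeodesic \<tau> w ` {s..1}"
      using hgeodesic_subarc[OF assms(1,2), of s] s by auto
    also have "\<dots> \<subseteq> hgeodesic \<tau> w ` {0<..1}" using s by (intro image_mono) auto
    finally show ?thesis .
  qed
qed

lemma hgeodesic_islimpt: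
  assumes "Im z > 0" "Im w > 0" "z \<noteq> w"
  shows "z islimpt path_image (hgeodesic z w)"
proof (rule connected_imp_perfect)
  have "arc (hgeodesic z w)" by (rule arc_hgeodesic[OF assms])
  then show "connected (path_image (hgeodesic z w))" by (intro connected_path_image arc_imp_path)
  have "z \<in> path_image (hgeodesic z w)" "w \<in> path_image (hgeodesic z w)"
    using pathstart_in_path_image[of "hgeodesic z w"] pathfinish_in_path_image[of "hgeodesic z w"]
      hgeodesic_endpoints[OF assms(1,2)] by simp_all
  then show "z \<in> path_image (hgeodesic z w)" "\<And>x. path_image (hgeodesic z w) \<noteq> {x}"
    using assms(3) by auto
qed

lemma eventually_at_withinI:
  assumes "\<And>z. z \<in> S \<Longrightarrow> z \<noteq> a \<Longrightarrow> P z"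
  shows "eventually P (at a within S)"
  using assms by (simp add: eventually_at_filter)

text \<open>The primitive \<open>G\<close> splits into a part continuous in the root and a multiple
  of its reciprocal. The second part is exactly the counterterm of the regularisation, so adding
  that term leaves an expression with a limit. \<open>P\<close> and \<open>Q\<close> serve all
  \<open>z\<close> on the arc at once.\<close>

lemma reg_integral_integrand_primitive:
  assumes hol: "f holomorphic_on {z. Im z > 0}"
    and \<tau>: "Im \<tau> > 0" and w: "Im w > 0" and ne: "\<tau> \<noteq> w"
  obtains P Q where "isCont P 0"
    "\<And>z. z \<in> hgeodesic \<tau> w ` {0<..1} \<Longrightarrow>
      ((\<lambda>p. f p / csqrt (\<i> * (p - \<tau>)) ^ 3) has_contour_integral
         Q + 2 * \<i> * P (csqrt (\<i> * (z - \<tau>))) - 2 * \<i> * (f \<tau> / csqrt (\<i> * (z - \<tau>)))) (hgeodesic z w)"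
proof -
  obtain P where P: "isCont P 0" and P':
    "\<And>u. Im (\<tau> - \<i> * u\<^sup>2) > 0 \<Longrightarrow> u \<noteq> 0 \<Longrightarrow>
       (P has_field_derivative (f (\<tau> - \<i> * u\<^sup>2) - f \<tau>) / u\<^sup>2) (at u)"
    using regular_part_primitive[OF hol \<tau>] by blast
  define S where "S = hgeodesic \<tau> w ` {0<..1}"
  define u where "u = (\<lambda>p. csqrt (\<i> * (p - \<tau>)))"
  define G where "G = (\<lambda>p. - 2 * \<i> * P (u p) + 2 * \<i> * (f \<tau> / u p))"
  have G: "(G has_field_derivative f p / u p ^ 3) (at p within S)" if p: "p \<in> S" for p
  proof -
    have "p \<noteq> \<tau>" using p hgeodesic_ne_start[OF \<tau> w ne] by (auto simp: S_def)
    then have u0: "u p \<noteq> 0" by (simp add: u_def)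
    have p_eq: "\<tau> - \<i> * (u p)\<^sup>2 = p" by (simp add: u_def algebra_simps flip: mult.assoc)
    have "Im p > 0"
      using hgeodesic_in_upper_half_plane[OF \<tau> w] p by (auto simp: S_def upper_half_plane_def)
    have u': "(u has_field_derivative \<i> / (2 * u p)) (at p within S)"
      using csqrt_hgeodesic_has_field_derivative[OF \<tau> w ne p[unfolded S_def]]
      unfolding u_def S_def .
    have "((\<lambda>x. P (u x)) has_field_derivative (f p - f \<tau>) / (u p)\<^sup>2 * (\<i> / (2 * u p))) (at p within S)"
      using P'[of "u p"] u0 \<open>Im p > 0\<close> unfolding p_eq by (intro DERIV_chain2[OF _ u']) auto
    then have "(G has_field_derivative - 2 * \<i> * ((f p - f \<tau>) / (u p)\<^sup>2 * (\<i> / (2 * u p))) +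
        2 * \<i> * (f \<tau> * (- (\<i> / (2 * u p)) / (u p)\<^sup>2))) (at p within S)"
      unfolding G_def using u' u0
      by (auto intro!: derivative_eq_intros simp: power2_eq_square) (simp add: algebra_simps)
    also have "- 2 * \<i> * ((f p - f \<tau>) / (u p)\<^sup>2 * (\<i> / (2 * u p))) +
        2 * \<i> * (f \<tau> * (- (\<i> / (2 * u p)) / (u p)\<^sup>2)) = f p / u p ^ 3"
    proof -
      have "- 2 * \<i> * (A / (u p)\<^sup>2 * (\<i> / (2 * u p))) + 2 * \<i> * (B * (- (\<i> / (2 * u p)) / (u p)\<^sup>2)) =
          - (\<i> * \<i>) * (A + B) / u p ^ 3" for A B
        using u0 by (simp add: divide_simps power2_eq_square power3_eq_cube del: complex_i_mult_minus i_squared)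
          (simp add: algebra_simps)
      from this[of "f p - f \<tau>" "f \<tau>"] show ?thesis by simp
    qed
    finally show ?thesis .
  qed
  show thesis
  proof (rule that[OF P, of "G w"])
    fix z assume z: "z \<in> hgeodesic \<tau> w ` {0<..1}"
    have Im: "Im z > 0"
      using hgeodesic_in_upper_half_plane[OF \<tau> w] z by (auto simp: upper_half_plane_def)
    have "((\<lambda>p. f p / u p ^ 3) has_contour_integral G (pathfinish (hgeodesic z w)) -
        G (pathstart (hgeodesic z w))) (hgeodesic z w)"
      using path_image_hgeodesic_subset[OF \<tau> w z] valid_path_hgeodesic[OF Im w]
      by (intro contour_integral_primitive[OF G]) (auto simp: S_def)
    then show "((\<lambda>p. f p / csqrt (\<i> * (p - \<tau>)) ^ 3) has_contour_integral
         G w + 2 * \<i> * P (csqrt (\<i> * (z - \<tau>))) - 2 * \<i> * (f \<tau> / csqrt (\<i> * (z - \<tau>)))) (hgeodesic z w)"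
      unfolding hgeodesic_endpoints[OF Im w] by (simp add: u_def G_def algebra_simps)
  qed
qed

text \<open>The point 0 lies on the boundary of the cut, so continuity there is taken from
  \<open>norm (csqrt x) = sqrt (norm x)\<close>.\<close>

lemma tendsto_csqrt_0:
  assumes "(f \<longlongrightarrow> 0) F"
  shows "((\<lambda>x. csqrt (f x)) \<longlongrightarrow> 0) F"
proof -
  have "((\<lambda>x. sqrt (norm (f x))) \<longlongrightarrow> sqrt (norm (0::complex))) F"
    by (intro tendsto_intros assms)
  then show ?thesis by (intro tendsto_norm_zero_cancel[of "\<lambda>x. csqrt (f x)"]) (simp add: norm_csqrt)
qed

text \<open>\<open>reg_integral\<close> is a \<open>Lim\<close>, which is meaningful only once the
  limit is known to exist and to be unique; uniqueness holds because \<open>\<tau>\<close> is a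
  limit point of the geodesic.\<close>

lemma reg_integral_tendsto:
  assumes hol: "f holomorphic_on {z. Im z > 0}"
    and \<tau>: "Im \<tau> > 0" and w: "Im w > 0" and ne: "\<tau> \<noteq> w"
  shows "((\<lambda>z. contour_integral (hgeodesic z w) (\<lambda>p. f p / csqrt (\<i> * (p - \<tau>)) ^ 3)
             + 2 * \<i> * (f \<tau> / csqrt (\<i> * (z - \<tau>)))) \<longlongrightarrow> reg_integral f \<tau> w)
         (at \<tau> within path_image (hgeodesic \<tau> w))" (is "(?F \<longlongrightarrow> _) ?at")
proof -
  obtain P Q where P: "isCont P 0" and I:
    "\<And>z. z \<in> hgeodesic \<tau> w ` {0<..1} \<Longrightarrow>
      ((\<lambda>p. f p / csqrt (\<i> * (p - \<tau>)) ^ 3) has_contour_integral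
         Q + 2 * \<i> * P (csqrt (\<i> * (z - \<tau>))) - 2 * \<i> * (f \<tau> / csqrt (\<i> * (z - \<tau>)))) (hgeodesic z w)"
    using reg_integral_integrand_primitive[OF assms] by blast
  have "((\<lambda>z. \<i> * (z - \<tau>)) \<longlongrightarrow> \<i> * (\<tau> - \<tau>)) ?at" by (intro tendsto_intros)
  then have "((\<lambda>z. csqrt (\<i> * (z - \<tau>))) \<longlongrightarrow> 0) ?at" by (intro tendsto_csqrt_0) simp
  then have "((\<lambda>z. P (csqrt (\<i> * (z - \<tau>)))) \<longlongrightarrow> P 0) ?at"
    using P by (rule isCont_tendsto_compose[rotated])
  then have "((\<lambda>z. Q + 2 * \<i> * P (csqrt (\<i> * (z - \<tau>)))) \<longlongrightarrow> Q + 2 * \<i> * P 0) ?at"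
    by (intro tendsto_intros)
  moreover have "eventually (\<lambda>z. Q + 2 * \<i> * P (csqrt (\<i> * (z - \<tau>))) = ?F z) ?at"
  proof (rule eventually_at_withinI)
    fix z assume "z \<in> path_image (hgeodesic \<tau> w)" "z \<noteq> \<tau>"
    then have "z \<in> hgeodesic \<tau> w ` {0<..1}" using path_image_hgeodesic[OF \<tau> w ne] by blast
    from contour_integral_unique[OF I[OF this]]
    show "Q + 2 * \<i> * P (csqrt (\<i> * (z - \<tau>))) = ?F z" by simp
  qed
  ultimately have "(?F \<longlongrightarrow> Q + 2 * \<i> * P 0) ?at" by (rule Lim_transform_eventually)
  moreover from this have "reg_integral f \<tau> w = Q + 2 * \<i> * P 0"
    unfolding reg_integral_def using hgeodesic_islimpt[OF \<tau> w ne]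
    by (intro tendsto_Lim) (auto simp: trivial_limit_within)
  ultimately show ?thesis by simp
qed

text \<open>Stated for any pair \<open>f\<close>, \<open>g\<close> related with weight 1/2, with a
  constant \<open>C\<close> that will absorb the dependence of \<open>h\<close> on its first
  argument. Division by the outer root is included because only then do the signs
  \<open>\<epsilon>\<close> cancel.\<close>

lemma reg_integral_moebius_int:
  assumes det: "a * d - b * c = 1"
    and hol: "f holomorphic_on {z. Im z > 0}"
    and fg: "\<And>p. Im p > 0 \<Longrightarrow> g (moebius_int a b c d p) = C * csqrt (of_int c * p + of_int d) * f p"
    and \<tau>: "Im \<tau> > 0" and w: "Im w > 0" and ne: "\<tau> \<noteq> w"
  defines "M \<equiv> moebius_int a b c d"
  shows "reg_integral g (M \<tau>) (M w) / csqrt (\<i> * (M w - M \<tau>)) =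
         C * (of_int c * \<tau> + of_int d)\<^sup>2 * csqrt (of_int c * w + of_int d) *
           (reg_integral f \<tau> w / csqrt (\<i> * (w - \<tau>)))"
proof -
  define S where "S = hgeodesic \<tau> w ` {0<..1}"
  define at\<tau> where "at\<tau> = at \<tau> within path_image (hgeodesic \<tau> w)"
  define j where "j = (\<lambda>p. csqrt (of_int c * p + of_int d))"
  define u where "u = (\<lambda>p. csqrt (\<i> * (p - \<tau>)))"
  define v where "v = (\<lambda>p. csqrt (\<i> * (M p - M \<tau>)))"
  obtain \<epsilon> where \<epsilon>: "\<epsilon>\<^sup>2 = 1" and uv: "\<And>p. p \<in> S \<Longrightarrow> u p = \<epsilon> * (v p * j p * j \<tau>)"
    using hgeodesic_sign[OF det \<tau> w ne] unfolding S_def u_def v_def j_def M_def by blast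
  have jnz: "j p \<noteq> 0" if "Im p > 0" for p
    using moebius_denom_nonzero[OF det, of p] that by (simp add: j_def)
  have j2: "j p ^ 2 = of_int c * p + of_int d" for p by (simp add: j_def)
  have SH: "Im p > 0" if "p \<in> S" for p
    using that hgeodesic_in_upper_half_plane[OF \<tau> w] by (auto simp: S_def upper_half_plane_def)
  have unz: "u p \<noteq> 0" if "p \<in> S" for p
    using that hgeodesic_ne_start[OF \<tau> w ne] by (auto simp: S_def u_def)
  have inv_v: "1 / v p = \<epsilon> * j p * j \<tau> / u p" if "p \<in> S" for p
  proof -
    have "v p \<noteq> 0" "\<epsilon> \<noteq> 0" using unz[OF that] uv[OF that] by auto
    then show ?thesis unfolding uv[OF that] using jnz[OF SH[OF that]] jnz[OF \<tau>] by simp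
  qed
  have e3: "\<epsilon> ^ 3 = \<epsilon>" using \<epsilon> by (simp add: power3_eq_cube power2_eq_square)
  \<comment> \<open>The cube of \<open>1 / v p\<close> contributes
    \<open>\<epsilon> ^ 3 = \<epsilon>\<close>, \<open>j \<tau> ^ 3\<close> and
    \<open>j p ^ 3\<close>. Together with the weight factor \<open>j p\<close> of \<open>g\<close>
    the last becomes \<open>j p ^ 4\<close>, which the Jacobian cancels.\<close>
  define K where "K = C * \<epsilon> * j \<tau> ^ 3"
  have ci: "contour_integral (hgeodesic (M z) (M w)) (\<lambda>p. g p / csqrt (\<i> * (p - M \<tau>)) ^ 3) =
            K * contour_integral (hgeodesic z w) (\<lambda>p. f p / u p ^ 3)" if z: "z \<in> S" for z
  proof -
    have "contour_integral (hgeodesic (M z) (M w)) (\<lambda>p. g p / csqrt (\<i> * (p - M \<tau>)) ^ 3) =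
      contour_integral (hgeodesic z w) (\<lambda>p. g (M p) / v p ^ 3 / (of_int c * p + of_int d)\<^sup>2)"
      unfolding M_def v_def by (rule contour_integral_moebius_int[OF det SH[OF z] w])
    also have "\<dots> = contour_integral (hgeodesic z w) (\<lambda>p. K * (f p / u p ^ 3))"
    proof (rule contour_integral_eq)
      fix p assume "p \<in> path_image (hgeodesic z w)"
      then have p: "p \<in> S" using path_image_hgeodesic_subset[OF \<tau> w z[unfolded S_def]] by (auto simp: S_def)
      have "g (M p) / v p ^ 3 = C * j p * f p * (1 / v p) ^ 3"
        using fg[OF SH[OF p]] by (simp add: M_def j_def power_divide)
      also have "\<dots> = K * (f p / u p ^ 3) * ((j p)\<^sup>2)\<^sup>2"
        unfolding inv_v[OF p] by (simp add: K_def power_divide power_mult_distrib e3)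
          (simp add: power2_eq_square power3_eq_cube power4_eq_xxxx)
      finally show "g (M p) / v p ^ 3 / (of_int c * p + of_int d)\<^sup>2 = K * (f p / u p ^ 3)"
        using moebius_denom_nonzero[OF det, of p] SH[OF p] unfolding j2 by simp
    qed
    also have "\<dots> = K * contour_integral (hgeodesic z w) (\<lambda>p. f p / u p ^ 3)"
    proof (rule contour_integral_lmul)
      show "(\<lambda>p. f p / u p ^ 3) contour_integrable_on hgeodesic z w"
        using z unfolding contour_integrable_on_def u_def S_def
        by (rule_tac reg_integral_integrand_primitive[OF hol \<tau> w ne]) blast
    qed
    finally show ?thesis .
  qed
  define F where "F = (\<lambda>z. contour_integral (hgeodesic z w) (\<lambda>p. f p / u p ^ 3) + 2 * \<i> * (f \<tau> / u z))"
  define F' where "F' = (\<lambda>z. contour_integral (hgeodesic z (M w)) (\<lambda>p. g p / csqrt (\<i> * (p - M \<tau>)) ^ 3)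
             + 2 * \<i> * (g (M \<tau>) / csqrt (\<i> * (z - M \<tau>))))"
  have F: "(F \<longlongrightarrow> reg_integral f \<tau> w) at\<tau>"
    using reg_integral_tendsto[OF hol \<tau> w ne] by (simp add: F_def at\<tau>_def u_def)
  \<comment> \<open>The integral scales with \<open>j \<tau> ^ 3\<close>, the transformed
    counterterm with \<open>(j \<tau>)\<^sup>2 * j z\<close>; the last summand is this
    discrepancy.\<close>
  have F'_eq: "F' (M z) = K * F z + 2 * \<i> * C * \<epsilon> * f \<tau> * (j \<tau>)\<^sup>2 * ((j z - j \<tau>) / u z)"
    if z: "z \<in> S" for z
  proof -
    have "g (M \<tau>) / csqrt (\<i> * (M z - M \<tau>)) = C * j \<tau> * f \<tau> * (1 / v z)"
      using fg[OF \<tau>] by (simp add: M_def j_def v_def)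
    also have "\<dots> = C * \<epsilon> * f \<tau> * (j \<tau>)\<^sup>2 * (j z / u z)"
      unfolding inv_v[OF z] by (simp add: power2_eq_square)
    finally have r: "g (M \<tau>) / csqrt (\<i> * (M z - M \<tau>)) = C * \<epsilon> * f \<tau> * (j \<tau>)\<^sup>2 * (j z / u z)" .
    show ?thesis using unz[OF z] unfolding F'_def F_def ci[OF z] r K_def
      by (simp add: field_simps power2_eq_square power3_eq_cube)
  qed
  have j_diff: "((\<lambda>z. (j z - j \<tau>) / u z) \<longlongrightarrow> 0) at\<tau>"
  proof -
    have "j holomorphic_on {z. Im z > 0}" unfolding j_def by (rule csqrt_linear_holomorphic[OF det])
    then obtain j' where "(j has_field_derivative j') (at \<tau>)"
      using \<tau> open_halfspace_Im_gt[of 0] by (auto simp: holomorphic_on_open)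
    then have "(j has_field_derivative j') at\<tau>" unfolding at\<tau>_def by (rule has_field_derivative_at_within)
    then have 1: "((\<lambda>z. (j z - j \<tau>) / (z - \<tau>)) \<longlongrightarrow> j') at\<tau>"
      unfolding at\<tau>_def by (simp add: has_field_derivative_iff)
    have "((\<lambda>z. \<i> * (z - \<tau>)) \<longlongrightarrow> \<i> * (\<tau> - \<tau>)) at\<tau>" unfolding at\<tau>_def by (intro tendsto_intros)
    then have 2: "(u \<longlongrightarrow> 0) at\<tau>" unfolding u_def by (intro tendsto_csqrt_0) simp
    \<comment> \<open>Because \<open>z - \<tau> = - \<i> * (u z)\<^sup>2\<close>, dividing by
      \<open>u z\<close> amounts to a convergent difference quotient times \<open>u z\<close>, which
      tends to 0.\<close>
    have "((\<lambda>z. - \<i> * ((j z - j \<tau>) / (z - \<tau>) * u z)) \<longlongrightarrow> - \<i> * (j' * 0)) at\<tau>"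
      by (intro tendsto_intros 1 2)
    moreover have "- \<i> * ((j z - j \<tau>) / (z - \<tau>) * u z) = (j z - j \<tau>) / u z" for z
    proof (cases "z = \<tau>")
      case False
      then have "u z \<noteq> 0" by (simp add: u_def)
      have e: "z - \<tau> = - \<i> * (u z)\<^sup>2" by (simp add: u_def flip: mult.assoc)
      show ?thesis unfolding e using \<open>u z \<noteq> 0\<close> by (simp add: power2_eq_square)
    qed simp
    ultimately show ?thesis by simp
  qed
  have "((\<lambda>z. K * F z + 2 * \<i> * C * \<epsilon> * f \<tau> * (j \<tau>)\<^sup>2 * ((j z - j \<tau>) / u z)) \<longlongrightarrow>
      K * reg_integral f \<tau> w + 2 * \<i> * C * \<epsilon> * f \<tau> * (j \<tau>)\<^sup>2 * 0) at\<tau>"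
    by (intro tendsto_intros F j_diff)
  moreover have "eventually (\<lambda>z. K * F z + 2 * \<i> * C * \<epsilon> * f \<tau> * (j \<tau>)\<^sup>2 * ((j z - j \<tau>) / u z) = F' (M z)) at\<tau>"
    unfolding at\<tau>_def
  proof (rule eventually_at_withinI)
    fix z assume "z \<in> path_image (hgeodesic \<tau> w)" "z \<noteq> \<tau>"
    then have "z \<in> S" using path_image_hgeodesic[OF \<tau> w ne] unfolding S_def by blast
    from F'_eq[OF this, symmetric]
    show "K * F z + 2 * \<i> * C * \<epsilon> * f \<tau> * (j \<tau>)\<^sup>2 * ((j z - j \<tau>) / u z) = F' (M z)" .
  qed
  ultimately have lim: "((\<lambda>z. F' (M z)) \<longlongrightarrow> K * reg_integral f \<tau> w) at\<tau>"
    by (auto dest: Lim_transform_eventually)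
  have pi: "path_image (hgeodesic (M \<tau>) (M w)) = M ` path_image (hgeodesic \<tau> w)"
    unfolding path_image_def image_image M_def
    by (intro image_cong refl moebius_int_hgeodesic[OF det \<tau> w])
  \<comment> \<open>The inverse matrix: the limit is known in the variable \<open>z\<close> at
    \<open>\<tau>\<close>, while \<open>reg_integral\<close> asks for it in the variable
    \<open>M z\<close> at \<open>M \<tau>\<close>.\<close>
  define M' where "M' = moebius_int d (-b) (-c) a"
  have M'M: "M' (M z) = z" if "Im z > 0" for z
    unfolding M_def M'_def using moebius_denom_nonzero[OF det, of z] that of_int_det[OF det]
    by (subst of_int_minus)+ (intro moebius_inverse, auto)
  have MIm: "Im (M z) > 0" if "Im z > 0" for z unfolding M_def by (rule Im_moebius_int_pos[OF det that])
  have "isCont M' (M \<tau>)"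
    unfolding M'_def using det MIm[OF \<tau>]
    by (intro DERIV_isCont[OF moebius_int_has_field_derivative]) (auto simp: algebra_simps)
  then have "filterlim M' (nhds (M' (M \<tau>))) (at (M \<tau>) within path_image (hgeodesic (M \<tau>) (M w)))"
    using continuous_at_imp_continuous_at_within continuous_within by blast
  moreover have "eventually (\<lambda>z. M' z \<in> path_image (hgeodesic \<tau> w) \<and> M' z \<noteq> \<tau> \<and> F' (M (M' z)) = F' z)
      (at (M \<tau>) within path_image (hgeodesic (M \<tau>) (M w)))"
    unfolding pi
  proof (rule eventually_at_withinI)
    fix z' assume "z' \<in> M ` path_image (hgeodesic \<tau> w)" "z' \<noteq> M \<tau>"
    then obtain z where z: "z \<in> path_image (hgeodesic \<tau> w)" "z' = M z" "z \<noteq> \<tau>" by auto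
    then have "M' z' = z" using M'M[OF hgeodesic_in_Im_pos[OF \<tau> w z(1)]] by simp
    then show "M' z' \<in> path_image (hgeodesic \<tau> w) \<and> M' z' \<noteq> \<tau> \<and> F' (M (M' z')) = F' z'"
      using z by simp
  qed
  note M' = this
  ultimately have "filterlim M' at\<tau> (at (M \<tau>) within path_image (hgeodesic (M \<tau>) (M w)))"
    unfolding at\<tau>_def M'M[OF \<tau>] filterlim_at by (auto elim: eventually_mono)
  from filterlim_compose[OF lim this]
  have "((\<lambda>z. F' (M (M' z))) \<longlongrightarrow> K * reg_integral f \<tau> w)
      (at (M \<tau>) within path_image (hgeodesic (M \<tau>) (M w)))" .
  moreover have "eventually (\<lambda>z. F' (M (M' z)) = F' z)
      (at (M \<tau>) within path_image (hgeodesic (M \<tau>) (M w)))"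
    using M' by (auto elim: eventually_mono)
  ultimately have "(F' \<longlongrightarrow> K * reg_integral f \<tau> w)
      (at (M \<tau>) within path_image (hgeodesic (M \<tau>) (M w)))"
    by (rule Lim_transform_eventually)
  moreover have "M \<tau> \<noteq> M w" using M'M[OF \<tau>] M'M[OF w] ne by metis
  ultimately have R: "reg_integral g (M \<tau>) (M w) = K * reg_integral f \<tau> w"
    unfolding reg_integral_def F'_def using hgeodesic_islimpt[OF MIm[OF \<tau>] MIm[OF w]]
    by (intro tendsto_Lim) (auto simp: trivial_limit_within)
  have wS: "w \<in> S" unfolding S_def by (rule image_eqI[of _ _ 1]) (simp_all add: hgeodesic_1[OF \<tau> w])
  have "reg_integral g (M \<tau>) (M w) / v w = K * reg_integral f \<tau> w * (1 / v w)" by (simp add: R)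
  also have "\<dots> = C * \<epsilon>\<^sup>2 * ((j \<tau>)\<^sup>2)\<^sup>2 * j w * (reg_integral f \<tau> w / u w)"
    unfolding inv_v[OF wS] K_def by (simp add: power2_eq_square power3_eq_cube)
  finally show ?thesis unfolding \<epsilon> j2 by (simp add: v_def u_def j_def)
qed

section \<open>Poisson summation\<close>

text \<open>
  A continuous function with vanishing Fourier coefficients is orthogonal to the trigonometric
  polynomials \<open>cos (\<pi> (x - x\<^sub>0)) ^ (2 N)\<close>, which concentrate at \<open>x\<^sub>0\<close> as \<open>N\<close> grows.
\<close>

lemma cos_power_eq_trig_poly:
  "complex_of_real (cos (pi * y) ^ (2 * N)) =
     (\<Sum>j\<le>2 * N. of_nat (2 * N choose j) / 4 ^ N * cis (2 * pi * of_int (int j - int N) * y))"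
proof -
  have "complex_of_real (cos (pi * y)) = (cis (pi * y) + cis (- (pi * y))) / 2"
    by (simp add: complex_eq_iff)
  then have "complex_of_real (cos (pi * y) ^ (2 * N)) =
      (\<Sum>j\<le>2 * N. of_nat (2 * N choose j) * cis (pi * y) ^ j * cis (- (pi * y)) ^ (2 * N - j)) / 2 ^ (2 * N)"
    by (simp only: of_real_power power_divide binomial_ring)
  also have "\<dots> = (\<Sum>j\<le>2 * N. of_nat (2 * N choose j) / 4 ^ N * cis (2 * pi * of_int (int j - int N) * y))"
    unfolding sum_divide_distrib
  proof (rule sum.cong[OF refl])
    fix j assume "j \<in> {..2 * N}"
    then have j: "j \<le> 2 * N" by simp
    have "cis (pi * y) ^ j * cis (- (pi * y)) ^ (2 * N - j) =
        cis (real j * (pi * y) + real (2 * N - j) * (- (pi * y)))"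
      by (simp only: Complex.DeMoivre cis_mult)
    also have "real j * (pi * y) + real (2 * N - j) * (- (pi * y)) = 2 * pi * of_int (int j - int N) * y"
      using j by (simp add: of_nat_diff algebra_simps)
    finally show "of_nat (2 * N choose j) * cis (pi * y) ^ j * cis (- (pi * y)) ^ (2 * N - j) / 2 ^ (2 * N) =
        of_nat (2 * N choose j) / 4 ^ N * cis (2 * pi * of_int (int j - int N) * y)"
      by (simp add: power_mult mult.assoc)
  qed
  finally show ?thesis .
qed

text \<open>The upper bound on \<open>\<bar>y\<bar>\<close> keeps away from
  \<open>\<bar>y\<bar> = 1\<close>, where the modulus of the cosine peaks again.\<close>

lemma abs_cos_pi_le:
  assumes "0 \<le> \<delta>" "\<delta> \<le> \<bar>y\<bar>" "\<bar>y\<bar> \<le> 1 - \<delta>"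
  shows "\<bar>cos (pi * y)\<bar> \<le> cos (pi * \<delta>)"
proof -
  have "cos (pi * \<bar>y\<bar>) \<le> cos (pi * \<delta>)"
    using assms by (intro cos_monotone_0_pi_le) auto
  moreover have "cos (pi * (1 - \<bar>y\<bar>)) \<le> cos (pi * \<delta>)"
    using assms by (intro cos_monotone_0_pi_le) auto
  moreover have "cos (pi * (1 - \<bar>y\<bar>)) = - cos (pi * \<bar>y\<bar>)"
    by (simp add: right_diff_distrib cos_diff)
  moreover have "cos (pi * \<bar>y\<bar>) = cos (pi * y)" by (cases "y \<ge> 0") auto
  ultimately show ?thesis by linarith
qed

lemma fourier_coeffs_zero_imp_zero:
  fixes D :: "real \<Rightarrow> complex"
  assumes cont: "continuous_on {0..1} D"
    and coeff: "\<And>k::int. ((\<lambda>x. D x * cis (2 * pi * of_int k * x)) has_integral 0) {0..1}"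
    and x0: "0 < x\<^sub>0" "x\<^sub>0 < 1"
  shows "D x\<^sub>0 = 0"
proof (rule ccontr)
  assume nz: "D x\<^sub>0 \<noteq> 0"
  \<comment> \<open>Dividing by \<open>D x\<^sub>0\<close> before taking the real part makes
    \<open>E x\<^sub>0 = 1\<close>, so positivity arguments apply to a complex-valued
    \<open>D\<close>.\<close>
  define E where "E = (\<lambda>x. Re (D x / D x\<^sub>0))"
  have contE: "continuous_on {0..1} E" unfolding E_def using nz
    by (intro continuous_intros cont) auto
  have int0: "((\<lambda>x. E x * cos (pi * (x - x\<^sub>0)) ^ (2 * N)) has_integral 0) {0..1}" for N
  proof -
    have "((\<lambda>x. \<Sum>j\<le>2 * N. (of_nat (2 * N choose j) / 4 ^ N * cis (- (2 * pi * of_int (int j - int N) * x\<^sub>0)) / D x\<^sub>0) *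
        (D x * cis (2 * pi * of_int (int j - int N) * x))) has_integral
        (\<Sum>j\<le>2 * N. (of_nat (2 * N choose j) / 4 ^ N * cis (- (2 * pi * of_int (int j - int N) * x\<^sub>0)) / D x\<^sub>0) * 0)) {0..1}"
      by (intro has_integral_sum has_integral_mult_right coeff) auto
    also have "(\<lambda>x. \<Sum>j\<le>2 * N. (of_nat (2 * N choose j) / 4 ^ N * cis (- (2 * pi * of_int (int j - int N) * x\<^sub>0)) / D x\<^sub>0) *
        (D x * cis (2 * pi * of_int (int j - int N) * x))) =
        (\<lambda>x. D x / D x\<^sub>0 * complex_of_real (cos (pi * (x - x\<^sub>0)) ^ (2 * N)))"
    proof
      fix x
      have c: "cis (2 * pi * of_int (int j - int N) * (x - x\<^sub>0)) =
          cis (2 * pi * of_int (int j - int N) * x) * cis (- (2 * pi * of_int (int j - int N) * x\<^sub>0))" for j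
        unfolding cis_mult by (rule arg_cong[of _ _ cis]) (simp add: algebra_simps)
      show "(\<Sum>j\<le>2 * N. (of_nat (2 * N choose j) / 4 ^ N * cis (- (2 * pi * of_int (int j - int N) * x\<^sub>0)) / D x\<^sub>0) *
        (D x * cis (2 * pi * of_int (int j - int N) * x))) =
        D x / D x\<^sub>0 * complex_of_real (cos (pi * (x - x\<^sub>0)) ^ (2 * N))"
        unfolding cos_power_eq_trig_poly sum_distrib_left c
        by (intro sum.cong refl) (simp add: field_simps)
    qed
    finally have "((\<lambda>x. D x / D x\<^sub>0 * complex_of_real (cos (pi * (x - x\<^sub>0)) ^ (2 * N))) has_integral 0) {0..1}"
      by simp
    from has_integral_linear[OF this bounded_linear_Re] show ?thesis
      by (simp only: o_def E_def times_complex.sel Re_complex_of_real Im_complex_of_real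
          mult_zero_right diff_zero zero_complex.sel)
  qed
  have "isCont E x\<^sub>0"
    using contE x0 by (simp add: continuous_on_eq_continuous_at[of "{0<..<1}"] continuous_on_interior)
  then obtain e where e: "e > 0" "\<And>x. \<bar>x - x\<^sub>0\<bar> < e \<Longrightarrow> \<bar>E x - E x\<^sub>0\<bar> < 1 / 2"
    unfolding continuous_at_eps_delta dist_real_def by (metis half_gt_zero_iff zero_less_one)
  have "E x\<^sub>0 = 1" using nz by (simp add: E_def)
  \<comment> \<open>The window of radius \<open>2 * \<delta>\<close> stays in \<open>{0..1}\<close>
    and \<open>E\<close> exceeds 1/2 in its interior. The gap between the radii
    \<open>\<delta>\<close> and \<open>2 * \<delta>\<close> is what makes \<open>c2 < c1\<close>
    strict.\<close>
  define \<delta> where "\<delta> = Min {e, x\<^sub>0, 1 - x\<^sub>0} / 2"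
  have \<delta>: "\<delta> > 0" "2 * \<delta> \<le> e" "2 * \<delta> \<le> x\<^sub>0" "2 * \<delta> \<le> 1 - x\<^sub>0" using e x0 by (auto simp: \<delta>_def)
  have "compact (E ` {0..1})" by (intro compact_continuous_image contE) auto
  then obtain B where B: "\<And>x. x \<in> {0..1} \<Longrightarrow> \<bar>E x\<bar> \<le> B"
    by (meson bounded_real compact_imp_bounded imageI)
  have "B \<ge> 0" using B[of 0] by simp
  define c1 c2 where "c1 = cos (pi * \<delta>)" and "c2 = cos (pi * (2 * \<delta>))"
  have c: "0 \<le> c2" "c2 < c1" "0 < c1"
  proof -
    have "cos (pi / 2) \<le> c2" unfolding c2_def using \<delta> x0 by (intro cos_monotone_0_pi_le) auto
    then show "0 \<le> c2" by simp
    show "c2 < c1" unfolding c1_def c2_def using \<delta> x0 by (intro cos_monotone_0_pi) auto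
    with \<open>0 \<le> c2\<close> show "0 < c1" by simp
  qed
  have bound: "\<delta> * c1 ^ (2 * N) \<le> B * c2 ^ (2 * N)" for N
  proof -
    \<comment> \<open>A step function below the integrand: the kernel is at least
      \<open>c1 ^ (2 * N)\<close> on the inner window, the product is nonnegative on the ring, and
      farther out it is at least \<open>- B * c2 ^ (2 * N)\<close>.\<close>
    define m where "m = (\<lambda>x. (if x \<in> {x\<^sub>0 - \<delta>..x\<^sub>0 + \<delta>} then 1 / 2 * c1 ^ (2 * N) else 0) - B * c2 ^ (2 * N))"
    have sub: "{x\<^sub>0 - \<delta>..x\<^sub>0 + \<delta>} \<subseteq> {0..1}" using \<delta> by auto
    have 1: "((\<lambda>x. if x \<in> {x\<^sub>0 - \<delta>..x\<^sub>0 + \<delta>} then 1 / 2 * c1 ^ (2 * N) else 0) has_integral \<delta> * c1 ^ (2 * N)) {0..1}"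
      unfolding has_integral_restrict[OF sub]
      using has_integral_const_real[of "1 / 2 * c1 ^ (2 * N)" "x\<^sub>0 - \<delta>" "x\<^sub>0 + \<delta>"] \<delta>(1) by simp
    have 2: "((\<lambda>_. B * c2 ^ (2 * N)) has_integral B * c2 ^ (2 * N)) {0..1::real}"
      using has_integral_const_real[of "B * c2 ^ (2 * N)" 0 1] by simp
    have "(m has_integral (\<delta> * c1 ^ (2 * N) - B * c2 ^ (2 * N))) {0..1}"
      unfolding m_def by (intro has_integral_diff 1 2)
    then have "\<delta> * c1 ^ (2 * N) - B * c2 ^ (2 * N) \<le> 0"
    proof (rule has_integral_le[OF _ int0[of N]])
      fix x :: real assume x: "x \<in> {0..1}"
      define K where "K = cos (pi * (x - x\<^sub>0)) ^ (2 * N)"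
      have K0: "K \<ge> 0" by (simp add: K_def power_mult)
      have nn: "0 \<le> B * c2 ^ (2 * N)" using \<open>B \<ge> 0\<close> c by simp
      consider "\<bar>x - x\<^sub>0\<bar> \<le> \<delta>" | "\<delta> < \<bar>x - x\<^sub>0\<bar>" "\<bar>x - x\<^sub>0\<bar> < 2 * \<delta>" | "2 * \<delta> \<le> \<bar>x - x\<^sub>0\<bar>" by linarith
      then show "m x \<le> E x * cos (pi * (x - x\<^sub>0)) ^ (2 * N)" unfolding K_def[symmetric]
      proof cases
        case 1
        have "cos (pi * \<delta>) \<le> cos (pi * \<bar>x - x\<^sub>0\<bar>)"
          using 1 \<delta> x0 by (intro cos_monotone_0_pi_le) auto
        moreover have "cos (pi * \<bar>x - x\<^sub>0\<bar>) = cos (pi * (x - x\<^sub>0))" by (cases "x \<ge> x\<^sub>0") (auto simp: cos_diff algebra_simps)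
        ultimately have "c1 ^ (2 * N) \<le> K" unfolding K_def c1_def using c by (intro power_mono) (auto simp: c1_def)
        moreover have "\<bar>E x - E x\<^sub>0\<bar> < 1 / 2" using 1 \<delta> by (intro e(2)) linarith
        then have "1 / 2 \<le> E x" using \<open>E x\<^sub>0 = 1\<close> by linarith
        ultimately have "1 / 2 * c1 ^ (2 * N) \<le> E x * K" using c by (intro mult_mono) auto
        moreover have "x \<in> {x\<^sub>0 - \<delta>..x\<^sub>0 + \<delta>}" using 1 by auto
        ultimately show "m x \<le> E x * K" using nn by (simp add: m_def)
      next
        case 2
        have "\<bar>E x - E x\<^sub>0\<bar> < 1 / 2" using 2 \<delta> by (intro e(2)) linarith
        then have "1 / 2 \<le> E x" using \<open>E x\<^sub>0 = 1\<close> by linarith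
        then have "0 \<le> E x * K" using K0 by simp
        moreover have "x \<notin> {x\<^sub>0 - \<delta>..x\<^sub>0 + \<delta>}" using 2 by auto
        then have "m x = - (B * c2 ^ (2 * N))" by (simp only: m_def if_False diff_0)
        ultimately show "m x \<le> E x * K" using nn by linarith
      next
        case 3
        have "\<bar>cos (pi * (x - x\<^sub>0))\<bar> \<le> c2" unfolding c2_def
          using 3 \<delta> x x0 by (intro abs_cos_pi_le) auto
        then have "\<bar>cos (pi * (x - x\<^sub>0))\<bar> ^ (2 * N) \<le> c2 ^ (2 * N)" by (intro power_mono) auto
        then have "K \<le> c2 ^ (2 * N)" by (simp add: K_def power_even_abs)
        then have "\<bar>E x\<bar> * K \<le> B * c2 ^ (2 * N)" using B[OF x] K0 \<open>B \<ge> 0\<close> by (intro mult_mono) auto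
        moreover have "- (\<bar>E x\<bar> * K) \<le> E x * K" using K0
          by (metis abs_ge_minus_self abs_mult abs_of_nonneg minus_le_iff)
        moreover have "x \<notin> {x\<^sub>0 - \<delta>..x\<^sub>0 + \<delta>}" using 3 \<delta>(1) by auto
        then have "m x = - (B * c2 ^ (2 * N))" by (simp only: m_def if_False diff_0)
        ultimately show "m x \<le> E x * K" by linarith
      qed
    qed
    then show ?thesis by simp
  qed
  define r where "r = (c2 / c1)\<^sup>2"
  have r: "0 \<le> r" "r < 1" using c by (auto simp: r_def power_divide divide_less_eq power_strict_mono)
  have "\<delta> \<le> B * r ^ N" for N
    using bound[of N] c by (simp add: r_def power_mult[symmetric] power_divide field_simps)
  moreover have "(\<lambda>N. B * r ^ N) \<longlonglongrightarrow> B * 0" using r by (intro tendsto_intros LIMSEQ_realpow_zero) auto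
  ultimately have "\<delta> \<le> B * 0" by (intro LIMSEQ_le_const) auto
  with \<delta>(1) show False by simp
qed

lemma cis_2pi_int [simp]: "cis (2 * pi * of_int k) = 1"
  using cis_multiple_2pi[of "of_int k"] by simp

lemma has_integral_cis_0_1:
  "((\<lambda>x. cis (2 * pi * of_int k * x)) has_integral (if k = 0 then 1 else 0)) {0..1}"
proof (cases "k = 0")
  case True
  then show ?thesis using has_integral_const_real[of "1::complex" 0 1] by simp
next
  case False
  define F where "F = (\<lambda>x. cis (2 * pi * of_int k * x) / (2 * pi * of_int k * \<i>))"
  have "((\<lambda>x. cis (2 * pi * of_int k * x)) has_integral (F 1 - F 0)) {0..1}"
  proof (rule fundamental_theorem_of_calculus)
    fix x :: real
    show "(F has_vector_derivative cis (2 * pi * of_int k * x)) (at x within {0..1})"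
    proof -
      have "((\<lambda>z. exp (\<i> * (2 * pi * of_int k * z)) / (2 * pi * of_int k * \<i>)) has_field_derivative
          exp (\<i> * (2 * pi * of_int k * of_real x))) (at (of_real x))"
        using False by (auto intro!: derivative_eq_intros)
      from has_vector_derivative_real_field[OF this] show ?thesis
        by (simp add: F_def cis_conv_exp o_def)
    qed
  qed simp
  then show ?thesis using False by (simp add: F_def)
qed

section \<open>Infinite sums over the integers and termwise integration\<close>

lemma bij_add_int: "bij (\<lambda>n. n + (k::int))"
  by (rule bij_betw_byWitness[of _ "\<lambda>n. n - k"]) auto

lemma infsum_shift_int: "(\<Sum>\<^sub>\<infinity>n::int. f (n + k)) = infsum f UNIV"
  by (rule infsum_reindex_bij_betw[OF bij_add_int])

lemma has_sum_int_symmetric_limit: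
  fixes f :: "int \<Rightarrow> 'a::{topological_comm_monoid_add, t2_space}"
  assumes "(f has_sum s) UNIV"
    and A: "\<And>N. finite (A N)" "\<And>N. {- int N..<int N} \<subseteq> A N"
  shows "(\<lambda>N::nat. \<Sum>n\<in>A N. f n) \<longlonglongrightarrow> s"
proof -
  have "filterlim A (finite_subsets_at_top UNIV) sequentially"
    unfolding filterlim_finite_subsets_at_top
  proof (intro allI impI)
    fix X :: "int set" assume "finite X \<and> X \<subseteq> UNIV"
    then have B: "\<bar>x\<bar> \<le> Max (abs ` X)" if "x \<in> X" for x using that by (intro Max_ge) auto
    show "\<forall>\<^sub>F N in sequentially. finite (A N) \<and> X \<subseteq> A N \<and> A N \<subseteq> UNIV"
      using eventually_gt_at_top[of "nat (Max (abs ` X))"]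
    proof eventually_elim
      case (elim N)
      then have "X \<subseteq> {- int N..<int N}" using B by force
      then show ?case using A by blast
    qed
  qed
  then show ?thesis using assms(1) unfolding has_sum_def by (rule filterlim_compose[rotated])
qed

lemma uniform_limit_infsum:
  fixes f :: "'i \<Rightarrow> 'a \<Rightarrow> 'b::banach"
  assumes "\<And>n x. x \<in> S \<Longrightarrow> norm (f n x) \<le> B n" and "B summable_on UNIV"
  shows "uniform_limit S (\<lambda>X x. \<Sum>n\<in>X. f n x) (\<lambda>x. \<Sum>\<^sub>\<infinity>n. f n x) (finite_subsets_at_top UNIV)"
  using assms by (intro Weierstrass_m_test_general) auto

lemma has_integral_infsum:
  fixes f :: "'i \<Rightarrow> real \<Rightarrow> 'b::banach"
  assumes bound: "\<And>n x. x \<in> {a..b} \<Longrightarrow> norm (f n x) \<le> B n" "B summable_on UNIV"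
    and cont: "\<And>n. continuous_on {a..b} (f n)"
    and int: "\<And>n. (f n has_integral I n) {a..b}" and J: "(I has_sum J) UNIV"
  shows "((\<lambda>x. \<Sum>\<^sub>\<infinity>n. f n x) has_integral J) {a..b}"
proof -
  obtain I' J' where I': "\<And>X. ((\<lambda>x. \<Sum>n\<in>X. f n x) has_integral I' X) {a..b}"
    and J': "((\<lambda>x. \<Sum>\<^sub>\<infinity>n. f n x) has_integral J') {a..b}" "(I' \<longlongrightarrow> J') (finite_subsets_at_top UNIV)"
    by (rule uniform_limit_integral[OF uniform_limit_infsum[OF bound]])
       (auto intro!: continuous_on_sum cont)
  have "I' X = sum I X" if "finite X" for X
    using has_integral_unique[OF I'[of X] has_integral_sum[OF that int]] by simp
  then have "(sum I \<longlongrightarrow> J') (finite_subsets_at_top UNIV)"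
    by (intro Lim_transform_eventually[OF J'(2)] eventually_finite_subsets_at_top_weakI) auto
  then have "J' = J" using J unfolding has_sum_def
    by (rule tendsto_unique[OF finite_subsets_at_top_neq_bot])
  with J'(1) show ?thesis by simp
qed

text \<open>As functions of \<open>a\<close> on \<open>{0..1}\<close> both sides are continuous with
  equal Fourier coefficients. The transform enters as a limit over symmetric windows, which matches
  partial sums over unit intervals.\<close>

lemma poisson_summation_aux:
  fixes G :: "real \<Rightarrow> complex" and c :: "int \<Rightarrow> complex"
  assumes cont: "continuous_on UNIV G"
    and bound: "\<And>n x. x \<in> {0..1} \<Longrightarrow> norm (G (x + of_int n)) \<le> B n" and B: "B summable_on UNIV"
    and coeff: "\<And>k. (\<lambda>N::nat. integral {- real N..real N} (\<lambda>x. G x * cis (2 * pi * of_int (- k) * x))) \<longlonglongrightarrow> c k"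
    and c: "(\<lambda>k. norm (c k)) summable_on UNIV"
    and a: "0 \<le> a" "a \<le> 1"
  shows "(\<Sum>\<^sub>\<infinity>n::int. G (a + of_int n)) = (\<Sum>\<^sub>\<infinity>k. c k * cis (2 * pi * of_int k * a))"
proof -
  define F where "F = (\<lambda>x. \<Sum>\<^sub>\<infinity>n::int. G (x + of_int n))"
  define H where "H = (\<lambda>x. \<Sum>\<^sub>\<infinity>k. c k * cis (2 * pi * of_int k * x))"
  define e where "e = (\<lambda>(k::int) x. cis (2 * pi * of_int k * x))"
  have e_cont: "continuous_on S (e k)" for S k
    unfolding e_def by (intro continuous_intros)
  have e_norm: "norm (e k x) = 1" for k x by (simp add: e_def)
  have e_mult: "e k x * e l x = e (k + l) x" for k l x
    by (simp add: e_def cis_mult algebra_simps)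
  have e_shift: "e k (x + of_int n) = e k x" for k n x
  proof -
    have "e k (x + of_int n) = e k x * cis (2 * pi * of_int (k * n))"
      unfolding e_def cis_mult by (simp add: algebra_simps)
    then show ?thesis by (simp del: of_int_mult)
  qed
  have G_cont: "continuous_on S (\<lambda>x. G (x + y))" for S y
    by (intro continuous_on_compose2[OF cont] continuous_intros) auto
  have "continuous_on {0..1} F" unfolding F_def
    by (rule uniform_limit_theorem[OF _ uniform_limit_infsum[OF bound B]])
       (auto intro!: always_eventually continuous_on_sum G_cont)
  moreover have "continuous_on {0..1} H" unfolding H_def
    by (rule uniform_limit_theorem[OF _ uniform_limit_infsum[OF _ c]])
       (auto intro!: always_eventually continuous_on_sum continuous_intros simp: norm_mult)
  moreover have "((\<lambda>x. (F x - H x) * e k x) has_integral 0) {0..1}" for k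
  proof -
    have "((\<lambda>x. \<Sum>\<^sub>\<infinity>n. G (x + of_int n) * e k x) has_integral c (- k)) {0..1}"
    proof -
      define I where "I = (\<lambda>n::int. integral {0..1} (\<lambda>x. G (x + of_int n) * e k x))"
      have cont': "continuous_on {0..1} (\<lambda>x. G (x + of_int n) * e k x)" for n
        by (intro continuous_intros G_cont e_cont)
      have I: "((\<lambda>x. G (x + of_int n) * e k x) has_integral I n) {0..1}" for n
        unfolding I_def using integrable_continuous_interval[OF cont'] by (rule integrable_integral)
      have "norm (I n) \<le> B n" for n
      proof -
        have "norm (integral (cbox 0 1) (\<lambda>x. G (x + of_int n) * e k x)) \<le> B n * measure lborel (cbox 0 (1::real))"
        proof (rule integrable_bound)
          have "norm (G (0 + of_int n)) \<le> B n" by (rule bound) auto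
          then show "0 \<le> B n" using norm_ge_zero order_trans by blast
          show "(\<lambda>x. G (x + of_int n) * e k x) integrable_on cbox 0 1"
            using I[of n] unfolding cbox_interval by blast
          show "norm (G (x + of_int n) * e k x) \<le> B n" if "x \<in> cbox 0 1" for x
            using bound[of x n] that by (simp add: norm_mult e_norm)
        qed
        then show ?thesis by (simp add: I_def)
      qed
      then have "I summable_on UNIV"
        using B by (meson Infinite_Sum.abs_summable_on_comparison_test' abs_summable_summable)
      then have "(I has_sum infsum I UNIV) UNIV" by simp
      moreover have "infsum I UNIV = c (- k)"
      proof -
        \<comment> \<open>As \<open>e k\<close> has period 1, each \<open>I n\<close> is an integral
          over \<open>{of_int n..of_int n + 1}\<close>, and consecutive unit intervals are glued by
          induction.\<close>
        have "sum I {- int N..<int N} = integral {- real N..real N} (\<lambda>x. G x * e k x)" for N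
        proof -
          have *: "integral {of_int n..of_int n + 1} (\<lambda>x. G x * e k x) = I n" for n
          proof -
            have "((\<lambda>x. G (x + of_int n) * e k (x + of_int n)) has_integral I n) {0..1}"
              using I[of n] by (simp add: e_shift)
            from has_integral_affinity'[of _ _ 0 1, OF _ zero_less_one, of _ _ "- of_int n", OF this[folded cbox_interval]]
            have "((\<lambda>x. G x * e k x) has_integral I n) {of_int n..1 + of_int n}" by simp
            then show ?thesis by (simp add: add.commute integral_unique)
          qed
          have "sum I {- int N..<- int N + int j} = integral {- real N..- real N + real j} (\<lambda>x. G x * e k x)" for j
          proof (induction j)
            case (Suc j)
            have "{- int N..<- int N + int (Suc j)} = insert (- int N + int j) {- int N..<- int N + int j}" by auto
            then have "sum I {- int N..<- int N + int (Suc j)} =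
                I (- int N + int j) + integral {- real N..- real N + real j} (\<lambda>x. G x * e k x)"
              using Suc by simp
            also have "\<dots> = integral {- real N..- real N + real j} (\<lambda>x. G x * e k x) +
                integral {- real N + real j..- real N + real j + 1} (\<lambda>x. G x * e k x)"
              using *[of "- int N + int j"] by simp
            also have "\<dots> = integral {- real N..- real N + real j + 1} (\<lambda>x. G x * e k x)"
              by (intro Henstock_Kurzweil_Integration.integral_combine integrable_continuous_interval
                  continuous_intros e_cont continuous_on_subset[OF cont]) auto
            finally show ?case by (simp add: add.commute add.left_commute)
          qed simp
          from this[of "2 * N"] show ?thesis by simp
        qed
        then have "(\<lambda>N. integral {- real N..real N} (\<lambda>x. G x * e k x)) \<longlonglongrightarrow> infsum I UNIV"
          using has_sum_int_symmetric_limit[OF \<open>(I has_sum infsum I UNIV) UNIV\<close>, of "\<lambda>N. {- int N..<int N}"] by simp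
        then show ?thesis using coeff[of "- k"] LIMSEQ_unique unfolding e_def by auto
      qed
      ultimately have J: "(I has_sum c (- k)) UNIV" by simp
      show ?thesis
        by (rule has_integral_infsum[OF _ B cont' I J]) (use bound in \<open>simp add: norm_mult e_norm\<close>)
    qed
    \<comment> \<open>Orthogonality keeps only the frequency \<open>l = - k\<close>, so this series
      has the same coefficient \<open>c (- k)\<close>.\<close>
    moreover have "((\<lambda>x. \<Sum>\<^sub>\<infinity>l. c l * e l x * e k x) has_integral c (- k)) {0..1}"
    proof (rule has_integral_infsum[where B = "\<lambda>l. norm (c l)" and I = "\<lambda>l. if l = - k then c (- k) else 0"])
      show "((\<lambda>x. c l * e l x * e k x) has_integral (if l = - k then c (- k) else 0)) {0..1}" for l
      proof -
        have "((\<lambda>x. c l * e (l + k) x) has_integral c l * (if l + k = 0 then 1 else 0)) {0..1}"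
          unfolding e_def by (intro has_integral_mult_right has_integral_cis_0_1)
        moreover have "c l * (if l + k = 0 then 1 else 0) = (if l = - k then c (- k) else 0)"
          by (auto simp: add_eq_0_iff2)
        ultimately show ?thesis by (simp add: mult.assoc e_mult)
      qed
      have "((\<lambda>l. if l = - k then c (- k) else 0) has_sum c (- k)) {- k}"
        by (intro has_sum_finiteI) auto
      then show "((\<lambda>l. if l = - k then c (- k) else 0) has_sum c (- k)) UNIV"
        by (rule has_sum_cong_neutral[THEN iffD1, rotated -1]) auto
    qed (use c in \<open>auto intro!: continuous_intros e_cont simp: norm_mult e_norm\<close>)
    ultimately have "((\<lambda>x. (\<Sum>\<^sub>\<infinity>n. G (x + of_int n) * e k x) - (\<Sum>\<^sub>\<infinity>l. c l * e l x * e k x))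
        has_integral c (- k) - c (- k)) {0..1}"
      by (rule has_integral_diff)
    moreover have "H = (\<lambda>x. \<Sum>\<^sub>\<infinity>l. c l * e l x)" by (simp add: H_def e_def)
    ultimately show ?thesis
      by (simp add: F_def left_diff_distrib infsum_cmult_left')
  qed
  ultimately have "continuous_on {0..1} (\<lambda>x. F x - H x) \<and> (\<forall>x\<in>{0<..<1}. F x - H x = 0)"
    unfolding e_def
    by (intro conjI ballI fourier_coeffs_zero_imp_zero[of "\<lambda>x. F x - H x"] continuous_on_diff) auto
  then have cont: "continuous_on {0..1} (\<lambda>x. F x - H x)"
    and zero: "\<And>x. x \<in> {0<..<1} \<Longrightarrow> F x - H x = 0" by auto
  \<comment> \<open>The coefficient argument covers interior points only; the endpoints follow by
    continuity, and 0 is needed when the shift is an integer.\<close>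
  have "F a - H a = 0"
    using continuous_constant_on_closure[of "{0<..<1}" "\<lambda>x. F x - H x"] cont zero a by simp
  then show ?thesis by (simp add: F_def H_def)
qed

text \<open>Both sides have period 1 in \<open>a\<close>, so the fractional part suffices.\<close>

lemma poisson_summation:
  fixes G :: "real \<Rightarrow> complex" and c :: "int \<Rightarrow> complex"
  assumes "continuous_on UNIV G"
    and "\<And>n x. x \<in> {0..1} \<Longrightarrow> norm (G (x + of_int n)) \<le> B n" and "B summable_on UNIV"
    and "\<And>k. (\<lambda>N::nat. integral {- real N..real N} (\<lambda>x. G x * cis (2 * pi * of_int (- k) * x))) \<longlonglongrightarrow> c k"
    and "(\<lambda>k. norm (c k)) summable_on UNIV"
  shows "(\<Sum>\<^sub>\<infinity>n::int. G (a + of_int n)) = (\<Sum>\<^sub>\<infinity>k. c k * cis (2 * pi * of_int k * a))"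
proof -
  have a: "a = frac a + of_int \<lfloor>a\<rfloor>" by (simp add: frac_def)
  have "(\<Sum>\<^sub>\<infinity>n::int. G (a + of_int n)) = (\<Sum>\<^sub>\<infinity>n. G (frac a + of_int (n + \<lfloor>a\<rfloor>)))"
    by (simp add: frac_def algebra_simps)
  also have "\<dots> = (\<Sum>\<^sub>\<infinity>n::int. G (frac a + of_int n))"
    by (rule infsum_shift_int)
  also have "\<dots> = (\<Sum>\<^sub>\<infinity>k. c k * cis (2 * pi * of_int k * frac a))"
    by (rule poisson_summation_aux[OF assms]) (auto intro: less_imp_le[OF frac_lt_1])
  also have "\<dots> = (\<Sum>\<^sub>\<infinity>k. c k * cis (2 * pi * of_int k * a))"
  proof (rule infsum_cong)
    fix k :: int
    have "cis (2 * pi * of_int k * a) = cis (2 * pi * of_int k * frac a) * cis (2 * pi * of_int (k * \<lfloor>a\<rfloor>))"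
      unfolding cis_mult by (subst a) (simp add: algebra_simps)
    then show "c k * cis (2 * pi * of_int k * frac a) = c k * cis (2 * pi * of_int k * a)"
      by (simp del: of_int_mult)
  qed
  finally show ?thesis .
qed

section \<open>Inversion of theta functions\<close>

text \<open>From \<open>\<bar>y\<bar> \<le> exp \<bar>y\<bar>\<close> and completing the square: the
  constant in the exponent is the maximum of
  \<open>(k + 1) * \<bar>y\<bar> - \<epsilon> * y\<^sup>2\<close>.\<close>

lemma abs_power_gauss_le:
  fixes y \<epsilon> :: real
  assumes "\<epsilon> > 0"
  shows "\<bar>y\<bar> ^ k * exp (- \<epsilon> * y\<^sup>2) \<le> exp ((real k + 1)\<^sup>2 / (4 * \<epsilon>)) * exp (- \<bar>y\<bar>)"
proof -
  have "\<bar>y\<bar> \<le> exp \<bar>y\<bar>" using exp_ge_add_one_self[of "\<bar>y\<bar>"] by linarith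
  then have "\<bar>y\<bar> ^ k \<le> exp \<bar>y\<bar> ^ k" by (intro power_mono) auto
  also have "\<dots> = exp (real k * \<bar>y\<bar>)" by (simp add: exp_of_nat_mult)
  finally have "\<bar>y\<bar> ^ k * exp (- \<epsilon> * y\<^sup>2) \<le> exp (real k * \<bar>y\<bar>) * exp (- \<epsilon> * y\<^sup>2)"
    by (intro mult_right_mono) auto
  also have "\<dots> = exp (real k * \<bar>y\<bar> - \<epsilon> * y\<^sup>2)" by (simp add: exp_diff exp_minus field_simps)
  also have "real k * \<bar>y\<bar> - \<epsilon> * y\<^sup>2 \<le> (real k + 1)\<^sup>2 / (4 * \<epsilon>) - \<bar>y\<bar>"
  proof -
    have "0 \<le> (2 * \<epsilon> * \<bar>y\<bar> - (real k + 1))\<^sup>2" by simp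
    then have "4 * \<epsilon> * ((real k + 1) * \<bar>y\<bar> - \<epsilon> * y\<^sup>2) \<le> (real k + 1)\<^sup>2"
      by (simp add: power2_diff power_mult_distrib algebra_simps power2_eq_square)
    then have "(real k + 1) * \<bar>y\<bar> - \<epsilon> * y\<^sup>2 \<le> (real k + 1)\<^sup>2 / (4 * \<epsilon>)"
      using assms by (simp add: pos_le_divide_eq mult.commute)
    then show ?thesis by (simp add: algebra_simps)
  qed
  also have "exp ((real k + 1)\<^sup>2 / (4 * \<epsilon>) - \<bar>y\<bar>) = exp ((real k + 1)\<^sup>2 / (4 * \<epsilon>)) * exp (- \<bar>y\<bar>)"
    by (simp add: exp_diff exp_minus field_simps)
  finally show ?thesis by simp
qed

lemma gauss_shift_le:
  fixes x \<epsilon> :: real and n :: int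
  assumes "\<epsilon> > 0" "\<bar>x\<bar> \<le> r"
  shows "\<bar>x + of_int n\<bar> ^ k * exp (- \<epsilon> * (x + of_int n)\<^sup>2) \<le>
           exp ((real k + 1)\<^sup>2 / (4 * \<epsilon>)) * exp r * exp (- \<bar>of_int n\<bar>)"
proof -
  have "exp (- \<bar>x + of_int n\<bar>) \<le> exp (r + - \<bar>of_int n\<bar>)" using assms(2) by simp
  then have *: "exp ((real k + 1)\<^sup>2 / (4 * \<epsilon>)) * exp (- \<bar>x + of_int n\<bar>) \<le>
      exp ((real k + 1)\<^sup>2 / (4 * \<epsilon>)) * (exp r * exp (- \<bar>of_int n\<bar>))"
    unfolding exp_add by (intro mult_left_mono) auto
  show ?thesis unfolding mult.assoc[of _ "exp r"]
    using abs_power_gauss_le[OF assms(1), of "x + of_int n" k] * by (rule order_trans)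
qed

lemma summable_on_exp_abs_int: "(\<lambda>n::int. C * exp (- \<bar>real_of_int n\<bar>)) summable_on UNIV"
proof -
  have geo: "(\<lambda>n::nat. exp (-1::real) ^ n) summable_on UNIV"
    by (intro norm_summable_imp_summable_on) (simp add: summable_geometric)
  have "(\<lambda>n::int. exp (- \<bar>real_of_int n\<bar>)) summable_on (range int)"
    using geo by (subst summable_on_reindex) (auto simp: o_def exp_of_nat_mult[symmetric])
  moreover have "(\<lambda>n::int. exp (- \<bar>real_of_int n\<bar>)) summable_on (range (\<lambda>n. - int n - 1))"
  proof (subst summable_on_reindex)
    show "inj (\<lambda>n. - int n - 1)" by (auto intro: injI)
    have "(\<lambda>n::nat. exp (-1::real) ^ n * exp (-1)) summable_on UNIV" using geo by (rule summable_on_cmult_left)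
    then show "((\<lambda>n::int. exp (- \<bar>real_of_int n\<bar>)) \<circ> (\<lambda>n. - int n - 1)) summable_on UNIV"
      by (rule summable_on_cong[THEN iffD1, rotated])
         (simp add: o_def exp_of_nat_mult[symmetric] mult_exp_exp)
  qed
  moreover have "range int \<inter> range (\<lambda>n. - int n - 1) = {}" by auto
  moreover have "range int \<union> range (\<lambda>n. - int n - 1) = UNIV"
  proof (intro equalityI subsetI UNIV_I)
    fix n :: int
    show "n \<in> range int \<union> range (\<lambda>n. - int n - 1)"
    proof (cases "n \<ge> 0")
      case True then show ?thesis by (metis UnI1 nonneg_int_cases range_eqI)
    next
      case False
      then have "n = - int (nat (- n - 1)) - 1" by simp
      then show ?thesis by blast
    qed
  qed
  ultimately have "(\<lambda>n::int. exp (- \<bar>real_of_int n\<bar>)) summable_on UNIV"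
    by (metis summable_on_Un_disjoint)
  then show ?thesis by (rule summable_on_cmult_right)
qed

lemma gauss_summable:
  fixes \<epsilon> a :: real
  assumes "\<epsilon> > 0"
  shows "(\<lambda>n::int. \<bar>a + of_int n\<bar> ^ k * exp (- \<epsilon> * (a + of_int n)\<^sup>2)) summable_on UNIV"
  by (rule summable_on_comparison_test[OF summable_on_exp_abs_int])
     (use gauss_shift_le[OF assms order_refl] in \<open>auto intro: mult_nonneg_nonneg\<close>)

section \<open>Fourier transforms of Gaussians\<close>

lemma gauss_integrable:
  assumes "t > 0"
  shows "integrable lborel (\<lambda>x::real. exp (- pi * t * x\<^sup>2))"
proof -
  define c where "c = sqrt (2 * pi * t)"
  have c: "c \<noteq> 0" "c\<^sup>2 = 2 * pi * t" using assms by (simp_all add: c_def)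
  have "integrable lborel (\<lambda>x. sqrt (2 * pi) * std_normal_density (0 + c * x))"
    using c by (intro integrable_mult_right lborel_integrable_real_affine integrable_normal_density) auto
  also have "(\<lambda>x. sqrt (2 * pi) * std_normal_density (0 + c * x)) = (\<lambda>x. exp (- pi * t * x\<^sup>2))"
    by (simp add: std_normal_density_def fun_eq_iff power_mult_distrib c)
  finally show ?thesis .
qed

lemma norm_real_times_cis [simp]: "norm (complex_of_real y * cis x) = \<bar>y\<bar>"
  by (simp add: norm_mult)

text \<open>Rescaling by \<open>c\<close> turns the Gaussian into a multiple of the standard normal
  density, whose characteristic function is known.\<close>

lemma gauss_fourier_integral:
  assumes t: "t > 0"
  shows "(LBINT x. complex_of_real (exp (- pi * t * x\<^sup>2)) * cis (2 * pi * s * x)) =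
           of_real (exp (- pi * s\<^sup>2 / t) / sqrt t)"
proof -
  define c where "c = sqrt (2 * pi * t)"
  have c: "c > 0" "c\<^sup>2 = 2 * pi * t" using assms by (simp_all add: c_def)
  define u where "u = 2 * pi * s / c"
  have "complex_of_real (exp (- (u\<^sup>2) / 2)) = char std_normal_distribution u"
    by (simp add: char_std_normal_distribution)
  also have "\<dots> = (CLINT x|lborel. std_normal_density x *\<^sub>R iexp (u * x))"
    unfolding char_def by (rule integral_density) auto
  also have "\<dots> = \<bar>c\<bar> *\<^sub>R (CLINT x|lborel. std_normal_density (0 + c * x) *\<^sub>R iexp (u * (0 + c * x)))"
    using c by (intro lborel_integral_real_affine) auto
  also have "(\<lambda>x. std_normal_density (0 + c * x) *\<^sub>R iexp (u * (0 + c * x))) =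
      (\<lambda>x. complex_of_real (1 / sqrt (2 * pi)) * (complex_of_real (exp (- pi * t * x\<^sup>2)) * cis (2 * pi * s * x)))"
    using c by (auto simp: std_normal_density_def fun_eq_iff power_mult_distrib u_def cis_conv_exp
        scaleR_conv_of_real mult_ac)
  finally have "complex_of_real (exp (- (u\<^sup>2) / 2)) =
      c / sqrt (2 * pi) * (LBINT x. complex_of_real (exp (- pi * t * x\<^sup>2)) * cis (2 * pi * s * x))"
    using c(1) by (simp add: scaleR_conv_of_real)
  moreover have "- (u\<^sup>2) / 2 = - pi * s\<^sup>2 / t" using c t
    by (simp add: u_def power_divide power_mult_distrib field_simps power2_eq_square)
  moreover have "c / sqrt (2 * pi) = sqrt t" using t by (simp add: c_def real_sqrt_mult)
  ultimately have "complex_of_real (exp (- pi * s\<^sup>2 / t)) =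
      of_real (sqrt t) * (LBINT x. complex_of_real (exp (- pi * t * x\<^sup>2)) * cis (2 * pi * s * x))"
    by (metis of_real_divide)
  then show ?thesis using t by (simp add: field_simps)
qed

lemma gauss_fourier_limit:
  assumes t: "t > 0"
  shows "(\<lambda>N::nat. integral {- real N..real N} (\<lambda>x. complex_of_real (exp (- pi * t * x\<^sup>2)) * cis (2 * pi * s * x)))
           \<longlonglongrightarrow> of_real (exp (- pi * s\<^sup>2 / t) / sqrt t)"
proof -
  define f where "f = (\<lambda>x. complex_of_real (exp (- pi * t * x\<^sup>2)) * cis (2 * pi * s * x))"
  have cont: "continuous_on S f" for S unfolding f_def by (intro continuous_intros)
  have meas: "f \<in> borel_measurable lborel"
    using borel_measurable_continuous_onI[OF cont] by simp
  have "(\<lambda>N::nat. LBINT x. indicator {- real N..real N} x *\<^sub>R f x) \<longlonglongrightarrow> (LBINT x. f x)"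
  proof (rule integral_dominated_convergence)
    show "integrable lborel (\<lambda>x::real. exp (- pi * t * x\<^sup>2))" by (rule gauss_integrable[OF t])
    show "AE x in lborel. (\<lambda>N. indicator {- real N..real N} x *\<^sub>R f x) \<longlonglongrightarrow> f x"
    proof (rule AE_I2)
      fix x :: real
      have "eventually (\<lambda>N::nat. \<bar>x\<bar> \<le> real N) sequentially"
        using eventually_ge_at_top[of "nat \<lceil>\<bar>x\<bar>\<rceil>"] by eventually_elim linarith
      then have "eventually (\<lambda>N::nat. f x = indicator {- real N..real N} x *\<^sub>R f x) sequentially"
        by eventually_elim (auto simp: indicator_def)
      then show "(\<lambda>N. indicator {- real N..real N} x *\<^sub>R f x) \<longlonglongrightarrow> f x"
        by (rule Lim_transform_eventually[OF tendsto_const])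
    qed
    show "AE x in lborel. norm (indicator {- real N..real N} x *\<^sub>R f x) \<le> exp (- pi * t * x\<^sup>2)" for N
      by (rule AE_I2) (simp add: f_def indicator_def)
  qed (use meas in auto)
  moreover have "(LBINT x. indicator {- real N..real N} x *\<^sub>R f x) = integral {- real N..real N} f" for N
  proof -
    have "set_integrable lborel {- real N..real N} f"
      by (intro borel_integrable_atLeastAtMost' cont)
    from set_borel_integral_eq_integral(2)[OF this] show ?thesis
      by (simp add: set_lebesgue_integral_def)
  qed
  ultimately show ?thesis using gauss_fourier_integral[OF t] by (simp add: f_def)
qed

text \<open>Integration by parts: the derivative of \<open>E\<close> combines \<open>g\<close> and
  \<open>E\<close> linearly, so the first moment reduces to \<open>gauss_fourier_limit\<close> up to
  boundary values, which vanish in the limit.\<close>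

lemma gauss_fourier_limit_1:
  assumes t: "t > 0"
  shows "(\<lambda>N::nat. integral {- real N..real N} (\<lambda>x. complex_of_real (x * exp (- pi * t * x\<^sup>2)) * cis (2 * pi * s * x)))
           \<longlonglongrightarrow> \<i> * of_real s / of_real t * of_real (exp (- pi * s\<^sup>2 / t) / sqrt t)"
proof -
  define E where "E = (\<lambda>x. complex_of_real (exp (- pi * t * x\<^sup>2)) * cis (2 * pi * s * x))"
  define I where "I = (\<lambda>N::nat. integral {- real N..real N} E)"
  define g where "g = (\<lambda>x. complex_of_real (x * exp (- pi * t * x\<^sup>2)) * cis (2 * pi * s * x))"
  have E_cont: "continuous_on S E" for S unfolding E_def by (intro continuous_intros)
  have g: "integral {- real N..real N} g = (2 * pi * \<i> * of_real s * I N - (E N - E (- real N))) / (2 * pi * t)" for N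
  proof -
    have "((\<lambda>x. - (2 * pi * t) * g x + 2 * pi * \<i> * of_real s * E x) has_integral (E N - E (- real N))) {- real N..real N}"
    proof (rule fundamental_theorem_of_calculus)
      fix x :: real
      have "((\<lambda>z. exp (- pi * t * z\<^sup>2 + \<i> * (2 * pi * s * z))) has_field_derivative
          exp (- pi * t * (of_real x)\<^sup>2 + \<i> * (2 * pi * s * of_real x)) * (- 2 * pi * t * of_real x + 2 * pi * \<i> * s)) (at (of_real x))"
        by (auto intro!: derivative_eq_intros)
      from has_vector_derivative_real_field[OF this]
      have "((\<lambda>x. exp (- pi * t * (of_real x)\<^sup>2 + \<i> * (2 * pi * s * of_real x))) has_vector_derivative
          exp (- pi * t * (of_real x)\<^sup>2 + \<i> * (2 * pi * s * of_real x)) * (- 2 * pi * t * of_real x + 2 * pi * \<i> * s))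
          (at x within {- real N..real N})"
        by (simp add: o_def)
      moreover have E_exp: "exp (- pi * t * (of_real x)\<^sup>2 + \<i> * (2 * pi * s * of_real x)) = E x" for x
        by (simp add: E_def cis_conv_exp mult_exp_exp algebra_simps flip: exp_of_real)
      moreover have "E x * (- 2 * pi * t * of_real x + 2 * pi * \<i> * s) =
          - (2 * pi * t) * g x + 2 * pi * \<i> * of_real s * E x"
        by (simp add: g_def E_def algebra_simps)
      ultimately show "(E has_vector_derivative - (2 * pi * t) * g x + 2 * pi * \<i> * of_real s * E x) (at x within {- real N..real N})"
        by (simp only:)
    qed simp
    moreover have "((\<lambda>x. 2 * pi * \<i> * of_real s * E x) has_integral 2 * pi * \<i> * of_real s * I N) {- real N..real N}"
      unfolding I_def by (intro has_integral_mult_right integrable_integral integrable_continuous_interval E_cont)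
    ultimately have "((\<lambda>x. (- (2 * pi * t) * g x + 2 * pi * \<i> * of_real s * E x) - 2 * pi * \<i> * of_real s * E x) has_integral
        (E N - E (- real N)) - 2 * pi * \<i> * of_real s * I N) {- real N..real N}"
      by (rule has_integral_diff)
    then have "((\<lambda>x. (-1 / (2 * pi * t)) * (- (2 * pi * t) * g x)) has_integral
        (-1 / (2 * pi * t)) * ((E N - E (- real N)) - 2 * pi * \<i> * of_real s * I N)) {- real N..real N}"
      by (intro has_integral_mult_right) simp
    then have "(g has_integral (-1 / (2 * pi * t)) * ((E N - E (- real N)) - 2 * pi * \<i> * of_real s * I N)) {- real N..real N}"
      using t by simp
    then have "integral {- real N..real N} g =
        (-1 / (2 * pi * t)) * ((E N - E (- real N)) - 2 * pi * \<i> * of_real s * I N)"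
      by (rule integral_unique)
    also have "\<dots> = (2 * pi * \<i> * of_real s * I N - (E N - E (- real N))) / (2 * pi * t)"
      using t by (simp add: divide_simps)
    finally show ?thesis .
  qed
  have "(\<lambda>N::nat. exp (- pi * t * (real N)\<^sup>2)) \<longlonglongrightarrow> 0" using t by real_asymp
  then have E0: "(\<lambda>N::nat. E (real N)) \<longlonglongrightarrow> 0" "(\<lambda>N::nat. E (- real N)) \<longlonglongrightarrow> 0"
    by (rule Lim_null_comparison[rotated], simp add: E_def)+
  have "(\<lambda>N. (2 * pi * \<i> * of_real s * I N - (E N - E (- real N))) / (2 * pi * t)) \<longlonglongrightarrow>
      (2 * pi * \<i> * of_real s * of_real (exp (- pi * s\<^sup>2 / t) / sqrt t) - (0 - 0)) / (2 * pi * t)"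
    unfolding I_def E_def
    by (intro tendsto_intros gauss_fourier_limit[OF t] E0[unfolded E_def]) (use t in auto)
  then show ?thesis unfolding g[symmetric] g_def using t by (simp add: field_simps)
qed

text \<open>The coefficient of index \<open>k\<close> is the transform at frequency
  \<open>s = - k\<close>, whence the factor \<open>- \<i> * k / t\<close> for
  \<open>j = 1\<close>.\<close>

lemma gauss_poisson:
  fixes t a :: real
  assumes t: "t > 0" and j: "j \<le> 1"
  shows "(\<Sum>\<^sub>\<infinity>n::int. complex_of_real ((a + of_int n) ^ j * exp (- pi * t * (a + of_int n)\<^sup>2))) =
         (\<Sum>\<^sub>\<infinity>k::int. (- \<i> * of_int k / of_real t) ^ j * of_real (exp (- pi * (of_int k)\<^sup>2 / t) / sqrt t) *
            cis (2 * pi * of_int k * a))"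
proof (rule poisson_summation[of "\<lambda>x. complex_of_real (x ^ j * exp (- pi * t * x\<^sup>2))"])
  have pt: "pi * t > 0" using t by simp
  show "continuous_on UNIV (\<lambda>x. complex_of_real (x ^ j * exp (- pi * t * x\<^sup>2)))"
    by (intro continuous_intros)
  show "norm (complex_of_real ((x + of_int n) ^ j * exp (- pi * t * (x + of_int n)\<^sup>2))) \<le>
      exp ((real j + 1)\<^sup>2 / (4 * (pi * t))) * exp 1 * exp (- \<bar>real_of_int n\<bar>)" if "x \<in> {0..1}" for x n
    using gauss_shift_le[OF pt, where x = x and r = 1 and k = j and n = n] that by (simp only: norm_of_real abs_mult power_abs) simp
  show "(\<lambda>n. exp ((real j + 1)\<^sup>2 / (4 * (pi * t))) * exp 1 * exp (- \<bar>real_of_int n\<bar>)) summable_on UNIV"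
    by (rule summable_on_exp_abs_int)
  show "(\<lambda>N::nat. integral {- real N..real N}
      (\<lambda>x. complex_of_real (x ^ j * exp (- pi * t * x\<^sup>2)) * cis (2 * pi * of_int (- k) * x))) \<longlonglongrightarrow>
      (- \<i> * of_int k / of_real t) ^ j * of_real (exp (- pi * (of_int k)\<^sup>2 / t) / sqrt t)" for k
  proof -
    consider "j = 0" | "j = 1" using j by linarith
    then show ?thesis
    proof cases
      case 1
      then show ?thesis using gauss_fourier_limit[OF t, of "of_int (- k)"] by simp
    next
      case 2
      then show ?thesis using gauss_fourier_limit_1[OF t, of "of_int (- k)"] by simp
    qed
  qed
  show "(\<lambda>k. norm ((- \<i> * of_int k / of_real t) ^ j * of_real (exp (- pi * (of_int k)\<^sup>2 / t) / sqrt t))) summable_on UNIV"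
  proof -
    have "(\<lambda>k::int. (\<bar>0 + of_int k\<bar> ^ j * exp (- (pi / t) * (0 + of_int k)\<^sup>2)) * (1 / (t ^ j * sqrt t))) summable_on UNIV"
      using t by (intro summable_on_cmult_left gauss_summable) simp
    then show ?thesis
      by (rule summable_on_cong[THEN iffD1, rotated])
         (use t in \<open>simp add: norm_mult norm_power norm_divide power_divide\<close>)
  qed
qed

text \<open>On a closed disc of radius \<open>Im z / 2\<close> about \<open>z\<close> the imaginary
  part stays at least \<open>Im z / 2\<close>, so one summable majorant serves the whole disc and
  the limit is locally uniform.\<close>

lemma holomorphic_gauss_series:
  fixes c :: "int \<Rightarrow> complex" and x :: "int \<Rightarrow> real"
  assumes "\<And>\<epsilon>. \<epsilon> > 0 \<Longrightarrow> (\<lambda>n. norm (c n) * exp (- \<epsilon> * (x n)\<^sup>2)) summable_on UNIV"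
  shows "(\<lambda>z. \<Sum>\<^sub>\<infinity>n. c n * exp (pi * \<i> * z * of_real ((x n)\<^sup>2))) holomorphic_on {z. Im z > 0}"
proof -
  let ?f = "\<lambda>n z. c n * exp (pi * \<i> * z * of_real ((x n)\<^sup>2))"
  have "(\<lambda>z. \<Sum>\<^sub>\<infinity>n. ?f n z) field_differentiable at z" if z: "Im z > 0" for z
  proof -
    define r where "r = Im z / 2"
    have r: "r > 0" using z by (simp add: r_def)
    have "norm (?f n w) \<le> norm (c n) * exp (- (pi * r) * (x n)\<^sup>2)" if "w \<in> cball z r" for n w
    proof -
      have "\<bar>Im (z - w)\<bar> \<le> r" using abs_Im_le_cmod[of "z - w"] that by (simp add: dist_norm)
      then have "\<bar>Im z - Im w\<bar> \<le> r" by simp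
      then have "r \<le> Im w" unfolding r_def by linarith
      then have "pi * r * (x n)\<^sup>2 \<le> pi * Im w * (x n)\<^sup>2" by (intro mult_right_mono mult_left_mono) auto
      then show ?thesis by (simp add: norm_mult mult_left_mono)
    qed
    moreover have "(\<lambda>n. norm (c n) * exp (- (pi * r) * (x n)\<^sup>2)) summable_on UNIV"
      using r by (intro assms) simp
    ultimately have lim: "uniform_limit (cball z r) (\<lambda>X w. \<Sum>n\<in>X. ?f n w) (\<lambda>w. \<Sum>\<^sub>\<infinity>n. ?f n w) (finite_subsets_at_top UNIV)"
      by (rule uniform_limit_infsum)
    have cont: "\<forall>\<^sub>F X in finite_subsets_at_top UNIV. continuous_on (cball z r) (\<lambda>w. \<Sum>n\<in>X. ?f n w) \<and>
        (\<lambda>w. \<Sum>n\<in>X. ?f n w) holomorphic_on ball z r"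
      by (intro always_eventually allI conjI continuous_intros holomorphic_intros)
    have "(\<lambda>w. \<Sum>\<^sub>\<infinity>n. ?f n w) holomorphic_on ball z r"
      by (rule holomorphic_uniform_limit[OF cont lim finite_subsets_at_top_neq_bot])
    then show ?thesis using r by (auto intro: holomorphic_on_imp_differentiable_at)
  qed
  then show ?thesis by (auto simp: holomorphic_on_def intro: field_differentiable_at_within)
qed

definition shifted_theta :: "nat \<Rightarrow> real \<Rightarrow> complex \<Rightarrow> complex" where
  "shifted_theta j a z =
     (\<Sum>\<^sub>\<infinity>n::int. of_real ((a + of_int n) ^ j) * exp (pi * \<i> * z * of_real ((a + of_int n)\<^sup>2)))"

text \<open>The Poisson dual of \<open>shifted_theta\<close>: the shift by \<open>a\<close> becomes
  a character of the summation index.\<close>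

definition twisted_theta :: "nat \<Rightarrow> real \<Rightarrow> complex \<Rightarrow> complex" where
  "twisted_theta j a z =
     (\<Sum>\<^sub>\<infinity>n::int. of_int n ^ j * cis (2 * pi * of_int n * a) * exp (pi * \<i> * z * of_real ((of_int n)\<^sup>2)))"

lemma shifted_theta_holomorphic: "shifted_theta j a holomorphic_on {z. Im z > 0}"
  unfolding shifted_theta_def
  by (rule holomorphic_gauss_series)
     (use gauss_summable in \<open>simp only: norm_of_real power_abs[symmetric]\<close>)

lemma twisted_theta_holomorphic: "twisted_theta j a holomorphic_on {z. Im z > 0}"
  unfolding twisted_theta_def
  by (rule holomorphic_gauss_series)
     (use gauss_summable[of _ 0 j] in \<open>simp add: norm_mult norm_power\<close>)

text \<open>On the imaginary axis the sums are over real Gaussians and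
  \<open>csqrt (- \<i> * z)\<close> is a positive root, so \<open>gauss_poisson\<close> applies.
  Both sides are holomorphic, and the identity theorem extends the equation to the
  half-plane.\<close>

lemma shifted_theta_inversion:
  assumes j: "j \<le> 1" and z: "Im z > 0"
  shows "shifted_theta j a (- 1 / z) = (- \<i>) ^ j * csqrt (- \<i> * z) ^ (2 * j + 1) * twisted_theta j a z"
proof -
  define U where "U = (\<lambda>t. \<i> * complex_of_real t) ` {0<..}"
  define D where "D = (\<lambda>z. shifted_theta j a (- 1 / z) - (- \<i>) ^ j * csqrt (- \<i> * z) ^ (2 * j + 1) * twisted_theta j a z)"
  have "D z = 0"
  proof (rule analytic_continuation[where f = D and U = U and S = "{z. Im z > 0}" and \<xi> = \<i>])
    have "(\<lambda>z. shifted_theta j a (- 1 / z)) holomorphic_on {z. Im z > 0}"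
    proof -
      have "(shifted_theta j a \<circ> (\<lambda>z. - 1 / z)) holomorphic_on {z. Im z > 0}"
        by (rule holomorphic_on_compose_gen[OF _ shifted_theta_holomorphic])
           (auto intro!: holomorphic_intros simp: Im_divide divide_neg_pos add_nonneg_pos)
      then show ?thesis by (simp add: o_def)
    qed
    moreover have "- \<i> * z \<notin> \<real>\<^sub>\<le>\<^sub>0" if "Im z > 0" for z
      using that by (auto simp: complex_nonpos_Reals_iff)
    ultimately show "D holomorphic_on {z. Im z > 0}" unfolding D_def
      by (intro holomorphic_intros twisted_theta_holomorphic) auto
    show "open {z. Im z > 0}" "connected {z. Im z > 0}"
      by (simp_all add: open_halfspace_Im_gt convex_connected convex_halfspace_Im_gt)
    show "U \<subseteq> {z. Im z > 0}" by (auto simp: U_def)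
    have "continuous_on {0<..} (\<lambda>t. \<i> * complex_of_real t)" by (intro continuous_intros)
    then have "connected U" unfolding U_def by (intro connected_continuous_image) auto
    moreover have "\<i> * of_real 1 \<in> U" "\<i> * of_real 2 \<in> U" unfolding U_def by (auto simp del: of_real_1 of_real_numeral)
    then have "\<i> \<in> U" "U \<noteq> {x}" for x by auto
    ultimately show "\<i> islimpt U" by (intro connected_imp_perfect)
    fix w assume "w \<in> U"
    then obtain t where t: "t > 0" "w = \<i> * of_real t" by (auto simp: U_def)
    have "shifted_theta j a (- 1 / w) =
        (\<Sum>\<^sub>\<infinity>n::int. complex_of_real ((a + of_int n) ^ j * exp (- pi * (1 / t) * (a + of_int n)\<^sup>2)))"
      unfolding shifted_theta_def
    proof (rule infsum_cong)
      fix n :: int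
      have E: "pi * \<i> * (- 1 / w) * of_real ((a + of_int n)\<^sup>2) = of_real (- pi * (1 / t) * (a + of_int n)\<^sup>2)"
        using t by (simp add: field_simps)
      show "of_real ((a + of_int n) ^ j) * exp (pi * \<i> * (- 1 / w) * of_real ((a + of_int n)\<^sup>2)) =
        complex_of_real ((a + of_int n) ^ j * exp (- pi * (1 / t) * (a + of_int n)\<^sup>2))"
        unfolding E unfolding exp_of_real by (rule of_real_mult[symmetric])
    qed
    also have "\<dots> = (\<Sum>\<^sub>\<infinity>k::int. (- \<i> * of_int k / of_real (1 / t)) ^ j *
        of_real (exp (- pi * (of_int k)\<^sup>2 / (1 / t)) / sqrt (1 / t)) * cis (2 * pi * of_int k * a))"
      using t by (intro gauss_poisson j) auto
    also have "\<dots> = (\<Sum>\<^sub>\<infinity>k::int. ((- \<i>) ^ j * of_real (t ^ j * sqrt t)) *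
        (of_int k ^ j * cis (2 * pi * of_int k * a) * exp (pi * \<i> * w * of_real ((of_int k)\<^sup>2))))"
    proof (rule infsum_cong)
      fix k :: int
      have "pi * \<i> * w * of_real ((of_int k)\<^sup>2) = of_real (- pi * (of_int k)\<^sup>2 / (1 / t))"
        by (simp add: t(2) algebra_simps)
      moreover have "exp (- pi * (of_int k)\<^sup>2 / (1 / t)) / sqrt (1 / t) = sqrt t * exp (- pi * (of_int k)\<^sup>2 / (1 / t))"
        using t by (simp add: real_sqrt_divide)
      moreover have p: "- \<i> * of_int k / of_real (1 / t) = (- \<i>) * (of_real t * of_int k)" by simp
      ultimately show "(- \<i> * of_int k / of_real (1 / t)) ^ j *
        of_real (exp (- pi * (of_int k)\<^sup>2 / (1 / t)) / sqrt (1 / t)) * cis (2 * pi * of_int k * a) =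
        ((- \<i>) ^ j * of_real (t ^ j * sqrt t)) *
        (of_int k ^ j * cis (2 * pi * of_int k * a) * exp (pi * \<i> * w * of_real ((of_int k)\<^sup>2)))"
        unfolding p power_mult_distrib by (simp only: exp_of_real of_real_mult of_real_power mult_ac)
    qed
    also have "\<dots> = ((- \<i>) ^ j * of_real (t ^ j * sqrt t)) * twisted_theta j a w"
      unfolding twisted_theta_def by (rule infsum_cmult_right')
    also have "of_real (t ^ j * sqrt t) = csqrt (- \<i> * w) ^ (2 * j + 1)"
    proof -
      have "- \<i> * w = of_real t" by (simp add: t(2) flip: mult.assoc)
      then have "csqrt (- \<i> * w) = of_real (sqrt t)" using t(1) by simp
      moreover have "sqrt t ^ (2 * j + 1) = t ^ j * sqrt t" using t(1) by (simp add: power_mult)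
      ultimately show ?thesis by (simp only: of_real_power[symmetric])
    qed
    finally show "D w = 0" by (simp add: D_def)
  qed (use z in auto)
  then show ?thesis by (simp add: D_def)
qed

lemma infsum_int_residue_split:
  fixes f :: "int \<Rightarrow> 'a::banach"
  assumes "f summable_on UNIV" "M > 0"
  shows "infsum f UNIV = (\<Sum>s<M. \<Sum>\<^sub>\<infinity>l. f (int M * l + int s))"
proof -
  let ?g = "\<lambda>(s, l). int M * l + int s"
  have bij: "bij_betw ?g ({..<M} \<times> UNIV) UNIV"
    by (rule bij_betw_byWitness[of _ "\<lambda>n. (nat (n mod int M), n div int M)"])
       (use assms(2) in \<open>auto simp: nat_less_iff\<close>)
  have "infsum f UNIV = infsum (\<lambda>x. f (?g x)) ({..<M} \<times> UNIV)"
    by (rule infsum_reindex_bij_betw[OF bij, symmetric])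
  also have "\<dots> = (\<Sum>\<^sub>\<infinity>(s, l)\<in>{..<M} \<times> UNIV. f (int M * l + int s))"
    by (rule infsum_cong) auto
  also have "\<dots> = (\<Sum>\<^sub>\<infinity>s\<in>{..<M}. \<Sum>\<^sub>\<infinity>l. f (int M * l + int s))"
  proof (rule infsum_Sigma'_banach[symmetric])
    have "(\<lambda>x. f (?g x)) summable_on ({..<M} \<times> UNIV)"
      using summable_on_reindex_bij_betw[OF bij] assms(1) by blast
    then show "(\<lambda>(s, l). f (int M * l + int s)) summable_on {..<M} \<times> UNIV"
      by (rule summable_on_cong[THEN iffD1, rotated]) auto
  qed
  finally show ?thesis by simp
qed

lemma theta_eq_shifted_theta: "theta m r j z = shifted_theta j (of_int r / (2 * m)) (2 * m * z)"
  unfolding theta_def shifted_theta_def Let_def by (intro infsum_cong) (simp add: algebra_simps)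

lemma theta_holomorphic:
  assumes "m > 0"
  shows "theta m r j holomorphic_on {z. Im z > 0}"
proof -
  have "(shifted_theta j (of_int r / (2 * m)) \<circ> (\<lambda>z. 2 * m * z)) holomorphic_on {z. Im z > 0}"
    by (rule holomorphic_on_compose_gen[OF _ shifted_theta_holomorphic])
       (use assms in \<open>auto intro!: holomorphic_intros\<close>)
  then show ?thesis by (simp add: o_def theta_eq_shifted_theta[abs_def])
qed

lemma csqrt_divide_of_real:
  assumes "x > 0"
  shows "csqrt (z / of_real x) = csqrt z / of_real (sqrt x)"
proof (rule csqrt_unique)
  show "(csqrt z / of_real (sqrt x))\<^sup>2 = z / of_real x"
    using assms by (simp add: power_divide flip: of_real_power)
  show "0 < Re (csqrt z / of_real (sqrt x)) \<or> Re (csqrt z / of_real (sqrt x)) = 0 \<and> 0 \<le> Im (csqrt z / of_real (sqrt x))"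
    using csqrt_principal[of z] assms
    by (simp add: Re_divide_of_real Im_divide_of_real zero_less_divide_iff zero_le_divide_iff del: csqrt.sel)
qed

text \<open>Writing the index as \<open>2 * m * l + s\<close> gives \<open>2 * m\<close> times an
  element of the coset of \<open>s / (2 * m)\<close>. The character sees only \<open>s\<close>,
  because \<open>l * r\<close> is an integer.\<close>

lemma twisted_theta_split:
  assumes m: "m > 0" and z: "Im z > 0"
  shows "twisted_theta j (of_int r / (2 * m)) (z / (2 * m)) =
    of_nat (2 * m) ^ j * (\<Sum>s<2 * m. cis (2 * pi * (real s * of_int r) / (2 * m)) * theta m (int s) j z)"
proof -
  define f where "f = (\<lambda>n::int. of_int n ^ j * cis (2 * pi * of_int n * (of_int r / (2 * m))) *
      exp (pi * \<i> * (z / (2 * m)) * of_real ((of_int n)\<^sup>2)))"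
  have "f summable_on UNIV"
  proof (rule abs_summable_summable)
    have "(\<lambda>n::int. \<bar>0 + of_int n\<bar> ^ j * exp (- (pi * Im z / (2 * m)) * (0 + of_int n)\<^sup>2)) summable_on UNIV"
      using m z by (intro gauss_summable) auto
    then show "(\<lambda>n. norm (f n)) summable_on UNIV"
      by (rule summable_on_cong[THEN iffD1, rotated]) (simp add: f_def norm_mult norm_power)
  qed
  then have "twisted_theta j (of_int r / (2 * m)) (z / (2 * m)) = (\<Sum>s<2 * m. \<Sum>\<^sub>\<infinity>l. f (int (2 * m) * l + int s))"
    unfolding twisted_theta_def f_def[symmetric] using m by (intro infsum_int_residue_split) auto
  also have "\<dots> = (\<Sum>s<2 * m. of_nat (2 * m) ^ j * (cis (2 * pi * (real s * of_int r) / (2 * m)) * theta m (int s) j z))"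
  proof (rule sum.cong[OF refl])
    fix s
    have "f (int (2 * m) * l + int s) = of_nat (2 * m) ^ j * cis (2 * pi * (real s * of_int r) / (2 * m)) *
      (let n = (of_int l + of_int (int s) / (2 * of_nat m) :: complex)
        in n ^ j * exp (2 * of_real pi * \<i> * of_nat m * n\<^sup>2 * z))" for l
    proof -
      define n where "n = (of_int l + of_int (int s) / (2 * of_nat m) :: complex)"
      have n: "of_int (int (2 * m) * l + int s) = of_nat (2 * m) * n"
        using m by (simp add: n_def field_simps)
      have "cis (2 * pi * of_int (int (2 * m) * l + int s) * (of_int r / (2 * m))) =
          cis (2 * pi * (real s * of_int r) / (2 * m)) * cis (2 * pi * of_int (l * r))"
        unfolding cis_mult using m by (intro arg_cong[of _ _ cis]) (simp add: field_simps)
      then have c: "cis (2 * pi * of_int (int (2 * m) * l + int s) * (of_int r / (2 * m))) =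
          cis (2 * pi * (real s * of_int r) / (2 * m))" by (simp only: cis_2pi_int mult_1_right)
      have "pi * \<i> * (z / (2 * m)) * of_real ((of_int (int (2 * m) * l + int s))\<^sup>2) =
          2 * of_real pi * \<i> * of_nat m * n\<^sup>2 * z"
        unfolding of_real_power of_real_of_int_eq n using m by (simp add: power2_eq_square)
      then show ?thesis unfolding f_def c n_def[symmetric] Let_def unfolding n
        by (simp add: power_mult_distrib)
    qed
    then show "(\<Sum>\<^sub>\<infinity>l. f (int (2 * m) * l + int s)) =
        of_nat (2 * m) ^ j * (cis (2 * pi * (real s * of_int r) / (2 * m)) * theta m (int s) j z)"
      unfolding theta_def by (simp only: infsum_cmult_right' mult.assoc)
  qed
  finally show ?thesis by (simp add: sum_distrib_left)
qed

text \<open>The thetas of fixed \<open>m\<close> and \<open>j\<close> transform by the finite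
  Fourier transform modulo \<open>2 * m\<close>. The powers of \<open>2 * m\<close> from the split
  and from the rescaled root cancel except for the normalisation
  \<open>sqrt (2 * m)\<close>.\<close>

lemma theta_inversion:
  assumes m: "m > 0" and j: "j \<le> 1" and z: "Im z > 0"
  shows "theta m r j (- 1 / z) = (- \<i>) ^ j * csqrt (- \<i> * z) ^ (2 * j + 1) / of_real (sqrt (2 * m)) *
           (\<Sum>s<2 * m. cis (2 * pi * (real s * of_int r) / (2 * m)) * theta m (int s) j z)"
proof -
  define S where "S = (\<Sum>s<2 * m. cis (2 * pi * (real s * of_int r) / (2 * m)) * theta m (int s) j z)"
  have "theta m r j (- 1 / z) = shifted_theta j (of_int r / (2 * m)) (- 1 / (z / (2 * m)))"
    unfolding theta_eq_shifted_theta by simp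
  also have "\<dots> = (- \<i>) ^ j * csqrt (- \<i> * (z / (2 * m))) ^ (2 * j + 1) *
      twisted_theta j (of_int r / (2 * m)) (z / (2 * m))"
    using m z by (intro shifted_theta_inversion j) auto
  also have "twisted_theta j (of_int r / (2 * m)) (z / (2 * m)) = of_nat (2 * m) ^ j * S"
    unfolding S_def using twisted_theta_split[OF m z, of j r] by simp
  also have "csqrt (- \<i> * (z / (2 * m))) = csqrt (- \<i> * z) / of_real (sqrt (2 * m))"
    using csqrt_divide_of_real[of "2 * m" "- \<i> * z"] m by simp
  also have "(csqrt (- \<i> * z) / of_real (sqrt (2 * m))) ^ (2 * j + 1) =
      csqrt (- \<i> * z) ^ (2 * j + 1) / (of_nat (2 * m) ^ j * of_real (sqrt (2 * m)))"
  proof -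
    have "sqrt (2 * m) ^ (2 * j + 1) = real (2 * m) ^ j * sqrt (2 * m)" by (simp add: power_mult)
    from arg_cong[OF this, of complex_of_real]
    have "of_real (sqrt (2 * m)) ^ (2 * j + 1) = (of_nat (2 * m) ^ j * of_real (sqrt (2 * m)) :: complex)"
      by (simp only: of_real_mult of_real_of_nat_eq of_real_power)
    then show ?thesis by (simp only: power_divide)
  qed
  finally show ?thesis using m by (simp add: S_def)
qed

section \<open>The pentagonal number theorem and the eta function\<close>

text \<open>
  Shanks' finite form of Euler's pentagonal number theorem: as \<open>n \<rightarrow> \<infinity>\<close>, only the term with \<open>s = 0\<close>
  survives, and it tends to the Euler product.
\<close>

definition shanks_term :: "'a::comm_ring_1 \<Rightarrow> nat \<Rightarrow> nat \<Rightarrow> 'a" where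
  "shanks_term q n s = (-1) ^ s * (\<Prod>i=s..<n. 1 - q ^ Suc i) * q ^ (s * n + \<Sum>{..s})"

text \<open>The exponents are the generalised pentagonal numbers \<open>k (3 k - 1) / 2\<close> and
  \<open>k (3 k + 1) / 2\<close>, written without division.\<close>

definition pentagonal_sum :: "'a::comm_ring_1 \<Rightarrow> nat \<Rightarrow> 'a" where
  "pentagonal_sum q n = 1 + (\<Sum>k=1..n. (-1) ^ k * (q ^ (k * k + \<Sum>{..<k}) + q ^ (k * k + \<Sum>{..k})))"

text \<open>Raising \<open>n\<close> by one multiplies a term by
  \<open>(1 - q ^ Suc n) * q ^ s\<close>. The closed form at \<open>m\<close> equals
  \<open>shanks_term q n (Suc m) * (1 - q ^ Suc m)\<close>, so it merges with the next
  difference.\<close>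

lemma shanks_telescope:
  assumes "m \<le> n"
  shows "(\<Sum>s\<le>m. shanks_term q (Suc n) s - shanks_term q n s) = - shanks_term q n m * q ^ (Suc n + m)"
proof -
  have step: "shanks_term q (Suc n) s = shanks_term q n s * (1 - q ^ Suc n) * q ^ s" if "s \<le> n" for s
    using that by (simp add: shanks_term_def prod.atLeastLessThan_Suc power_add mult_ac)
  show ?thesis using assms
  proof (induction m)
    case 0
    then show ?case using step[of 0] by (simp add: algebra_simps)
  next
    case (Suc m)
    have "shanks_term q n (Suc m) * (1 - q ^ Suc m) = - shanks_term q n m * q ^ (Suc n + m)"
      if "shanks_term q n m = (-1) ^ m * ((1 - q ^ Suc m) * (\<Prod>i=Suc m..<n. 1 - q ^ Suc i)) * q ^ (m * n + \<Sum>{..m})"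
      unfolding that by (simp add: shanks_term_def power_add algebra_simps)
    moreover have "shanks_term q n m = (-1) ^ m * ((1 - q ^ Suc m) * (\<Prod>i=Suc m..<n. 1 - q ^ Suc i)) * q ^ (m * n + \<Sum>{..m})"
      using Suc.prems by (simp add: shanks_term_def prod.atLeast_Suc_lessThan)
    ultimately have *: "- shanks_term q n m * q ^ (Suc n + m) = shanks_term q n (Suc m) * (1 - q ^ Suc m)" by simp
    have "(\<Sum>s\<le>Suc m. shanks_term q (Suc n) s - shanks_term q n s) =
        shanks_term q n (Suc m) * (1 - q ^ Suc m) + (shanks_term q (Suc n) (Suc m) - shanks_term q n (Suc m))"
      unfolding sum.atMost_Suc Suc.IH[OF Suc_leD[OF Suc.prems]] * ..
    also have "\<dots> = - shanks_term q n (Suc m) * q ^ (Suc n + Suc m)"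
      unfolding step[OF Suc.prems] by (simp add: algebra_simps power_add)
    finally show ?case .
  qed
qed

text \<open>Passing from \<open>n\<close> to \<open>Suc n\<close> adds the term
  \<open>s = Suc n\<close> and the telescoped remainder; these are the two new pentagonal
  powers.\<close>

lemma shanks_identity: "(\<Sum>s\<le>n. shanks_term q n s) = pentagonal_sum q n"
proof (induction n)
  case 0
  show ?case by (simp add: shanks_term_def pentagonal_sum_def)
next
  case (Suc n)
  have "(\<Sum>s\<le>Suc n. shanks_term q (Suc n) s) =
      shanks_term q (Suc n) (Suc n) + (\<Sum>s\<le>n. shanks_term q (Suc n) s - shanks_term q n s) + (\<Sum>s\<le>n. shanks_term q n s)"
    by (simp add: sum_subtractf)
  also have "\<dots> = shanks_term q (Suc n) (Suc n) - shanks_term q n n * q ^ (Suc n + n) + pentagonal_sum q n"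
    unfolding shanks_telescope[OF order_refl] Suc by simp
  also have "shanks_term q n n * q ^ (Suc n + n) = - ((-1) ^ Suc n * q ^ (Suc n * Suc n + \<Sum>{..<Suc n}))"
    by (simp add: shanks_term_def lessThan_Suc_atMost power_add mult_ac)
  also have "shanks_term q (Suc n) (Suc n) = (-1) ^ Suc n * q ^ (Suc n * Suc n + \<Sum>{..Suc n})"
    by (simp add: shanks_term_def)
  finally show ?case by (simp add: pentagonal_sum_def algebra_simps)
qed

lemma q_prod_convergent:
  fixes q :: complex
  assumes "norm q < 1"
  shows "convergent_prod (\<lambda>n. 1 - q ^ Suc n)"
proof -
  have "summable (\<lambda>n. norm q ^ Suc n)" using assms by (simp add: summable_geometric)
  then have "abs_convergent_prod (\<lambda>n. 1 - q ^ Suc n)"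
    by (simp add: abs_convergent_prod_conv_summable norm_power norm_mult)
  then show ?thesis by (rule abs_convergent_prod_imp_convergent_prod)
qed

lemma pentagonal_sum_tendsto:
  fixes q :: complex
  assumes q: "norm q < 1"
  shows "pentagonal_sum q \<longlonglongrightarrow> (\<Prod>n. 1 - q ^ Suc n)"
proof -
  define r where "r = norm q"
  have r: "0 \<le> r" "r < 1" using q by (simp_all add: r_def)
  \<comment> \<open>A uniform bound for all partial products, from
    \<open>norm (1 - q ^ Suc i) \<le> exp (r ^ i)\<close> and the geometric series.\<close>
  define C where "C = exp (1 / (1 - r))"
  have geo: "(\<Sum>i\<in>A. r ^ i) \<le> 1 / (1 - r)" if "finite A" for A
  proof -
    have "(\<Sum>i\<in>A. r ^ i) \<le> (\<Sum>i. r ^ i)"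
      using that r by (intro sum_le_suminf) (auto simp: summable_geometric)
    then show ?thesis using r by (simp add: suminf_geometric)
  qed
  have prod_le: "norm (\<Prod>i=s..<n. 1 - q ^ Suc i) \<le> C" for s n
  proof -
    have "norm (\<Prod>i=s..<n. 1 - q ^ Suc i) \<le> (\<Prod>i=s..<n. exp (r ^ i))"
      unfolding prod_norm[symmetric]
    proof (intro prod_mono conjI)
      fix i
      have "norm (1 - q ^ Suc i) \<le> 1 + r ^ Suc i"
        using norm_triangle_ineq4[of 1 "q ^ Suc i"] by (simp add: r_def norm_power norm_mult)
      also have "r ^ Suc i \<le> r ^ i" using r by (simp add: mult_left_le_one_le)
      then have "1 + r ^ Suc i \<le> exp (r ^ i)" using exp_ge_add_one_self[of "r ^ i"] by linarith
      finally show "norm (1 - q ^ Suc i) \<le> exp (r ^ i)" .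
    qed auto
    also have "\<dots> = exp (\<Sum>i=s..<n. r ^ i)" by (simp add: exp_sum)
    also have "\<dots> \<le> C" unfolding C_def using geo[of "{s..<n}"] by simp
    finally show ?thesis .
  qed
  have bound: "norm (pentagonal_sum q n - (\<Prod>i<n. 1 - q ^ Suc i)) \<le> C * (1 / (1 - r)) * r ^ n" for n
  proof -
    have "pentagonal_sum q n = (\<Sum>s\<in>insert 0 {1..n}. shanks_term q n s)"
      unfolding shanks_identity[symmetric] by (rule sum.cong) auto
    also have "\<dots> = (\<Prod>i<n. 1 - q ^ Suc i) + (\<Sum>s=1..n. shanks_term q n s)"
      by (simp add: shanks_term_def lessThan_atLeast0)
    finally have "norm (pentagonal_sum q n - (\<Prod>i<n. 1 - q ^ Suc i)) = norm (\<Sum>s=1..n. shanks_term q n s)" by simp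
    also have "\<dots> \<le> (\<Sum>s=1..n. C * r ^ n * r ^ s)"
    proof (rule sum_norm_le)
      fix s assume s: "s \<in> {1..n}"
      \<comment> \<open>For \<open>s \<ge> 1\<close> the exponent of a term is at least
        \<open>n + s\<close>, so these terms together are of order \<open>r ^ n\<close>.\<close>
      have "s \<le> \<Sum>{..s}" by (intro member_le_sum) auto
      moreover have "n \<le> s * n" using s by simp
      ultimately have "n + s \<le> s * n + \<Sum>{..s}" by linarith
      then have "r ^ (s * n + \<Sum>{..s}) \<le> r ^ (n + s)" using r by (intro power_decreasing) auto
      then have "norm (\<Prod>i=s..<n. 1 - q ^ Suc i) * r ^ (s * n + \<Sum>{..s}) \<le> C * r ^ (n + s)"
        using prod_le r by (intro mult_mono) (auto simp: C_def)
      then show "norm (shanks_term q n s) \<le> C * r ^ n * r ^ s"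
        unfolding shanks_term_def norm_mult norm_power r_def[symmetric] by (simp add: power_add mult_ac)
    qed
    also have "\<dots> = C * r ^ n * (\<Sum>s=1..n. r ^ s)" by (simp add: sum_distrib_left)
    also have "\<dots> \<le> C * r ^ n * (1 / (1 - r))"
      using r geo by (intro mult_left_mono) (auto simp: C_def)
    finally show ?thesis by (simp add: mult_ac)
  qed
  have "(\<lambda>n. C * (1 / (1 - r)) * r ^ n) \<longlonglongrightarrow> C * (1 / (1 - r)) * 0"
    using r by (intro tendsto_intros LIMSEQ_realpow_zero) auto
  then have "(\<lambda>n. C * (1 / (1 - r)) * r ^ n) \<longlonglongrightarrow> 0" by simp
  then have "(\<lambda>n. pentagonal_sum q n - (\<Prod>i<n. 1 - q ^ Suc i)) \<longlonglongrightarrow> 0"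
    by (rule Lim_null_comparison[OF always_eventually[OF allI[OF bound]]])
  moreover have "(\<lambda>n. \<Prod>i<n. 1 - q ^ Suc i) \<longlonglongrightarrow> (\<Prod>n. 1 - q ^ Suc n)"
    using convergent_prod_LIMSEQ[OF q_prod_convergent[OF q]]
    by (subst filterlim_sequentially_Suc[symmetric]) (simp only: lessThan_Suc_atMost)
  ultimately have "(\<lambda>n. pentagonal_sum q n - (\<Prod>i<n. 1 - q ^ Suc i) + (\<Prod>i<n. 1 - q ^ Suc i))
      \<longlonglongrightarrow> 0 + (\<Prod>n. 1 - q ^ Suc n)"
    by (rule tendsto_add)
  then show ?thesis by simp
qed

text \<open>Non-vanishing makes the multiplier unique, which the description in
  \<open>nu_eta\<close> requires.\<close>

lemma dedekind_eta_nonzero: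
  assumes "Im z > 0"
  shows "dedekind_eta z \<noteq> 0"
proof -
  define q where "q = exp (2 * of_real pi * \<i> * z)"
  have q: "norm q < 1" using assms by (simp add: q_def)
  have "q ^ Suc n \<noteq> 1" for n
  proof
    assume "q ^ Suc n = 1"
    then have "norm q ^ Suc n = 1" by (metis norm_one norm_power)
    moreover have "norm q ^ Suc n \<le> norm q ^ 1" using q by (intro power_decreasing) auto
    ultimately show False using q by simp
  qed
  then have "(\<Prod>n. 1 - q ^ Suc n) \<noteq> 0"
    by (intro prodinf_nonzero q_prod_convergent q) (simp only: right_minus_eq, metis)
  then show ?thesis by (simp add: dedekind_eta_def q_def)
qed

lemma two_times_sum_atMost: "2 * \<Sum>{..n} = n * (n + 1)" for n :: nat
  using gauss_sum_nat[of n] by (induction n) auto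

text \<open>Completing the square, \<open>1 + 24 * (k (3 k + 1) / 2) = (6 k + 1)^2\<close>, absorbs
  the prefactor \<open>q^(1/24)\<close>; negative \<open>k\<close> supply the other pentagonal
  numbers. Even \<open>k\<close> give the residue 1 modulo 12 with sign +, odd \<open>k\<close> the
  residue 7 with sign -.\<close>

lemma dedekind_eta_eq_theta:
  assumes z: "Im z > 0"
  shows "dedekind_eta z = theta 6 1 0 z - theta 6 7 0 z"
proof -
  define q where "q = exp (2 * of_real pi * \<i> * z)"
  have q: "norm q < 1" using z by (simp add: q_def)
  define f where "f = (\<lambda>k::int. (if even k then 1 else -1) * exp (pi * \<i> * z * (of_int ((6 * k + 1)\<^sup>2) / 12)))"
  define e0 where "e0 = exp (2 * of_real pi * \<i> * z / 24)"
  have summ: "f summable_on UNIV"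
  proof (rule abs_summable_summable)
    have "(\<lambda>k::int. \<bar>1 / 6 + of_int k\<bar> ^ 0 * exp (- (3 * pi * Im z) * (1 / 6 + of_int k)\<^sup>2)) summable_on UNIV"
      using z by (intro gauss_summable) auto
    then show "(\<lambda>k. norm (f k)) summable_on UNIV"
      by (rule summable_on_cong[THEN iffD1, rotated])
         (simp add: f_def norm_mult power2_eq_square algebra_simps)
  qed
  have f_pos: "f (int k) = e0 * ((-1) ^ k * q ^ (k * k + \<Sum>{..k}))" for k
  proof -
    have "(6 * int k + 1)\<^sup>2 = 1 + 24 * int (k * k + \<Sum>{..k})"
      using arg_cong[OF two_times_sum_atMost[of k], of int]
      by (simp add: power2_eq_square algebra_simps)
    then have "f (int k) = (if even k then 1 else -1) * exp (2 * of_real pi * \<i> * z / 24 + of_nat (k * k + \<Sum>{..k}) * (2 * of_real pi * \<i> * z))"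
      unfolding f_def by (simp add: field_simps)
    then show ?thesis by (simp add: e0_def q_def exp_add minus_one_power_iff flip: exp_of_nat_mult)
  qed
  have f_neg: "f (- int k) = e0 * ((-1) ^ k * q ^ (k * k + \<Sum>{..<k}))" if "k \<ge> 1" for k
  proof -
    have "\<Sum>{..k} = \<Sum>{..<k} + k" by (simp add: lessThan_Suc_atMost[symmetric])
    then have "(6 * (- int k) + 1)\<^sup>2 = 1 + 24 * int (k * k + \<Sum>{..<k})"
      using arg_cong[OF two_times_sum_atMost[of k], of int]
      by (simp add: power2_eq_square algebra_simps)
    then have "f (- int k) = (if even k then 1 else -1) * exp (2 * of_real pi * \<i> * z / 24 + of_nat (k * k + \<Sum>{..<k}) * (2 * of_real pi * \<i> * z))"
      unfolding f_def by (simp add: field_simps)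
    then show ?thesis by (simp add: e0_def q_def exp_add minus_one_power_iff flip: exp_of_nat_mult)
  qed
  have part: "(\<Sum>k\<in>{- int N..int N}. f k) = e0 * pentagonal_sum q N" for N
  proof (induction N)
    case 0
    then show ?case using f_pos[of 0] by (simp add: pentagonal_sum_def)
  next
    case (Suc N)
    have "{- int (Suc N)..int (Suc N)} = insert (- int (Suc N)) (insert (int (Suc N)) {- int N..int N})" by auto
    then have "(\<Sum>k\<in>{- int (Suc N)..int (Suc N)}. f k) =
        f (- int (Suc N)) + (f (int (Suc N)) + (\<Sum>k\<in>{- int N..int N}. f k))" by simp
    also have "f (- int (Suc N)) = e0 * ((-1) ^ Suc N * q ^ (Suc N * Suc N + \<Sum>{..<Suc N}))"
      by (rule f_neg) simp
    also have "e0 * ((-1) ^ Suc N * q ^ (Suc N * Suc N + \<Sum>{..<Suc N})) +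
        (f (int (Suc N)) + (\<Sum>k\<in>{- int N..int N}. f k)) = e0 * pentagonal_sum q (Suc N)"
      unfolding Suc f_pos by (simp add: pentagonal_sum_def algebra_simps)
    finally show ?case .
  qed
  have "(f has_sum infsum f UNIV) UNIV" using summ by simp
  then have "(\<lambda>N. \<Sum>k\<in>{- int N..int N}. f k) \<longlonglongrightarrow> infsum f UNIV"
    by (rule has_sum_int_symmetric_limit) auto
  then have "(\<lambda>N. e0 * pentagonal_sum q N) \<longlonglongrightarrow> infsum f UNIV" by (simp only: part)
  moreover have "(\<lambda>N. e0 * pentagonal_sum q N) \<longlonglongrightarrow> dedekind_eta z"
    unfolding dedekind_eta_def e0_def[symmetric] q_def[symmetric]
    by (intro tendsto_intros pentagonal_sum_tendsto q)
  ultimately have "dedekind_eta z = infsum f UNIV" by (rule LIMSEQ_unique[rotated])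
  also have "\<dots> = (\<Sum>s<2. \<Sum>\<^sub>\<infinity>l. f (int 2 * l + int s))"
    by (rule infsum_int_residue_split[OF summ]) simp
  also have "\<dots> = (\<Sum>\<^sub>\<infinity>l. f (2 * l)) + (\<Sum>\<^sub>\<infinity>l. f (2 * l + 1))"
    by (simp add: numeral_2_eq_2)
  also have "(\<Sum>\<^sub>\<infinity>l. f (2 * l)) = theta 6 1 0 z"
    unfolding theta_def f_def Let_def
    by (intro infsum_cong) (simp add: power2_eq_square field_simps, rule arg_cong[of _ _ exp], simp add: field_simps)
  also have "(\<Sum>\<^sub>\<infinity>l. f (2 * l + 1)) = - theta 6 7 0 z"
    unfolding theta_def f_def Let_def infsum_uminus[symmetric]
    by (intro infsum_cong) (simp add: power2_eq_square field_simps, rule arg_cong[of _ _ exp], simp add: field_simps)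
  finally show ?thesis by simp
qed

section \<open>Transformation laws under the modular group\<close>

lemma theta_uminus: "theta m (- r) j z = (-1) ^ j * theta m r j z"
proof -
  define F where "F = (\<lambda>r l::int. let n = (of_int l + of_int r / (2 * of_nat m) :: complex)
        in n ^ j * exp (2 * of_real pi * \<i> * of_nat m * n\<^sup>2 * z))"
  have bij: "bij (uminus :: int \<Rightarrow> int)" by (rule bij_uminus)
  have F_eq: "F (- r) (- l) = (-1) ^ j * F r l" for l
  proof -
    have E: "of_int (- l) + of_int (- r) / (2 * of_nat m) = - (of_int l + of_int r / (2 * of_nat m) :: complex)"
      by simp
    show ?thesis unfolding F_def Let_def E power2_minus
      by (subst power_minus) (simp only: mult.assoc)
  qed
  have "theta m (- r) j z = (\<Sum>\<^sub>\<infinity>l. F (- r) (- l))"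
    unfolding theta_def F_def by (rule infsum_reindex_bij_betw[OF bij, symmetric])
  also have "\<dots> = (\<Sum>\<^sub>\<infinity>l. (-1) ^ j * F r l)" unfolding F_eq ..
  also have "(\<Sum>\<^sub>\<infinity>l. (-1) ^ j * F r l) = (-1) ^ j * theta m r j z"
    unfolding theta_def F_def by (rule infsum_cmult_right')
  finally show ?thesis .
qed

lemma theta_add_period:
  assumes "m > 0"
  shows "theta m (r + 2 * int m) j z = theta m r j z"
proof -
  define F where "F = (\<lambda>l::int. let n = (of_int l + of_int r / (2 * of_nat m) :: complex)
        in n ^ j * exp (2 * of_real pi * \<i> * of_nat m * n\<^sup>2 * z))"
  have "theta m (r + 2 * int m) j z = (\<Sum>\<^sub>\<infinity>l. F (l + 1))"
    unfolding theta_def F_def Let_def using assms by (simp add: add_divide_distrib add_ac)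
  also have "\<dots> = theta m r j z"
    unfolding theta_def F_def[symmetric] by (rule infsum_shift_int)
  finally show ?thesis .
qed

lemma theta_translation:
  assumes "m > 0"
  shows "theta m r j (z + of_int k) = cis (pi * of_int (r\<^sup>2 * k) / (2 * m)) * theta m r j z"
proof -
  define F where "F = (\<lambda>z l::int. let n = (of_int l + of_int r / (2 * of_nat m) :: complex)
        in n ^ j * exp (2 * of_real pi * \<i> * of_nat m * n\<^sup>2 * z))"
  have F_eq: "F (z + of_int k) l = cis (pi * of_int (r\<^sup>2 * k) / (2 * m)) * F z l" for l
  proof -
    define n where "n = (of_int l + of_int r / (2 * of_nat m) :: complex)"
    \<comment> \<open>Since \<open>m * n\<^sup>2\<close> is \<open>r\<^sup>2 / (4 * m)\<close> plus
      the integer \<open>m * l\<^sup>2 + l * r\<close>, the phase does not depend on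
      \<open>l\<close>.\<close>
    have "2 * of_real pi * \<i> * of_nat m * n\<^sup>2 * of_int k =
        \<i> * of_real (pi * of_int (r\<^sup>2 * k) / (2 * m)) + \<i> * of_real (2 * pi * of_int ((m * l\<^sup>2 + l * r) * k))"
      unfolding n_def using assms by (simp add: field_simps power2_eq_square)
    then have "exp (2 * of_real pi * \<i> * of_nat m * n\<^sup>2 * of_int k) =
        cis (pi * of_int (r\<^sup>2 * k) / (2 * m)) * cis (2 * pi * of_int ((m * l\<^sup>2 + l * r) * k))"
      by (simp only: exp_add cis_conv_exp)
    then have "exp (2 * of_real pi * \<i> * of_nat m * n\<^sup>2 * of_int k) = cis (pi * of_int (r\<^sup>2 * k) / (2 * m))"
      by (simp only: cis_2pi_int mult_1_right)
    then show ?thesis unfolding F_def Let_def n_def[symmetric] distrib_left exp_add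
      by (simp only: mult_ac)
  qed
  have "theta m r j w = (\<Sum>\<^sub>\<infinity>l. F w l)" for w unfolding theta_def F_def ..
  then show ?thesis unfolding F_eq by (simp only: F_eq infsum_cmult_right')
qed

lemma cis_cong_2pi: "x = y + 2 * pi * of_int k \<Longrightarrow> cis x = cis y"
  by (simp add: cis_mult[symmetric] del: of_int_mult)

text \<open>The root of a point of the upper half-plane lies in the open first quadrant, so turning
  it by 45 degrees clockwise keeps it in the right half-plane, where roots are principal.\<close>

lemma csqrt_minus_i_times:
  assumes "Im z > 0"
  shows "csqrt (- \<i> * z) = cis (- pi / 4) * csqrt z"
proof (rule csqrt_unique)
  have "(cis (- pi / 4))\<^sup>2 = - \<i>" by (simp add: Complex.DeMoivre complex_eq_iff)
  then show "(cis (- pi / 4) * csqrt z)\<^sup>2 = - \<i> * z" by (simp add: power_mult_distrib)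
  have "Re (csqrt z) \<ge> 0" using csqrt_principal[of z] by (auto simp del: csqrt.sel)
  moreover have "2 * Re (csqrt z) * Im (csqrt z) = Im ((csqrt z)\<^sup>2)" by (simp only: Im_power2)
  then have "Re (csqrt z) * Im (csqrt z) > 0" using assms by (simp only: power2_csqrt)
  ultimately have "Re (csqrt z) > 0" "Im (csqrt z) > 0"
    by (auto simp: zero_less_mult_iff simp del: csqrt.sel)
  then show "0 < Re (cis (- pi / 4) * csqrt z) \<or> Re (cis (- pi / 4) * csqrt z) = 0 \<and> 0 \<le> Im (cis (- pi / 4) * csqrt z)"
    by (intro disjI1) (simp add: cos_45 sin_45 add_pos_pos del: csqrt.sel)
qed

lemma dedekind_eta_translation: "dedekind_eta (z + of_int k) = cis (pi * of_int k / 12) * dedekind_eta z"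
proof -
  have "exp (2 * of_real pi * \<i> * (z + of_int k)) = exp (2 * of_real pi * \<i> * z) * cis (2 * pi * of_int k)"
    unfolding cis_conv_exp by (simp add: distrib_left exp_add mult_ac)
  moreover have "exp (2 * of_real pi * \<i> * (z + of_int k) / 24) = exp (2 * of_real pi * \<i> * z / 24) * cis (pi * of_int k / 12)"
    unfolding cis_conv_exp exp_add[symmetric] by (rule arg_cong[of _ _ exp]) (simp add: field_simps)
  ultimately show ?thesis by (simp add: dedekind_eta_def)
qed

section \<open>Inversion for small indices: Fourier sums modulo 2, 6 and 12\<close>

lemma sum_lessThan_6: "(\<Sum>s<6::nat. f s) = f 0 + f 1 + f 2 + f 3 + f 4 + f 5"
  by (simp add: eval_nat_numeral add_ac)

lemma cis_60_multiples:
  "cis (pi / 3) = Complex (1 / 2) (sqrt 3 / 2)" "cis (pi * 2 / 3) = Complex (- 1 / 2) (sqrt 3 / 2)"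
  "cis (pi * 4 / 3) = Complex (- 1 / 2) (- sqrt 3 / 2)" "cis (pi * 5 / 3) = Complex (1 / 2) (- sqrt 3 / 2)"
  "cis (pi * 8 / 3) = Complex (- 1 / 2) (sqrt 3 / 2)" "cis (pi * 10 / 3) = Complex (- 1 / 2) (- sqrt 3 / 2)"
proof -
  show 1: "cis (pi / 3) = Complex (1 / 2) (sqrt 3 / 2)" "cis (pi * 2 / 3) = Complex (- 1 / 2) (sqrt 3 / 2)"
    using cos_120 sin_120 by (simp_all add: complex_eq_iff cos_60 sin_60 mult.commute)
  have "cis (pi * 4 / 3) = cis (- (pi * 2 / 3))" "cis (pi * 5 / 3) = cis (- (pi / 3))"
    "cis (pi * 8 / 3) = cis (pi * 2 / 3)" "cis (pi * 10 / 3) = cis (pi * 4 / 3)"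
    by (rule cis_cong_2pi[of _ _ 1], simp)+
  with 1 show "cis (pi * 4 / 3) = Complex (- 1 / 2) (- sqrt 3 / 2)" "cis (pi * 5 / 3) = Complex (1 / 2) (- sqrt 3 / 2)"
    "cis (pi * 8 / 3) = Complex (- 1 / 2) (sqrt 3 / 2)" "cis (pi * 10 / 3) = Complex (- 1 / 2) (- sqrt 3 / 2)"
    by (simp_all add: complex_eq_iff cis_cnj[symmetric] del: cis.sel)
qed

text \<open>The hypotheses say that \<open>g\<close> is odd modulo 6, as \<open>theta 3 s 1\<close>
  is in \<open>s\<close>. Pairing \<open>s\<close> with \<open>6 - s\<close> leaves sines, all equal
  to plus or minus \<open>sqrt 3 / 2\<close>.\<close>

lemma cis_sum_6:
  assumes "g 0 = 0" "g 3 = 0" "g 4 = - g 2" "g 5 = - g 1"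
  shows "(\<Sum>s<6. cis (2 * pi * (real s * 1) / 6) * g s) = \<i> * of_real (sqrt 3) * (g 1 + g 2)"
    and "(\<Sum>s<6. cis (2 * pi * (real s * 2) / 6) * g s) = \<i> * of_real (sqrt 3) * (g 1 - g 2)"
  using assms by (simp_all add: sum_lessThan_6 cis_60_multiples complex_eq_iff algebra_simps)

lemma theta_1_inversion:
  assumes z: "Im z > 0"
  shows "theta 1 0 0 (- 1 / z) = csqrt (- \<i> * z) / of_real (sqrt 2) * (theta 1 0 0 z + theta 1 1 0 z)"
    and "theta 1 1 0 (- 1 / z) = csqrt (- \<i> * z) / of_real (sqrt 2) * (theta 1 0 0 z - theta 1 1 0 z)"
  using theta_inversion[of 1 0 z 0] theta_inversion[of 1 0 z 1] z
  by (simp_all add: numeral_2_eq_2)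

lemma sum_lessThan_12:
  "(\<Sum>s<12::nat. f s) = f 0 + f 1 + f 2 + f 3 + f 4 + f 5 + f 6 + f 7 + f 8 + f 9 + f 10 + f 11"
  by (simp add: eval_nat_numeral add_ac)

lemma theta_3_inversion:
  assumes z: "Im z > 0"
  shows "theta 3 1 1 (- 1 / z) = csqrt (- \<i> * z) ^ 3 / of_real (sqrt 2) * (theta 3 1 1 z + theta 3 2 1 z)"
    and "theta 3 2 1 (- 1 / z) = csqrt (- \<i> * z) ^ 3 / of_real (sqrt 2) * (theta 3 1 1 z - theta 3 2 1 z)"
proof -
  have sym: "theta 3 (6 - r) 1 z = - theta 3 r 1 z" for r
    using theta_add_period[of 3 "- r" 1 z] theta_uminus[of 3 r 1 z] by (simp add: add.commute)
  have v: "theta 3 0 1 z = 0" "theta 3 3 1 z = 0" "theta 3 4 1 z = - theta 3 2 1 z" "theta 3 5 1 z = - theta 3 1 1 z"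
    using theta_uminus[of 3 0 1 z] sym[of 3] sym[of 2] sym[of 1] by simp_all
  have "(\<Sum>s<6. cis (2 * pi * (real s * 1) / 6) * theta 3 (int s) 1 z) = \<i> * of_real (sqrt 3) * (theta 3 1 1 z + theta 3 2 1 z)"
    "(\<Sum>s<6. cis (2 * pi * (real s * 2) / 6) * theta 3 (int s) 1 z) = \<i> * of_real (sqrt 3) * (theta 3 1 1 z - theta 3 2 1 z)"
    using cis_sum_6[of "\<lambda>s. theta 3 (int s) 1 z"] v by (simp_all only: of_nat_0 of_nat_1 of_nat_numeral)
  moreover have "sqrt 6 = sqrt 2 * sqrt 3" by (simp flip: real_sqrt_mult)
  ultimately show "theta 3 1 1 (- 1 / z) = csqrt (- \<i> * z) ^ 3 / of_real (sqrt 2) * (theta 3 1 1 z + theta 3 2 1 z)"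
    "theta 3 2 1 (- 1 / z) = csqrt (- \<i> * z) ^ 3 / of_real (sqrt 2) * (theta 3 1 1 z - theta 3 2 1 z)"
    using theta_inversion[of 3 1 z 1] theta_inversion[of 3 1 z 2] z
    by (simp_all add: mult.left_commute[of "csqrt (- (\<i> * z)) ^ 3" \<i>])
qed

text \<open>The characters for \<open>r = 1\<close> and \<open>r = 7\<close> differ by
  \<open>(-1) ^ s\<close>, so even residues cancel. Pairing the odd \<open>s\<close> with
  \<open>12 - s\<close> leaves cosines: the residue 3 drops out, while 1 and 7 receive opposite
  coefficients, which reproduces eta.\<close>

lemma dedekind_eta_inversion:
  assumes z: "Im z > 0"
  shows "dedekind_eta (- 1 / z) = csqrt (- \<i> * z) * dedekind_eta z"
proof -
  have Im: "Im (- 1 / z) > 0" using Im_moebius_int_pos[of 0 0 "-1" 1 z] z by (simp add: moebius_def)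
  have sym: "theta 6 (12 - r) 0 z = theta 6 r 0 z" for r
    using theta_add_period[of 6 "- r" 0 z] theta_uminus[of 6 r 0 z] by (simp add: add.commute)
  have v: "theta 6 11 0 z = theta 6 1 0 z" "theta 6 9 0 z = theta 6 3 0 z" "theta 6 5 0 z = theta 6 7 0 z"
    using sym[of 1] sym[of 3] sym[of 7] by simp_all
  have split: "cis (2 * pi * (real s * 7) / 12) = (-1) ^ s * cis (pi * real s / 6)" for s
  proof -
    have "cis (2 * pi * (real s * 7) / 12) = cis (real s * pi) * cis (pi * real s / 6)"
      unfolding cis_mult by (rule arg_cong[of _ _ cis]) (simp add: field_simps)
    also have "cis (real s * pi) = (-1) ^ s" unfolding Complex.DeMoivre[symmetric] by simp
    finally show ?thesis .
  qed
  have split': "cis (2 * pi * (real s * 1) / 12) = cis (pi * real s / 6)" for s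
    by (rule arg_cong[of _ _ cis]) simp
  have c: "cis (pi * 11 / 6) = cis (- (pi / 6))" "cis (pi * 3 / 2) = cis (- (pi / 2))" "cis (pi * 7 / 6) = cis (- (5 * pi / 6))"
    by (rule cis_cong_2pi[of _ _ 1], simp)+
  have c5: "cos (5 * pi / 6) = - sqrt 3 / 2"
    using cos_pi_minus[of "pi / 6"] by (simp add: cos_30 field_simps)
  have pairs: "cis (pi / 6) + cis (- (pi / 6)) = of_real (sqrt 3)" "cis (pi / 2) + cis (- (pi / 2)) = 0"
     "cis (5 * pi / 6) + cis (- (5 * pi / 6)) = - of_real (sqrt 3)"
    using c5 by (simp_all add: complex_eq_iff cos_30)
  define S where "S = (\<lambda>r. \<Sum>s<12. cis (2 * pi * (real s * of_int r) / 12) * theta 6 (int s) 0 z)"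
  have "S 1 - S 7 = (\<Sum>s<12. (1 - (-1) ^ s) * (cis (pi * real s / 6) * theta 6 (int s) 0 z))"
    unfolding S_def using split split' by (simp add: sum_subtractf[symmetric] algebra_simps)
  also have "\<dots> = 2 * ((cis (pi / 6) + cis (- (pi / 6))) * theta 6 1 0 z +
      (cis (pi / 2) + cis (- (pi / 2))) * theta 6 3 0 z + (cis (5 * pi / 6) + cis (- (5 * pi / 6))) * theta 6 7 0 z)"
    unfolding sum_lessThan_12 by (simp add: v c algebra_simps)
  also have "\<dots> = 2 * of_real (sqrt 3) * dedekind_eta z"
    unfolding pairs dedekind_eta_eq_theta[OF z] by (simp add: algebra_simps)
  finally have S: "S 1 - S 7 = 2 * of_real (sqrt 3) * dedekind_eta z" .
  have "sqrt 12 = 2 * sqrt 3" using real_sqrt_mult[of 4 3] by simp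
  moreover have "dedekind_eta (- 1 / z) = csqrt (- \<i> * z) / of_real (sqrt 12) * (S 1 - S 7)"
    unfolding dedekind_eta_eq_theta[OF Im] right_diff_distrib S_def
    using theta_inversion[of 6 0 z 1] theta_inversion[of 6 0 z 7] z by simp
  ultimately show ?thesis unfolding S by simp
qed

text \<open>
  The square root \<open>csqrt (c z + d)\<close> is a cocycle only up to a sign that is constant in \<open>z\<close>. The sign
  drops out of \<open>\<nu> ^ 8\<close>, and it occurs twice in the law for \<open>h\<close>.
\<close>

definition modular_law :: "int \<Rightarrow> int \<Rightarrow> int \<Rightarrow> int \<Rightarrow> complex \<Rightarrow> bool" where
  "modular_law a b c d \<nu> \<longleftrightarrow>
     (\<forall>z. Im z > 0 \<longrightarrow>
        dedekind_eta (moebius_int a b c d z) = \<nu> * csqrt (of_int c * z + of_int d) * dedekind_eta z) \<and>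
     (\<forall>z w. Im z > 0 \<longrightarrow> Im w > 0 \<longrightarrow>
        h (moebius_int a b c d z) (moebius_int a b c d w) =
          \<nu> ^ 8 * (of_int c * z + of_int d) * csqrt (of_int c * z + of_int d) *
            csqrt (of_int c * w + of_int d) * h z w)"

lemma cis_pi_div_12_power8: "cis (pi * of_int k / 12) ^ 8 = cis (2 * pi * of_int k / 3)"
  unfolding Complex.DeMoivre by (rule arg_cong[of _ _ cis]) simp

text \<open>In units of \<open>pi * k\<close> the two products in \<open>h\<close> acquire the
  phases 1/6 + 1/2 and 2/3 + 0. These agree, and equal eight times the phase 1/12 of eta.\<close>

lemma modular_law_translation: "modular_law 1 k 0 1 (cis (pi * of_int k / 12))"
proof -
  have "h (z + of_int k) (w + of_int k) = cis (2 * pi * of_int k / 3) * h z w" for z w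
  proof -
    have "theta 3 1 1 (z + of_int k) = cis (pi * of_int k / 6) * theta 3 1 1 z"
      "theta 3 2 1 (z + of_int k) = cis (2 * pi * of_int k / 3) * theta 3 2 1 z"
      "theta 1 0 0 (w + of_int k) = theta 1 0 0 w"
      "theta 1 1 0 (w + of_int k) = cis (pi * of_int k / 2) * theta 1 1 0 w"
      using theta_translation[of 3 1 1 z k] theta_translation[of 3 2 1 z k]
        theta_translation[of 1 0 0 w k] theta_translation[of 1 1 0 w k]
      by (simp_all add: mult_ac)
    moreover have "cis (pi * of_int k / 6) * cis (pi * of_int k / 2) = cis (2 * pi * of_int k / 3)"
      unfolding cis_mult by (rule arg_cong[of _ _ cis]) (simp add: field_simps)
    ultimately show ?thesis unfolding h_def by (simp add: algebra_simps)
  qed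
  then show ?thesis unfolding modular_law_def
    using dedekind_eta_translation by (simp add: moebius_def cis_pi_div_12_power8)
qed

lemma modular_law_inversion: "modular_law 0 (-1) 1 0 (cis (- pi / 4))"
  unfolding modular_law_def
proof (intro conjI allI impI)
  let ?\<kappa> = "cis (- pi / 4)"
  have k4: "?\<kappa> ^ 4 = -1" unfolding Complex.DeMoivre by (simp add: complex_eq_iff)
  then have k8: "?\<kappa> ^ 8 = 1" using power_mult[of ?\<kappa> 4 2] by simp
  fix z :: complex assume z: "Im z > 0"
  show "dedekind_eta (moebius_int 0 (-1) 1 0 z) = ?\<kappa> * csqrt (of_int 1 * z + of_int 0) * dedekind_eta z"
    using dedekind_eta_inversion[OF z] csqrt_minus_i_times[OF z] by (simp add: moebius_def)
  fix w :: complex assume w: "Im w > 0"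
  define x y where "x = csqrt (- \<i> * z)" and "y = csqrt (- \<i> * w)"
  have "complex_of_real (sqrt 2) * of_real (sqrt 2) = 2" by (simp flip: of_real_mult)
  then have r2: "A / of_real (sqrt 2) * B * (C / of_real (sqrt 2) * D) = A * C * (B * D) / 2" for A B C D :: complex
    by simp
  \<comment> \<open>The minus sign is the determinant of the common matrix acting on both pairs of
    thetas. It is compensated by \<open>cis (- pi / 4) ^ 4 = -1\<close>, which comes from moving
    \<open>- \<i>\<close> out of the four roots in \<open>x ^ 3 * y\<close>.\<close>
  have "h (- 1 / z) (- 1 / w) = - (x ^ 3 * y) * h z w"
    unfolding h_def theta_1_inversion[OF w] theta_3_inversion[OF z] x_def[symmetric] y_def[symmetric] r2
    by (simp add: field_simps)
  also have "- (x ^ 3 * y) = z * csqrt z * csqrt w"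
  proof -
    have "x ^ 3 * y = ?\<kappa> ^ 4 * ((csqrt z)\<^sup>2 * csqrt z * csqrt w)"
      unfolding x_def y_def csqrt_minus_i_times[OF z] csqrt_minus_i_times[OF w]
      by (simp only: power_mult_distrib power2_eq_square power3_eq_cube power4_eq_xxxx mult_ac)
    then show ?thesis unfolding k4 by simp
  qed
  finally show "h (moebius_int 0 (-1) 1 0 z) (moebius_int 0 (-1) 1 0 w) =
      ?\<kappa> ^ 8 * (of_int 1 * z + of_int 0) * csqrt (of_int 1 * z + of_int 0) * csqrt (of_int 1 * w + of_int 0) * h z w"
    unfolding k8 by (simp add: moebius_def)
qed

lemma csqrt_cocycle_sign:
  fixes a b c d a' b' c' d' :: int
  assumes det: "a * d - b * c = 1" and det': "a' * d' - b' * c' = 1"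
  defines "C \<equiv> c * a' + d * c'" and "D \<equiv> c * b' + d * d'"
  obtains \<epsilon> :: complex where "\<epsilon>\<^sup>2 = 1"
    "\<And>z. Im z > 0 \<Longrightarrow> csqrt (of_int c * moebius_int a' b' c' d' z + of_int d) * csqrt (of_int c' * z + of_int d') =
       \<epsilon> * csqrt (of_int C * z + of_int D)"
proof -
  define S where "S = {z. Im z > 0}"
  define A B where "A = a * a' + b * c'" and "B = a * b' + b * d'"
  have det'': "A * D - B * C = 1"
  proof -
    have "A * D - B * C = (a * d - b * c) * (a' * d' - b' * c')"
      unfolding A_def B_def C_def D_def by (simp add: algebra_simps)
    then show ?thesis by (simp add: det det')
  qed
  have "connected S" by (simp add: S_def convex_connected convex_halfspace_Im_gt)
  moreover have cont: "continuous_on S (\<lambda>z. csqrt (of_int c * z + of_int d))" if "a * d - b * c = 1" for a b c d :: int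
    unfolding S_def by (rule holomorphic_on_imp_continuous_on[OF csqrt_linear_holomorphic[OF that]])
  have "continuous_on S (moebius_int a' b' c' d')"
  proof (rule DERIV_continuous_on)
    fix p assume "p \<in> S"
    then show "(moebius_int a' b' c' d' has_field_derivative 1 / (of_int c' * p + of_int d')\<^sup>2) (at p within S)"
      by (intro moebius_int_has_field_derivative[OF det']) (auto simp: S_def)
  qed
  then have "continuous_on S (\<lambda>z. csqrt (of_int c * moebius_int a' b' c' d' z + of_int d))"
    by (rule continuous_on_compose2[OF cont[OF det]]) (auto simp: S_def intro: Im_moebius_int_pos[OF det'])
  then have "continuous_on S (\<lambda>z. csqrt (of_int c * moebius_int a' b' c' d' z + of_int d) * csqrt (of_int c' * z + of_int d'))"
    by (intro continuous_on_mult cont[OF det'])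
  moreover note cont[OF det'']
  moreover have "(csqrt (of_int c * moebius_int a' b' c' d' z + of_int d) * csqrt (of_int c' * z + of_int d'))\<^sup>2 =
      (csqrt (of_int C * z + of_int D))\<^sup>2" if "z \<in> S" for z
  proof -
    have "of_int c' * z + of_int d' \<noteq> 0"
      using that by (intro moebius_denom_nonzero[OF det']) (auto simp: S_def)
    then show ?thesis
      by (simp add: power_mult_distrib moebius_def C_def D_def distrib_right) (simp add: algebra_simps)
  qed
  moreover have "csqrt (of_int C * z + of_int D) \<noteq> 0" if "z \<in> S" for z
    using moebius_denom_nonzero[OF det'', of z] that by (simp add: S_def)
  ultimately show thesis
    by (rule square_eq_imp_global_sign) (use that in \<open>auto simp: S_def\<close>)
qed

lemma modular_law_compose:
  assumes det: "a * d - b * c = 1" and det': "a' * d' - b' * c' = 1"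
    and law: "modular_law a b c d \<nu>" and law': "modular_law a' b' c' d' \<nu>'"
  shows "\<exists>\<mu>. modular_law (a * a' + b * c') (a * b' + b * d') (c * a' + d * c') (c * b' + d * d') \<mu>"
proof -
  define C D where "C = c * a' + d * c'" and "D = c * b' + d * d'"
  let ?M = "moebius_int a b c d" and ?M' = "moebius_int a' b' c' d'"
  let ?MM = "moebius_int (a * a' + b * c') (a * b' + b * d') C D"
  obtain \<epsilon> where \<epsilon>: "\<epsilon>\<^sup>2 = 1" and sgn: "\<And>z. Im z > 0 \<Longrightarrow>
      csqrt (of_int c * ?M' z + of_int d) * csqrt (of_int c' * z + of_int d') = \<epsilon> * csqrt (of_int C * z + of_int D)"
    using csqrt_cocycle_sign[OF det det'] unfolding C_def D_def by blast
  have e8: "\<epsilon> ^ 8 = 1" using \<epsilon> power_mult[of \<epsilon> 2 4] by simp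
  have jnz: "of_int c' * z + of_int d' \<noteq> 0" if "Im z > 0" for z
    using moebius_denom_nonzero[OF det', of z] that by simp
  have j: "(of_int c * ?M' z + of_int d) * (of_int c' * z + of_int d') = of_int C * z + of_int D" if "Im z > 0" for z
    using jnz[OF that] by (simp add: moebius_def C_def D_def distrib_right) (simp add: algebra_simps)
  have comp: "?MM z = ?M (?M' z)" if z: "Im z > 0" for z
  proof -
    have n: "(of_int a * ?M' z + of_int b) * (of_int c' * z + of_int d') =
        of_int (a * a' + b * c') * z + of_int (a * b' + b * d')"
      using jnz[OF z] by (simp add: moebius_def distrib_right) (simp add: algebra_simps)
    have "?M (?M' z) = (of_int a * ?M' z + of_int b) * (of_int c' * z + of_int d') /
        ((of_int c * ?M' z + of_int d) * (of_int c' * z + of_int d'))"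
      using jnz[OF z] by (simp add: moebius_def)
    then show ?thesis unfolding n j[OF z] by (simp only: moebius_def)
  qed
  have M': "Im (?M' z) > 0" if "Im z > 0" for z by (rule Im_moebius_int_pos[OF det' that])
  have "modular_law (a * a' + b * c') (a * b' + b * d') C D (\<nu> * \<nu>' * \<epsilon>)"
    unfolding modular_law_def
  proof (intro conjI allI impI)
    fix z :: complex assume z: "Im z > 0"
    have "dedekind_eta (?MM z) = \<nu> * \<nu>' *
        (csqrt (of_int c * ?M' z + of_int d) * csqrt (of_int c' * z + of_int d')) * dedekind_eta z"
      using law law' M'[OF z] z unfolding comp[OF z] modular_law_def by simp
    then show "dedekind_eta (?MM z) = \<nu> * \<nu>' * \<epsilon> * csqrt (of_int C * z + of_int D) * dedekind_eta z"
      unfolding sgn[OF z] by simp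
    fix w :: complex assume w: "Im w > 0"
    have "h (?M (?M' z)) (?M (?M' w)) = \<nu> ^ 8 * (of_int c * ?M' z + of_int d) * csqrt (of_int c * ?M' z + of_int d) *
            csqrt (of_int c * ?M' w + of_int d) * h (?M' z) (?M' w)"
      using law M'[OF z] M'[OF w] unfolding modular_law_def by blast
    also have "h (?M' z) (?M' w) = \<nu>' ^ 8 * (of_int c' * z + of_int d') * csqrt (of_int c' * z + of_int d') *
            csqrt (of_int c' * w + of_int d') * h z w"
      using law' z w unfolding modular_law_def by blast
    finally have "h (?MM z) (?MM w) = (\<nu> * \<nu>') ^ 8 * ((of_int c * ?M' z + of_int d) * (of_int c' * z + of_int d')) *
        (csqrt (of_int c * ?M' z + of_int d) * csqrt (of_int c' * z + of_int d')) *
        (csqrt (of_int c * ?M' w + of_int d) * csqrt (of_int c' * w + of_int d')) * h z w"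
      unfolding comp[OF z] comp[OF w] by (simp only: power_mult_distrib mult_ac)
    also have "\<dots> = (\<nu> * \<nu>') ^ 8 * (of_int C * z + of_int D) * csqrt (of_int C * z + of_int D) *
        csqrt (of_int C * w + of_int D) * (\<epsilon>\<^sup>2) * h z w"
      unfolding sgn[OF z] sgn[OF w] j[OF z] by (simp only: power2_eq_square mult_ac)
    finally show "h (?MM z) (?MM w) = (\<nu> * \<nu>' * \<epsilon>) ^ 8 * (of_int C * z + of_int D) *
        csqrt (of_int C * z + of_int D) * csqrt (of_int C * w + of_int D) * h z w"
      by (simp add: power_mult_distrib \<epsilon> e8)
  qed
  then show ?thesis unfolding C_def D_def by blast
qed

text \<open>Euclidean algorithm on the bottom row: with \<open>d = c * q + r\<close>, the matrix is
  one with lower left entry \<open>- r\<close>, times the inversion, times the translation by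
  \<open>q\<close>.\<close>

lemma modular_law_exists:
  fixes a b c d :: int
  assumes "a * d - b * c = 1"
  shows "\<exists>\<nu>. modular_law a b c d \<nu>"
  using assms
proof (induction "nat \<bar>c\<bar>" arbitrary: a b c d rule: less_induct)
  case less
  show ?case
  proof (cases "c = 0")
    case True
    then have "a * d = 1" using less.prems by simp
    then consider "a = 1" "d = 1" | "a = -1" "d = -1" using zmult_eq_1_iff by auto
    then show ?thesis
    proof cases
      case 1
      then show ?thesis using True modular_law_translation by blast
    next
      case 2
      \<comment> \<open>The negative identity is the square of the inversion matrix.\<close>
      obtain \<mu> where "modular_law (-1) 0 0 (-1) \<mu>"
        using modular_law_compose[OF _ _ modular_law_inversion modular_law_inversion] by auto
      from modular_law_compose[OF _ _ this modular_law_translation[of "- b"]]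
      show ?thesis using 2 True by simp
    qed
  next
    case False
    define q r where "q = d div c" and "r = d mod c"
    have d: "d = c * q + r" by (simp add: q_def r_def)
    have "\<bar>- r\<bar> < \<bar>c\<bar>" using False by (simp add: r_def abs_mod_less)
    then have "nat \<bar>- r\<bar> < nat \<bar>c\<bar>" by simp
    moreover have det: "- (b - q * a) * c - a * (- r) = 1" using less.prems d by (simp add: algebra_simps)
    ultimately obtain \<nu> where "modular_law (- (b - q * a)) a (- r) c \<nu>" using less.hyps by blast
    from modular_law_compose[OF det _ this modular_law_inversion]
    obtain \<mu> where "modular_law a (b - q * a) c r \<mu>" by auto
    from modular_law_compose[OF _ _ this modular_law_translation[of q]]
    show ?thesis using det d by (simp add: algebra_simps)
  qed
qed

text \<open>The eta part of the law, evaluated at \<open>\<i>\<close>, determines the constant; the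
  \<open>h\<close> part then holds with \<open>nu_eta\<close> itself.\<close>

lemma modular_law_nu_eta:
  assumes det: "a * d - b * c = 1"
  shows "modular_law a b c d (nu_eta a b c d)"
proof -
  obtain \<nu> where \<nu>: "modular_law a b c d \<nu>" using modular_law_exists[OF det] by blast
  have "nu_eta a b c d = \<nu>" unfolding nu_eta_def
  proof (rule the_equality)
    show "\<forall>\<tau>\<in>upper_half_plane. dedekind_eta (moebius_int a b c d \<tau>) =
        \<nu> * csqrt (of_int c * \<tau> + of_int d) * dedekind_eta \<tau>"
      using \<nu> by (simp add: modular_law_def upper_half_plane_def)
    fix \<mu> assume \<mu>: "\<forall>\<tau>\<in>upper_half_plane. dedekind_eta (moebius_int a b c d \<tau>) =
        \<mu> * csqrt (of_int c * \<tau> + of_int d) * dedekind_eta \<tau>"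
    have "\<mu> * csqrt (of_int c * \<i> + of_int d) * dedekind_eta \<i> = dedekind_eta (moebius_int a b c d \<i>)"
      using \<mu> by (simp add: upper_half_plane_def)
    also have "\<dots> = \<nu> * csqrt (of_int c * \<i> + of_int d) * dedekind_eta \<i>"
      using \<nu> by (simp add: modular_law_def)
    finally show "\<mu> = \<nu>"
      using moebius_denom_nonzero[OF det, of \<i>] dedekind_eta_nonzero[of \<i>] by simp
  qed
  with \<nu> show ?thesis by simp
qed

text \<open>Used to pull the factor out of the outer integral by
  \<open>contour_integral_cmult\<close> without knowing integrability.\<close>

lemma nu_eta_nonzero:
  assumes det: "a * d - b * c = 1"
  shows "nu_eta a b c d \<noteq> 0"
proof
  assume "nu_eta a b c d = 0"
  then have "dedekind_eta (moebius_int a b c d \<i>) = 0"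
    using modular_law_nu_eta[OF det] by (simp add: modular_law_def)
  then show False using dedekind_eta_nonzero Im_moebius_int_pos[OF det, of \<i>] by simp
qed

section \<open>Assembling the two integrals\<close>

lemma h_holomorphic: "h z holomorphic_on {w. Im w > 0}"
  unfolding h_def[abs_def] by (intro holomorphic_intros theta_holomorphic) auto

theorem proposition5p5:
  fixes a b c d :: int and \<tau> w :: complex
  assumes "a * d - b * c = 1"
    and "\<tau> \<in> upper_half_plane" and "w \<in> upper_half_plane" and "\<tau> \<noteq> w"
  shows "Psi_hat (moebius (of_int a) (of_int b) (of_int c) (of_int d) \<tau>)
                 (moebius (of_int a) (of_int b) (of_int c) (of_int d) w) =
         nu_eta a b c d ^ 8 * (of_int c * \<tau> + of_int d)\<^sup>2 * Psi_hat \<tau> w"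
proof -
  let ?M = "moebius_int a b c d"
  note det = assms(1)
  have \<tau>: "Im \<tau> > 0" and w: "Im w > 0" using assms(2,3) by (simp_all add: upper_half_plane_def)
  define k where "k = nu_eta a b c d ^ 8 * (of_int c * \<tau> + of_int d)\<^sup>2"
  have k: "k \<noteq> 0"
    using nu_eta_nonzero[OF det] moebius_denom_nonzero[OF det, of \<tau>] \<tau> by (simp add: k_def)
  have "contour_integral (hgeodesic (?M \<tau>) (?M w))
        (\<lambda>w\<^sub>1. reg_integral (h w\<^sub>1) (?M \<tau>) w\<^sub>1 / csqrt (\<i> * (w\<^sub>1 - ?M \<tau>))) =
      contour_integral (hgeodesic \<tau> w)
        (\<lambda>p. reg_integral (h (?M p)) (?M \<tau>) (?M p) / csqrt (\<i> * (?M p - ?M \<tau>)) / (of_int c * p + of_int d)\<^sup>2)"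
    by (rule contour_integral_moebius_int[OF det \<tau> w])
  also have "\<dots> = contour_integral (hgeodesic \<tau> w) (\<lambda>p. k * (reg_integral (h p) \<tau> p / csqrt (\<i> * (p - \<tau>))))"
  proof (rule contour_integral_eq)
    fix p assume "p \<in> path_image (hgeodesic \<tau> w)"
    then have p: "Im p > 0" by (rule hgeodesic_in_Im_pos[OF \<tau> w])
    define J where "J = of_int c * p + of_int d"
    have J: "J \<noteq> 0" using moebius_denom_nonzero[OF det, of p] p by (simp add: J_def)
    show "reg_integral (h (?M p)) (?M \<tau>) (?M p) / csqrt (\<i> * (?M p - ?M \<tau>)) / (of_int c * p + of_int d)\<^sup>2 =
        k * (reg_integral (h p) \<tau> p / csqrt (\<i> * (p - \<tau>)))"
    \<comment> \<open>At the starting point both roots are \<open>csqrt 0 = 0\<close>, and division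
      by zero makes both integrands 0.\<close>
    proof (cases "p = \<tau>")
      case False
      have "reg_integral (h (?M p)) (?M \<tau>) (?M p) / csqrt (\<i> * (?M p - ?M \<tau>)) =
          nu_eta a b c d ^ 8 * J * csqrt J * (of_int c * \<tau> + of_int d)\<^sup>2 * csqrt J *
            (reg_integral (h p) \<tau> p / csqrt (\<i> * (p - \<tau>)))"
        unfolding J_def
      proof (rule reg_integral_moebius_int[OF det h_holomorphic _ \<tau> p])
        show "h (?M p) (?M p') = nu_eta a b c d ^ 8 * (of_int c * p + of_int d) * csqrt (of_int c * p + of_int d) *
            csqrt (of_int c * p' + of_int d) * h p p'" if "Im p' > 0" for p'
          using modular_law_nu_eta[OF det] p that unfolding modular_law_def by blast
      qed (use False in auto)
      \<comment> \<open>One root of \<open>J\<close> comes from the weight 3/2 of \<open>h\<close>,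
        the other from the regularised integral; the resulting \<open>J * J\<close> cancels the
        Jacobian.\<close>
      also have "\<dots> = k * J * (csqrt J)\<^sup>2 * (reg_integral (h p) \<tau> p / csqrt (\<i> * (p - \<tau>)))"
        unfolding k_def by (simp only: power2_eq_square mult_ac)
      finally have E: "reg_integral (h (?M p)) (?M \<tau>) (?M p) / csqrt (\<i> * (?M p - ?M \<tau>)) =
          k * J * J * (reg_integral (h p) \<tau> p / csqrt (\<i> * (p - \<tau>)))" by (simp only: power2_csqrt)
      show ?thesis unfolding E J_def[symmetric] using J by (simp add: power2_eq_square)
    qed simp
  qed
  also have "\<dots> = k * contour_integral (hgeodesic \<tau> w) (\<lambda>p. reg_integral (h p) \<tau> p / csqrt (\<i> * (p - \<tau>)))"
    by (rule contour_integral_cmult[OF k])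
  finally show ?thesis unfolding Psi_hat_def k_def[symmetric] by simp
qed

end
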